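(* Let $(X,\mathcal{A},\mu,T)$ be an ergodic probability preserving system, $(A_l)$ an asymptotically rare sequence in $\mathcal{A}$, and $(\psi_{A_l})_{l\ge1}$ a sequence of $\mathfrak{F}$-valued local observables for the $A_l$ such that $\psi_{A_l}\overset{\mu_{A_l}}{\Longrightarrow}\psi$ as $l\to\infty$ for some random element $\psi$ of $\mathfrak{F}$. Let $\Psi_{A_l}$ be the corresponding local processes. Suppose $\mathcal{B}^\pi_{\mathfrak{F}}$ is a $\pi$-system generating the Borel $\sigma$-algebra of $\mathfrak{F}$ with $\mathfrak{F}\in\mathcal{B}^\pi_{\mathfrak{F}}$, and $\Pr[\psi\in\partial F]=0$ for all $F\in\mathcal{B}^\pi_{\mathfrak{F}}$. Let $\nu_l:=\mu_{A_l}$ and assume that for every $F\in\mathcal{B}^\pi_{\mathfrak{F}}$ with $\Pr[\psi\in F]>0$ there are measurable $\tau_{l,F}:X\to\mathbb{N}_0$, $l\ge1$, such that, with $\nu_{l,F}:=(\nu_l)_{\{\psi_{A_l}\in F\}}$, we have $\nu_{l,F}(\tau_{l,F}<\varphi_{A_l})\to1$ as $l\to\infty$, while there is a compact subset $\mathfrak{K}_F$ of $(\mathfrak{P},d_{\mathfrak{P}})$ with $T^{\tau_{l,F}}_\ast\nu_{l,F}\in\mathfrak{K}_F$ for $l\ge1$. Then $$\widetilde\Psi_{A_l}\overset{\mu_{A_l}}{\Longrightarrow}\Psi^\ast\quad\text{and}\quad\Psi_{A_l}\overset{\mu}{\Longrightarrow}\Psi^\ast\qquad\text{as }l\to\infty,$$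 where $\Psi^\ast=(\psi^{\ast(j)})_{j\ge0}$ is an iid sequence in $\mathfrak{F}$ with $\mathrm{law}(\psi^{\ast(0)})=\mathrm{law}(\psi)$. More generally, this conclusion follows if for every $\varepsilon>0$ there are a sequence $(\nu_l)$ in $\mathfrak{P}$ with $d_{\mathfrak{P}}(\nu_l,\mu_{A_l})<\varepsilon$ for all $l$, and, for every $F\in\mathcal{B}^\pi_{\mathfrak{F}}$ with $\Pr[\psi\in F]>0$, a compact set $\mathfrak{K}_F\subseteq\mathfrak{P}$, measures $\nu_{l,F}\in\mathfrak{P}$ with $d_{\mathfrak{P}}(\nu_{l,F},(\nu_l)_{\{\psi_{A_l}\in F\}})\to0$, and measurable $\tau_{l,F}$ such that $\nu_{l,F}(\tau_{l,F}<\varphi_{A_l})\to1$ and $T^{\tau_{l,F}}_\ast\nu_{l,F}\in\mathfrak{K}_F$ for all $l$.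
   Context: $(\mathfrak{F},d_{\mathfrak{F}})$ compact metric space. For $A$ with $\mu(A)>0$: $\varphi_A(x):=\inf\{n\ge1:T^nx\in A\}$, $T_Ax:=T^{\varphi_A(x)}x$, $\mu_A:=\mu(A\cap\cdot)/\mu(A)$; $\nu_B:=\nu(B\cap\cdot)/\nu(B)$. Asymptotically rare: $0<\mu(A_l)\to0$. Local observable: measurable $\psi_A:A\to\mathfrak{F}$; $\Psi_A:=(\psi_A\circ T_A,\psi_A\circ T_A^2,\ldots):X\to\mathfrak{F}^{\mathbb{N}}$ and $\widetilde\Psi_A:=(\psi_A,\psi_A\circ T_A,\ldots):A\to\mathfrak{F}^{\mathbb{N}_0}$. $\mathfrak{P}$: probabilities $\nu\ll\mu$ with $d_{\mathfrak{P}}(\nu,\nu')=2\sup_A|\nu(A)-\nu'(A)|$. $T^\tau x:=T^{\tau(x)}x$, $T^\tau_\ast\nu:=\nu\circ(T^\tau)^{-1}$. $\partial F$ is the topological boundary. $\overset{\nu}{\Longrightarrow}$: weak convergence of laws under $\nu$. *)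

theory Defs
  imports "HOL-Probability.Probability"
begin

definition ergodic_pps :: "'a measure \<Rightarrow> ('a \<Rightarrow> 'a) \<Rightarrow> bool" where
  "ergodic_pps M T \<longleftrightarrow> prob_space M \<and> T \<in> measurable M M \<and> distr M M T = M \<and>
     (\<forall>B\<in>sets M. T -` B \<inter> space M = B \<longrightarrow> measure M B = 0 \<or> measure M B = 1)"

definition ret_time :: "('a \<Rightarrow> 'a) \<Rightarrow> 'a set \<Rightarrow> 'a \<Rightarrow> enat" where
  "ret_time T A x = (if \<exists>n\<ge>1. (T ^^ n) x \<in> A
                      then enat (LEAST n. n \<ge> 1 \<and> (T ^^ n) x \<in> A) else \<infinity>)"

text \<open>T_A x = T^(phi_A x) x (arbitrary on the null set where phi_A is infinite).\<close>
definition ret_map :: "('a \<Rightarrow> 'a) \<Rightarrow> 'a set \<Rightarrow> 'a \<Rightarrow> 'a" where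
  "ret_map T A x = (T ^^ (LEAST n. n \<ge> 1 \<and> (T ^^ n) x \<in> A)) x"

definition cond_meas :: "'a measure \<Rightarrow> 'a set \<Rightarrow> 'a measure" where
  "cond_meas N B = density N (\<lambda>x. indicator B x / emeasure N B)"

definition loc_proc :: "('a \<Rightarrow> 'a) \<Rightarrow> 'a set \<Rightarrow> ('a \<Rightarrow> 'b) \<Rightarrow> 'a \<Rightarrow> nat \<Rightarrow> 'b" where
  "loc_proc T A \<psi> x = (\<lambda>n. \<psi> ((ret_map T A ^^ Suc n) x))"

definition loc_proc0 :: "('a \<Rightarrow> 'a) \<Rightarrow> 'a set \<Rightarrow> ('a \<Rightarrow> 'b) \<Rightarrow> 'a \<Rightarrow> nat \<Rightarrow> 'b" where
  "loc_proc0 T A \<psi> x = (\<lambda>n. \<psi> ((ret_map T A ^^ n) x))"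

definition Pmeas :: "'a measure \<Rightarrow> 'a measure set" where
  "Pmeas M = {\<nu>. sets \<nu> = sets M \<and> prob_space \<nu> \<and> absolutely_continuous M \<nu>}"

definition dP :: "'a measure \<Rightarrow> 'a measure \<Rightarrow> 'a measure \<Rightarrow> real" where
  "dP M \<nu> \<nu>' = 2 * (SUP B\<in>sets M. \<bar>measure \<nu> B - measure \<nu>' B\<bar>)"

definition P_compact :: "'a measure \<Rightarrow> 'a measure set \<Rightarrow> bool" where
  "P_compact M K \<longleftrightarrow> K \<subseteq> Pmeas M \<and>
     (\<forall>s::nat \<Rightarrow> 'a measure. (\<forall>n. s n \<in> K) \<longrightarrow>
        (\<exists>(r::nat \<Rightarrow> nat) \<nu>. strict_mono r \<and> \<nu> \<in> K \<and> (\<lambda>n. dP M (s (r n)) \<nu>) \<longlonglongrightarrow> 0))"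

definition push_tau :: "('a \<Rightarrow> 'a) \<Rightarrow> ('a \<Rightarrow> nat) \<Rightarrow> 'a measure \<Rightarrow> 'a measure" where
  "push_tau T \<tau> \<nu> = distr \<nu> \<nu> (\<lambda>x. (T ^^ \<tau> x) x)"

definition weak_conv_law ::
  "(nat \<Rightarrow> 'a measure) \<Rightarrow> (nat \<Rightarrow> 'a \<Rightarrow> 'c::topological_space) \<Rightarrow> 'c measure \<Rightarrow> bool" where
  "weak_conv_law P X L \<longleftrightarrow>
     (\<forall>g::'c \<Rightarrow> real. continuous_on UNIV g \<and> bounded (range g) \<longrightarrow>
        (\<lambda>l. \<integral>x. g (X l x) \<partial>(P l)) \<longlonglongrightarrow> (\<integral>y. g y \<partial>L))"

end

theory Submission
  imports Defs
begin

text \<open>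
  Write \<open>G l = g \<circ> \<Psi>\<close> for a bounded test function \<open>g\<close> of the local process of \<open>A l\<close>. Replacing \<open>x\<close> by
  \<open>T x\<close> changes the process only if \<open>T x \<in> A l\<close>, so \<open>G l\<close> is asymptotically \<open>T\<close>-invariant in \<open>L\<^sup>1\<close>. By the
  ergodic theorem the integrals of \<open>G l\<close> under all measures of a compact subset of the
  absolutely continuous probabilities then merge with its \<open>\<mu>\<close>-integral. Since the process does not
  change before the first return, \<open>G l\<close> has the same integral under \<open>\<nu>\<^sub>F\<close> as under its image by \<open>T\<^sup>\<tau>\<close>, up to
  \<open>o(1)\<close>. Hence, under \<open>\<mu>\<close> conditioned on \<open>A l\<close>, the future \<open>G l\<close> is asymptotically uncorrelated with the
  events \<open>\<psi> l \<in> F\<close>. Their indicators span a dense subspace of \<open>L\<^sup>1(Q)\<close> and are \<open>Q\<close>-almost everywhere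
  continuous, which extends this to continuous functions of \<open>\<psi> l\<close>. As the return map preserves
  the conditional measure, induction on the number of coordinates yields independence.
\<close>

section \<open>An ergodic theorem for bounded functions\<close>

text \<open>The measures conditioned on visits to \<open>A l\<close> are the obstacle: as
  \<open>measure M (A l)\<close> tends to 0 they concentrate on ever smaller sets, and no single
  measure dominates them all uniformly. The delay \<tau> removes this. It moves them into one
  norm-compact set, and where it is shorter than the return time it leaves the future process
  unchanged. Compactness is essential because the merging of integrals is proved for one fixed
  measure at a time; a moving measure is replaced by its \<open>dP\<close>-limit along a
  subsequence. In the general form of the hypothesis the reference measures are only
  \<epsilon>-close to the conditional ones. Decorrelation is therefore shown with an error
  proportional to \<epsilon>, for a fixed test function and every \<epsilon>. A second obstacle is
  measurability. \<open>\<psi> l\<close> is given as measurable on \<open>A l\<close>, while all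
  integrals use the \<sigma>-algebra of \<open>M\<close>. The assumed weak convergence yields
  measurability on \<open>M\<close> from some index on, so the main argument is run for a shifted
  sequence.\<close>

locale ergodic_system = prob_space M for M :: "'a measure" and T :: "'a \<Rightarrow> 'a" +
  assumes T_measurable [measurable]: "T \<in> measurable M M"
    and T_invariant: "distr M M T = M"
    and T_ergodic: "B \<in> sets M \<Longrightarrow> T -` B \<inter> space M = B \<Longrightarrow> measure M B = 0 \<or> measure M B = 1"

lemma ergodic_system_iff: "ergodic_pps M T \<longleftrightarrow> ergodic_system M T"
  unfolding ergodic_pps_def ergodic_system_def ergodic_system_axioms_def by blast

context ergodic_system
begin

lemma T_power_measurable [measurable]: "(T ^^ n) \<in> measurable M M"
  by (induction n) auto

lemma T_in_space: "x \<in> space M \<Longrightarrow> T x \<in> space M"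
  using measurable_space[OF T_measurable] .

lemma T_power_in_space: "x \<in> space M \<Longrightarrow> (T ^^ n) x \<in> space M"
  using measurable_space[OF T_power_measurable] .

lemma distr_T_power: "distr M M (T ^^ n) = M"
proof (induction n)
  case 0
  show ?case by (simp add: id_def)
next
  case (Suc n)
  have "distr M M (T ^^ Suc n) = distr (distr M M (T ^^ n)) M T"
    by (subst distr_distr) (auto simp: o_def)
  then show ?case using Suc T_invariant by (simp add: o_def)
qed

lemma measure_vimage_T_power:
  assumes "B \<in> sets M"
  shows "measure M ((T ^^ n) -` B \<inter> space M) = measure M B"
  using measure_distr[OF T_power_measurable assms, of n] distr_T_power by simp

lemma measure_vimage_T:
  "B \<in> sets M \<Longrightarrow> measure M (T -` B \<inter> space M) = measure M B"
  using measure_vimage_T_power[of B 1] by simp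

lemma integral_T_power:
  fixes f :: "'a \<Rightarrow> real"
  assumes "f \<in> borel_measurable M"
  shows "(\<integral>x. f ((T ^^ n) x) \<partial>M) = (\<integral>x. f x \<partial>M)"
  using integral_distr[OF T_power_measurable assms, of n] distr_T_power by simp

lemma integral_T:
  fixes f :: "'a \<Rightarrow> real"
  assumes "f \<in> borel_measurable M"
  shows "(\<integral>x. f (T x) \<partial>M) = (\<integral>x. f x \<partial>M)"
  using integral_T_power[OF assms, of 1] by simp

lemma integrable_bounded:
  fixes f :: "'a \<Rightarrow> real"
  assumes "f \<in> borel_measurable M" "\<And>x. x \<in> space M \<Longrightarrow> \<bar>f x\<bar> \<le> C"
  shows "integrable M f"
  using assms by (intro integrable_const_bound[of _ C]) auto

section \<open>Maximal functions and almost sure convergence of Birkhoff averages\<close>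

definition birkhoff_sum :: "('a \<Rightarrow> real) \<Rightarrow> nat \<Rightarrow> 'a \<Rightarrow> real" where
  "birkhoff_sum u n x = (\<Sum>k<n. u ((T ^^ k) x))"

text \<open>This is the maximum of \<open>birkhoff_sum u k x\<close> over k \<le> n, with the empty
  sum 0 included. The recursion expresses it through the maximum at \<open>T x\<close>, which is the
  only way in which it is used.\<close>

primrec birkhoff_max :: "('a \<Rightarrow> real) \<Rightarrow> nat \<Rightarrow> 'a \<Rightarrow> real" where
  "birkhoff_max u 0 x = 0"
| "birkhoff_max u (Suc n) x = max 0 (u x + birkhoff_max u n (T x))"

lemma birkhoff_sum_Suc: "birkhoff_sum u (Suc n) x = u x + birkhoff_sum u n (T x)"
  unfolding birkhoff_sum_def by (subst sum.lessThan_Suc_shift) (simp add: funpow_swap1)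

lemma birkhoff_sum_le_max: "birkhoff_sum u n x \<le> birkhoff_max u n x"
proof (induction n arbitrary: x)
  case 0
  show ?case by (simp add: birkhoff_sum_def)
next
  case (Suc n)
  show ?case using Suc[of "T x"] by (simp add: birkhoff_sum_Suc)
qed

lemma birkhoff_max_nonneg: "0 \<le> birkhoff_max u n x"
  by (cases n) auto

lemma birkhoff_max_mono: "birkhoff_max u n x \<le> birkhoff_max u (Suc n) x"
proof (induction n arbitrary: x)
  case (Suc n)
  show ?case using Suc[of "T x"] by (auto simp del: birkhoff_max.simps(2) simp: birkhoff_max.simps(2)[of u n] birkhoff_max.simps(2)[of u "Suc n"])
qed simp

lemma birkhoff_max_measurable [measurable]:
  assumes [measurable]: "u \<in> borel_measurable M"
  shows "birkhoff_max u n \<in> borel_measurable M"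
proof (induction n)
  case (Suc n)
  note [measurable] = Suc
  have "(\<lambda>x. max 0 (u x + birkhoff_max u n (T x))) \<in> borel_measurable M" by measurable
  then show ?case by (simp add: fun_eq_iff cong: measurable_cong)
qed simp

lemma birkhoff_sum_measurable [measurable]:
  assumes [measurable]: "u \<in> borel_measurable M"
  shows "birkhoff_sum u n \<in> borel_measurable M"
  unfolding birkhoff_sum_def by measurable

lemma birkhoff_max_le:
  assumes "\<And>x. x \<in> space M \<Longrightarrow> \<bar>u x\<bar> \<le> C" "x \<in> space M"
  shows "birkhoff_max u n x \<le> n * C"
  using assms(2)
proof (induction n arbitrary: x)
  case (Suc n)
  have "birkhoff_max u n (T x) \<le> n * C" using Suc T_in_space by blast
  moreover have "\<bar>u x\<bar> \<le> C" using assms Suc by blast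
  moreover have "0 \<le> n * C" using calculation by simp
  ultimately show ?case by (auto simp: algebra_simps)
qed simp

text \<open>If the maxima \<open>M\<^sub>n\<close> were unbounded almost everywhere, then
  \<open>M\<^sub>n\<^sub>+\<^sub>1 - M\<^sub>n \<circ> T = max u (- M\<^sub>n \<circ> T)\<close>, whose integral is nonnegative, would converge to \<open>u\<close>.\<close>

lemma AE_birkhoff_sum_bounded_above:
  assumes u [measurable]: "u \<in> borel_measurable M"
    and bound: "\<And>x. x \<in> space M \<Longrightarrow> \<bar>u x\<bar> \<le> C"
    and neg: "(\<integral>x. u x \<partial>M) < 0"
  shows "AE x in M. \<exists>K. \<forall>n. birkhoff_sum u n x \<le> K"
proof -
  define B where "B = {x \<in> space M. \<forall>K::nat. \<exists>n. birkhoff_max u n x > K}"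
  have B [measurable]: "B \<in> sets M" unfolding B_def by measurable
  \<comment> \<open>As soon as \<open>birkhoff_max u (Suc n) x\<close> is positive it equals
    \<open>u x + birkhoff_max u n (T x)\<close>, so the maxima at \<open>x\<close> and at
    \<open>T x\<close> are bounded or unbounded together. Hence \<open>B\<close> is exactly
    invariant.\<close>
  have "T x \<in> B \<longleftrightarrow> x \<in> B" if x: "x \<in> space M" for x
  proof
    assume *: "T x \<in> B"
    show "x \<in> B" unfolding B_def
    proof safe
      fix K :: nat
      obtain n where "birkhoff_max u n (T x) > nat \<lceil>K + \<bar>u x\<bar>\<rceil>" using * unfolding B_def by blast
      then have "birkhoff_max u n (T x) > K + \<bar>u x\<bar>" by linarith
      then have "birkhoff_max u (Suc n) x > K" by auto
      then show "\<exists>n. birkhoff_max u n x > K" ..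
    qed fact
  next
    assume *: "x \<in> B"
    show "T x \<in> B" unfolding B_def
    proof safe
      fix K :: nat
      obtain n where n: "birkhoff_max u n x > nat \<lceil>K + \<bar>u x\<bar>\<rceil>" using * unfolding B_def by blast
      then have n2: "birkhoff_max u n x > K + \<bar>u x\<bar>" by linarith
      then obtain m where m: "n = Suc m" by (cases n) auto
      have "birkhoff_max u m (T x) > K" using n2 unfolding m by (auto simp: max_def split: if_splits)
      then show "\<exists>n. birkhoff_max u n (T x) > K" ..
    qed (use x T_in_space in auto)
  qed
  then have inv: "T -` B \<inter> space M = B" using B sets.sets_into_space by blast
  have "measure M B \<noteq> 1"
  proof
    assume "measure M B = 1"
    then have AEB: "AE x in M. x \<in> B" by (rule AE_prob_1)
    define v where "v n x = max (u x) (- birkhoff_max u n (T x))" for n x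
    have v [measurable]: "v n \<in> borel_measurable M" for n unfolding v_def by measurable
    have int_max: "integrable M (birkhoff_max u n)" for n
      using birkhoff_max_le[OF bound] birkhoff_max_nonneg[of u n]
      by (intro integrable_bounded[of _ "n * C"]) auto
    have int_maxT: "integrable M (\<lambda>x. birkhoff_max u n (T x))" for n
      using birkhoff_max_le[OF bound T_in_space] birkhoff_max_nonneg[of u n]
      by (intro integrable_bounded[of _ "n * C"]) auto
    have "(\<integral>x. v n x \<partial>M) \<ge> 0" for n
    proof -
      have "v n x = birkhoff_max u (Suc n) x - birkhoff_max u n (T x)" for x
        unfolding v_def by (auto simp: max_def)
      then have v_eq: "(\<integral>x. v n x \<partial>M) = (\<integral>x. birkhoff_max u (Suc n) x \<partial>M) - (\<integral>x. birkhoff_max u n (T x) \<partial>M)"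
        using int_max int_maxT by (simp del: birkhoff_max.simps)
      have "(\<integral>x. birkhoff_max u n (T x) \<partial>M) = (\<integral>x. birkhoff_max u n x \<partial>M)"
        by (intro integral_T) measurable
      also have "\<dots> \<le> (\<integral>x. birkhoff_max u (Suc n) x \<partial>M)"
        by (intro integral_mono int_max birkhoff_max_mono)
      finally show ?thesis using v_eq by (simp del: birkhoff_max.simps)
    qed
    moreover have "(\<lambda>n. \<integral>x. v n x \<partial>M) \<longlonglongrightarrow> (\<integral>x. u x \<partial>M)"
    proof (rule integral_dominated_convergence[where w = "\<lambda>_. C"])
      show "AE x in M. (\<lambda>n. v n x) \<longlonglongrightarrow> u x"
        using AEB
      proof eventually_elim
        case (elim x)
        then have "T x \<in> B" using inv by auto
        then obtain N where N: "birkhoff_max u N (T x) > nat \<lceil>\<bar>u x\<bar>\<rceil>" unfolding B_def by blast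
        have mono: "incseq (\<lambda>n. birkhoff_max u n (T x))" by (rule incseq_SucI) (rule birkhoff_max_mono)
        have "v n x = u x" if "n \<ge> N" for n
        proof -
          have "birkhoff_max u N (T x) \<le> birkhoff_max u n (T x)"
            using incseqD[OF mono that] .
          moreover have "birkhoff_max u N (T x) \<ge> \<bar>u x\<bar>" using N by linarith
          ultimately show ?thesis unfolding v_def by simp
        qed
        then show ?case by (intro tendsto_eventually) (auto simp: eventually_sequentially)
      qed
      \<comment> \<open>The maxima are nonnegative, so \<open>v n x\<close> lies between
        \<open>u x\<close> and \<open>max (u x) 0\<close>.\<close>
      show "AE x in M. norm (v n x) \<le> C" for n
      proof (rule AE_I2)
        fix x assume "x \<in> space M"
        then have "\<bar>u x\<bar> \<le> C" using bound by blast
        moreover have "0 \<le> birkhoff_max u n (T x)" by (rule birkhoff_max_nonneg)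
        ultimately show "norm (v n x) \<le> C" unfolding v_def by auto
      qed
    qed auto
    ultimately have "(\<integral>x. u x \<partial>M) \<ge> 0" by (intro LIMSEQ_le_const) auto
    then show False using neg by simp
  qed
  then have "measure M B = 0" using T_ergodic[OF B inv] by blast
  then have "AE x in M. x \<notin> B" by (simp add: AE_iff_measurable[OF B] emeasure_eq_measure prob_eq_0)
  then show ?thesis
    using AE_space
  proof eventually_elim
    case (elim x)
    then obtain K :: nat where "\<forall>n. birkhoff_max u n x \<le> K" unfolding B_def by (auto simp: not_less)
    then show ?case using birkhoff_sum_le_max order_trans by blast
  qed
qed

text \<open>Subtracting a constant halfway between the mean and the mean plus \<open>e\<close>
  leaves a function of integral \<open>- e / 2\<close>. Its Birkhoff sums are bounded above almost
  everywhere, and the bound disappears after division by n.\<close>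

lemma AE_birkhoff_average_le:
  assumes u [measurable]: "u \<in> borel_measurable M"
    and bound: "\<And>x. x \<in> space M \<Longrightarrow> \<bar>u x\<bar> \<le> C"
    and e: "e > 0"
  shows "AE x in M. \<forall>\<^sub>F n in sequentially. birkhoff_sum u n x / n \<le> (\<integral>x. u x \<partial>M) + e"
proof -
  define c where "c = (\<integral>x. u x \<partial>M) + e / 2"
  have int: "integrable M u" using bound by (intro integrable_bounded) auto
  have "AE x in M. \<exists>K. \<forall>n. birkhoff_sum (\<lambda>x. u x - c) n x \<le> K"
  proof (rule AE_birkhoff_sum_bounded_above)
    show "\<bar>u x - c\<bar> \<le> C + \<bar>c\<bar>" if "x \<in> space M" for x using bound[OF that] by linarith
    have "(\<integral>x. u x - c \<partial>M) = - e / 2" using int by (simp add: c_def prob_space)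
    then show "(\<integral>x. u x - c \<partial>M) < 0" using e by simp
  qed auto
  then show ?thesis
  proof eventually_elim
    case (elim x)
    then obtain K where K: "\<And>n. birkhoff_sum (\<lambda>x. u x - c) n x \<le> K" by blast
    have "(\<lambda>n. K / real n) \<longlonglongrightarrow> 0" by (rule lim_const_over_n)
    then have "\<forall>\<^sub>F n in sequentially. K / real n < e / 2" using e by (intro order_tendstoD) auto
    then show ?case
      using eventually_gt_at_top[of 0]
    proof eventually_elim
      case (elim n)
      have "birkhoff_sum u n x - n * c \<le> K"
        using K[of n] by (simp add: birkhoff_sum_def sum_subtractf)
      then have "birkhoff_sum u n x / n \<le> c + K / n" using elim by (simp add: field_simps)
      then show ?case using elim unfolding c_def by linarith
    qed
  qed
qed

text \<open>The one-sided estimate is applied to \<open>u\<close> and to \<open>- u\<close>, and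
  only the countably many errors 1 / (m + 1) are taken, so that a single null set suffices.\<close>

theorem AE_birkhoff_average_tendsto:
  assumes u [measurable]: "u \<in> borel_measurable M"
    and bound: "\<And>x. x \<in> space M \<Longrightarrow> \<bar>u x\<bar> \<le> C"
  shows "AE x in M. (\<lambda>n. birkhoff_sum u n x / n) \<longlonglongrightarrow> (\<integral>x. u x \<partial>M)"
proof -
  let ?c = "\<integral>x. u x \<partial>M"
  have "AE x in M. \<forall>m::nat. \<forall>\<^sub>F n in sequentially. birkhoff_sum u n x / n \<le> ?c + 1 / Suc m"
    unfolding AE_all_countable using AE_birkhoff_average_le[OF u bound] by simp
  moreover have "AE x in M. \<forall>m::nat. \<forall>\<^sub>F n in sequentially.
      birkhoff_sum (\<lambda>x. - u x) n x / n \<le> (\<integral>x. - u x \<partial>M) + 1 / Suc m"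
    unfolding AE_all_countable using AE_birkhoff_average_le[of "\<lambda>x. - u x" C] bound by simp
  ultimately show ?thesis
  proof eventually_elim
    case (elim x)
    show ?case
    proof (rule LIMSEQ_I)
      fix r :: real assume "r > 0"
      then obtain m where m: "1 / Suc m < r" using nat_approx_posE by blast
      have "\<forall>\<^sub>F n in sequentially. norm (birkhoff_sum u n x / n - ?c) < r"
        using elim(1)[rule_format, of m] elim(2)[rule_format, of m]
      proof eventually_elim
        case (elim n)
        have "birkhoff_sum (\<lambda>x. - u x) n x / n = - (birkhoff_sum u n x / n)"
          by (simp add: birkhoff_sum_def sum_negf)
        then show ?case using elim m by (simp add: abs_less_iff)
      qed
      then show "\<exists>no. \<forall>n\<ge>no. norm (birkhoff_sum u n x / n - ?c) < r"
        by (simp add: eventually_sequentially)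
    qed
  qed
qed

lemma birkhoff_sum_bound:
  assumes bound: "\<And>x. x \<in> space M \<Longrightarrow> \<bar>u x\<bar> \<le> C" and "x \<in> space M"
  shows "\<bar>birkhoff_sum u n x\<bar> \<le> n * C"
proof -
  have "\<bar>birkhoff_sum u n x\<bar> \<le> (\<Sum>k<n. \<bar>u ((T ^^ k) x)\<bar>)"
    unfolding birkhoff_sum_def by (rule sum_abs)
  also have "\<dots> \<le> (\<Sum>k<n. C)" using assms T_power_in_space by (intro sum_mono) blast
  finally show ?thesis by simp
qed

theorem birkhoff_average_tendsto_L1:
  assumes u [measurable]: "u \<in> borel_measurable M"
    and bound: "\<And>x. x \<in> space M \<Longrightarrow> \<bar>u x\<bar> \<le> C"
  shows "(\<lambda>n. \<integral>x. \<bar>birkhoff_sum u n x / n - (\<integral>x. u x \<partial>M)\<bar> \<partial>M) \<longlonglongrightarrow> 0"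
proof -
  let ?c = "\<integral>x. u x \<partial>M"
  have "(\<lambda>n. \<integral>x. \<bar>birkhoff_sum u n x / n - ?c\<bar> \<partial>M) \<longlonglongrightarrow> (\<integral>x. 0 \<partial>M)"
  proof (rule integral_dominated_convergence[where w = "\<lambda>_. C + \<bar>?c\<bar>"])
    have "AE x in M. (\<lambda>n. birkhoff_sum u n x / n) \<longlonglongrightarrow> ?c"
      by (rule AE_birkhoff_average_tendsto[OF u bound])
    then show "AE x in M. (\<lambda>n. \<bar>birkhoff_sum u n x / n - ?c\<bar>) \<longlonglongrightarrow> 0"
      by eventually_elim (metis LIM_zero tendsto_rabs_zero)
    show "AE x in M. norm \<bar>birkhoff_sum u n x / n - ?c\<bar> \<le> C + \<bar>?c\<bar>" for n
    proof (rule AE_I2)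
      fix x assume x: "x \<in> space M"
      have "\<bar>birkhoff_sum u n x / n\<bar> \<le> C"
      \<comment> \<open>For n = 0 the average is 0, by the convention on division by zero.\<close>
      proof (cases "n = 0")
        case True then show ?thesis using bound[OF x] by simp
      next
        case False then show ?thesis using birkhoff_sum_bound[OF bound x, where n = n] by (simp add: field_simps)
      qed
      then show "norm \<bar>birkhoff_sum u n x / n - ?c\<bar> \<le> C + \<bar>?c\<bar>"
        unfolding real_norm_def by linarith
    qed
  qed auto
  then show ?thesis by simp
qed

end

section \<open>Asymptotically invariant functions under absolutely continuous measures\<close>

lemma sum_indicator_eq_floor:
  fixes t :: real
  assumes "0 \<le> t" "t \<le> n"
  shows "(\<Sum>j\<in>{1..n}. if real j \<le> t then 1 else 0) = real_of_int \<lfloor>t\<rfloor>"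
proof -
  have "{j \<in> {1..n}. real j \<le> t} = {1..nat \<lfloor>t\<rfloor>}"
    using assms by (auto simp: le_nat_iff le_floor_iff)
  moreover have "(\<Sum>j\<in>{1..n}. if real j \<le> t then 1 else 0) = real (card {j \<in> {1..n}. real j \<le> t})"
    by (subst sum.inter_filter[symmetric]) auto
  ultimately show ?thesis using assms by simp
qed

text \<open>Layer-cake argument: \<open>f\<close> is within 1 / n of the average of the indicators
  of its n superlevel sets at the heights j / n. Each of these sets contributes at most \<delta>,
  hence so does their average, and the discretisation error vanishes as n grows.\<close>

lemma integral_diff_le_unit:
  fixes f :: "'a \<Rightarrow> real"
  assumes N: "finite_measure N" and N': "finite_measure N'" and sets: "sets N' = sets N"
    and f [measurable]: "f \<in> borel_measurable N"
    and bound: "\<And>x. x \<in> space N \<Longrightarrow> 0 \<le> f x \<and> f x \<le> 1"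
    and diff: "\<And>B. B \<in> sets N \<Longrightarrow> \<bar>measure N B - measure N' B\<bar> \<le> \<delta>"
  shows "\<bar>(\<integral>x. f x \<partial>N) - (\<integral>x. f x \<partial>N')\<bar> \<le> \<delta>"
proof -
  interpret N: finite_measure N by fact
  interpret N': finite_measure N' by fact
  have sp: "space N' = space N" using sets by (rule sets_eq_imp_space_eq)
  let ?m = "measure N (space N) + measure N' (space N)"
  have step: "\<bar>(\<integral>x. f x \<partial>N) - (\<integral>x. f x \<partial>N')\<bar> \<le> \<delta> + ?m / n" if n: "n > 0" for n :: nat
  proof -
    define B where "B j = {x \<in> space N. real j \<le> n * f x}" for j :: nat
    have B: "B j \<in> sets N" for j unfolding B_def by measurable
    define s where "s x = (\<Sum>j\<in>{1..n}. indicator (B j) x) / n" for x :: 'a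
    have s_int: "(\<integral>x. s x \<partial>P) = (\<Sum>j\<in>{1..n}. measure P (B j)) / n \<and> integrable P s"
      if "finite_measure P" "sets P = sets N" for P
    proof -
      interpret finite_measure P by fact
      have "integrable P (indicator (B j) :: 'a \<Rightarrow> real)" for j using B that by (simp add: less_top[symmetric])
      moreover have "B j \<inter> space P = B j" for j using sets.sets_into_space[OF B] sets_eq_imp_space_eq[OF that(2)] by auto
      ultimately show ?thesis unfolding s_def by simp
    qed
    have close: "\<bar>f x - s x\<bar> \<le> 1 / n" if "x \<in> space N" for x
    proof -
      have "s x = real_of_int \<lfloor>n * f x\<rfloor> / n"
      proof -
        have "indicator (B j) x = (if real j \<le> n * f x then 1 else (0::real))" for j
          using that by (simp add: B_def indicator_def)
        then show ?thesis
          using sum_indicator_eq_floor[of "n * f x" n] bound[OF that] n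
          by (simp only: s_def) (simp add: mult_left_le)
      qed
      then have "f x - s x = (n * f x - \<lfloor>n * f x\<rfloor>) / n" using n by (simp add: field_simps)
      moreover have "0 \<le> n * f x - \<lfloor>n * f x\<rfloor>" "n * f x - \<lfloor>n * f x\<rfloor> \<le> 1" by linarith+
      ultimately show ?thesis by (simp add: divide_right_mono)
    qed
    have approx: "\<bar>(\<integral>x. f x \<partial>P) - (\<integral>x. s x \<partial>P)\<bar> \<le> measure P (space N) / n"
      if P: "finite_measure P" "sets P = sets N" for P
    proof -
      interpret finite_measure P by fact
      have sP: "space P = space N" using P(2) by (rule sets_eq_imp_space_eq)
      have [measurable]: "f \<in> borel_measurable P" using f P(2) measurable_cong_sets by blast
      have fi: "integrable P f" using bound sP by (intro integrable_const_bound[of _ 1]) auto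
      have si: "integrable P s" using s_int[OF P] by blast
      have "\<bar>(\<integral>x. f x \<partial>P) - (\<integral>x. s x \<partial>P)\<bar> = \<bar>\<integral>x. f x - s x \<partial>P\<bar>" using fi si by simp
      also have "\<dots> \<le> (\<integral>x. \<bar>f x - s x\<bar> \<partial>P)" by (rule integral_abs_bound)
      also have "\<dots> \<le> (\<integral>x. 1 / n \<partial>P)" using fi si close sP by (intro integral_mono) auto
      finally show ?thesis using sP by simp
    qed
    have "\<bar>(\<integral>x. s x \<partial>N) - (\<integral>x. s x \<partial>N')\<bar> = \<bar>\<Sum>j\<in>{1..n}. measure N (B j) - measure N' (B j)\<bar> / n"
      using s_int[OF N] s_int[OF N' sets] n by (simp add: sum_subtractf diff_divide_distrib[symmetric])
    also have "\<dots> \<le> (\<Sum>j\<in>{1..n}. \<delta>) / n"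
      using diff[OF B] by (intro divide_right_mono order_trans[OF sum_abs] sum_mono) auto
    also have "\<dots> = \<delta>" using n by simp
    finally show ?thesis using approx[OF N] approx[OF N' sets] by (simp add: add_divide_distrib)
  qed
  have "(\<lambda>n. \<delta> + ?m / real n) \<longlonglongrightarrow> \<delta> + 0"
    by (intro tendsto_add tendsto_const lim_const_over_n)
  then show ?thesis
    using step by (intro LIMSEQ_le_const[of _ "\<delta>"]) (auto intro!: exI[of _ 1])
qed

text \<open>Rescaling [-C, C] to [0, 1] costs the factor 2 * C. The third C * \<delta> pays for the
  shift, because the total masses may differ: the measures are only finite, as
  \<open>cond_meas N B\<close> is the zero measure when \<open>B\<close> is null.\<close>

lemma integral_diff_le:
  fixes f :: "'a \<Rightarrow> real"
  assumes N: "finite_measure N" and N': "finite_measure N'" and sets: "sets N' = sets N"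
    and f [measurable]: "f \<in> borel_measurable N"
    and bound: "\<And>x. x \<in> space N \<Longrightarrow> \<bar>f x\<bar> \<le> C" and C: "C > 0"
    and diff: "\<And>B. B \<in> sets N \<Longrightarrow> \<bar>measure N B - measure N' B\<bar> \<le> \<delta>"
  shows "\<bar>(\<integral>x. f x \<partial>N) - (\<integral>x. f x \<partial>N')\<bar> \<le> 3 * C * \<delta>"
proof -
  have sp: "space N' = space N" using sets by (rule sets_eq_imp_space_eq)
  let ?g = "\<lambda>x. (f x + C) / (2 * C)"
  have a: "\<bar>(\<integral>x. ?g x \<partial>N) - (\<integral>x. ?g x \<partial>N')\<bar> \<le> \<delta>"
  proof (rule integral_diff_le_unit[OF N N' sets])
    show "0 \<le> ?g x \<and> ?g x \<le> 1" if "x \<in> space N" for x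
      using bound[OF that] C by (simp add: field_simps abs_le_iff)
  qed (auto intro: diff)
  have "(\<integral>x. f x \<partial>P) = 2 * C * (\<integral>x. ?g x \<partial>P) - C * measure P (space N)"
    if P: "finite_measure P" "sets P = sets N" for P
  proof -
    interpret finite_measure P by fact
    have sP: "space P = space N" using P(2) by (rule sets_eq_imp_space_eq)
    have [measurable]: "f \<in> borel_measurable P" using f P(2) measurable_cong_sets by blast
    have fi: "integrable P f" using bound sP by (intro integrable_const_bound[of _ C]) auto
    show ?thesis using fi C sP by (simp add: field_simps)
  qed
  from this[OF N] this[OF N' sets]
  have eq: "(\<integral>x. f x \<partial>N) - (\<integral>x. f x \<partial>N') = 2 * C * ((\<integral>x. ?g x \<partial>N) - (\<integral>x. ?g x \<partial>N'))
      - C * (measure N (space N) - measure N' (space N))"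
    by (simp add: algebra_simps)
  have b: "\<bar>measure N (space N) - measure N' (space N)\<bar> \<le> \<delta>" by (rule diff) simp
  have "\<bar>(\<integral>x. f x \<partial>N) - (\<integral>x. f x \<partial>N')\<bar> \<le> 2 * C * \<delta> + C * \<delta>"
  proof -
    let ?a = "(\<integral>x. ?g x \<partial>N) - (\<integral>x. ?g x \<partial>N')" and ?b = "measure N (space N) - measure N' (space N)"
    have "\<bar>2 * C * ?a - C * ?b\<bar> \<le> \<bar>2 * C * ?a\<bar> + \<bar>C * ?b\<bar>" by (rule abs_triangle_ineq4)
    also have "\<dots> = 2 * C * \<bar>?a\<bar> + C * \<bar>?b\<bar>" using C by (simp add: abs_mult)
    also have "\<dots> \<le> 2 * C * \<delta> + C * \<delta>"
      using C a b by (intro add_mono mult_left_mono) auto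
    finally show ?thesis unfolding eq .
  qed
  then show ?thesis by simp
qed

lemma abs_measure_diff_le_dP:
  assumes N: "finite_measure N" "sets N = sets M" and N': "finite_measure N'" "sets N' = sets M"
    and B: "B \<in> sets M"
  shows "\<bar>measure N B - measure N' B\<bar> \<le> dP M N N' / 2"
proof -
  interpret N: finite_measure N by fact
  interpret N': finite_measure N' by fact
  have "bdd_above ((\<lambda>B. \<bar>measure N B - measure N' B\<bar>) ` sets M)"
  proof (rule bdd_aboveI2)
    fix B assume "B \<in> sets M"
    show "\<bar>measure N B - measure N' B\<bar> \<le> measure N (space N) + measure N' (space N')"
      using N.bounded_measure[of B] N'.bounded_measure[of B] by (smt (verit) measure_nonneg)
  qed
  from cSUP_upper[OF B this] show ?thesis by (simp add: dP_def)
qed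

lemma integral_diff_le_dP:
  fixes f :: "'a \<Rightarrow> real"
  assumes N: "finite_measure N" "sets N = sets M" and N': "finite_measure N'" "sets N' = sets M"
    and f: "f \<in> borel_measurable M"
    and bound: "\<And>x. x \<in> space M \<Longrightarrow> \<bar>f x\<bar> \<le> C" and C: "C > 0"
  shows "\<bar>(\<integral>x. f x \<partial>N) - (\<integral>x. f x \<partial>N')\<bar> \<le> 2 * C * dP M N N'"
proof -
  have sp: "space N = space M" using N(2) by (rule sets_eq_imp_space_eq)
  have "\<bar>(\<integral>x. f x \<partial>N) - (\<integral>x. f x \<partial>N')\<bar> \<le> 3 * C * (dP M N N' / 2)"
    using N N' f bound C abs_measure_diff_le_dP[OF N N'] sp
    by (intro integral_diff_le) (auto cong: measurable_cong_sets)
  also have "\<dots> \<le> 2 * C * dP M N N'"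
    \<comment> \<open>The instance at the empty set says that \<open>dP\<close> is nonnegative, so
      the constant 3 / 2 may be rounded up to 2.\<close>
    using C abs_measure_diff_le_dP[OF N N', of "{}"] by simp
  finally show ?thesis .
qed

section \<open>Merging of integrals of asymptotically invariant functions\<close>

context ergodic_system
begin

lemma abs_integral_mult_le:
  fixes f u :: "'a \<Rightarrow> real"
  assumes "integrable M f" "u \<in> borel_measurable M" "\<And>x. x \<in> space M \<Longrightarrow> \<bar>u x\<bar> \<le> D"
  shows "\<bar>\<integral>x. f x * u x \<partial>M\<bar> \<le> D * (\<integral>x. \<bar>f x\<bar> \<partial>M)"
proof -
  have "\<bar>\<integral>x. f x * u x \<partial>M\<bar> \<le> (\<integral>x. \<bar>f x * u x\<bar> \<partial>M)" by (rule integral_abs_bound)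
  also have "\<dots> \<le> (\<integral>x. D * \<bar>f x\<bar> \<partial>M)"
  proof (rule integral_mono_AE)
    have b: "\<bar>f x * u x\<bar> \<le> D * \<bar>f x\<bar>" if "x \<in> space M" for x
      using mult_left_mono[OF assms(3)[OF that], of "\<bar>f x\<bar>"] by (simp add: abs_mult mult.commute)
    show "integrable M (\<lambda>x. D * \<bar>f x\<bar>)" using assms(1) by simp
    then show "integrable M (\<lambda>x. \<bar>f x * u x\<bar>)"
      using assms order_trans[OF b abs_ge_self]
      by (intro Bochner_Integration.integrable_bound[OF \<open>integrable M (\<lambda>x. D * \<bar>f x\<bar>)\<close>]) (auto intro!: AE_I2)
    show "AE x in M. \<bar>f x * u x\<bar> \<le> D * \<bar>f x\<bar>" using b by auto
  qed
  finally show ?thesis by simp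
qed

text \<open>Invariance of \<open>M\<close> allows \<open>u\<close> to be replaced by its composition
  with \<open>T ^^ k\<close> at a cost of at most k times D times the invariance defect of
  \<open>f l\<close>. Averaging over k < n puts a Birkhoff average in place of \<open>u\<close>, and
  the \<open>L1\<close> ergodic theorem puts the mean in place of that average. The first cost grows
  with n, so n is fixed before l tends to infinity.\<close>

lemma asymptotically_invariant_tendsto_bounded:
  fixes f :: "nat \<Rightarrow> 'a \<Rightarrow> real"
  assumes f [measurable]: "\<And>l. f l \<in> borel_measurable M"
    and fC: "\<And>l x. x \<in> space M \<Longrightarrow> \<bar>f l x\<bar> \<le> C"
    and inv: "(\<lambda>l. \<integral>x. \<bar>f l (T x) - f l x\<bar> \<partial>M) \<longlonglongrightarrow> 0"
    and u [measurable]: "u \<in> borel_measurable M"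
    and uD: "\<And>x. x \<in> space M \<Longrightarrow> \<bar>u x\<bar> \<le> D"
  shows "(\<lambda>l. (\<integral>x. f l x * u x \<partial>M) - (\<integral>x. f l x \<partial>M) * (\<integral>x. u x \<partial>M)) \<longlonglongrightarrow> 0"
proof -
  define \<delta> where "\<delta> l = (\<integral>x. \<bar>f l (T x) - f l x\<bar> \<partial>M)" for l
  let ?c = "\<integral>x. u x \<partial>M"
  obtain x0 where x0: "x0 \<in> space M" using not_empty by blast
  have D0: "D \<ge> 0" and C0: "C \<ge> 0" using uD[OF x0] fC[OF x0] by (auto intro: order_trans[OF abs_ge_zero])
  have fi: "integrable M (f l)" for l using fC by (intro integrable_bounded) auto
  have fTi: "integrable M (\<lambda>x. f l (T x))" for l using fC T_in_space by (intro integrable_bounded[of _ C]) auto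
  have prod_int: "integrable M (\<lambda>x. g x * w x)"
    if [measurable]: "g \<in> borel_measurable M" "w \<in> borel_measurable M" and
      "\<And>x. x \<in> space M \<Longrightarrow> \<bar>g x\<bar> \<le> a" "\<And>x. x \<in> space M \<Longrightarrow> \<bar>w x\<bar> \<le> b" for g w :: "'a \<Rightarrow> real" and a b
    using that(3,4) by (intro integrable_bounded[of _ "a * b"]) (auto simp: abs_mult intro!: mult_mono' )
  have step: "\<bar>(\<integral>x. f l x * w x \<partial>M) - (\<integral>x. f l x * w (T x) \<partial>M)\<bar> \<le> D * \<delta> l"
    if w [measurable]: "w \<in> borel_measurable M" and wD: "\<And>x. x \<in> space M \<Longrightarrow> \<bar>w x\<bar> \<le> D" for w l
  proof -
    have "(\<integral>x. f l x * w x \<partial>M) = (\<integral>x. f l (T x) * w (T x) \<partial>M)" by (rule integral_T[symmetric]) measurable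
    moreover have "(\<integral>x. f l (T x) * w (T x) \<partial>M) - (\<integral>x. f l x * w (T x) \<partial>M)
        = (\<integral>x. (f l (T x) - f l x) * w (T x) \<partial>M)"
    proof -
      have "integrable M (\<lambda>x. f l (T x) * w (T x))" "integrable M (\<lambda>x. f l x * w (T x))"
        using fC wD T_in_space by (auto intro!: prod_int[of _ _ C D])
      then show ?thesis by (simp add: left_diff_distrib)
    qed
    ultimately show ?thesis unfolding \<delta>_def
      using abs_integral_mult_le[of "\<lambda>x. f l (T x) - f l x" "\<lambda>x. w (T x)" D] fi fTi wD T_in_space by simp
  qed
  have steps: "\<bar>(\<integral>x. f l x * u x \<partial>M) - (\<integral>x. f l x * u ((T ^^ k) x) \<partial>M)\<bar> \<le> k * (D * \<delta> l)" for l k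
  proof (induction k)
    case (Suc k)
    have "\<bar>(\<integral>x. f l x * u ((T ^^ k) x) \<partial>M) - (\<integral>x. f l x * u ((T ^^ k) (T x)) \<partial>M)\<bar> \<le> D * \<delta> l"
      using uD T_power_in_space by (intro step) auto
    then show ?case using Suc by (simp add: funpow_swap1 algebra_simps)
  qed simp
  have avg: "\<bar>(\<integral>x. f l x * u x \<partial>M) - (\<integral>x. f l x * (birkhoff_sum u n x / n) \<partial>M)\<bar> \<le> n * (D * \<delta> l)"
    if n: "n > 0" for n l
  proof -
    have "\<delta> l \<ge> 0" unfolding \<delta>_def by simp
    have ki: "integrable M (\<lambda>x. f l x * u ((T ^^ k) x))" for k
      using fC uD T_power_in_space by (intro prod_int[of _ _ C D]) auto
    have "(\<integral>x. f l x * (birkhoff_sum u n x / n) \<partial>M) = (\<integral>x. (\<Sum>k<n. f l x * u ((T ^^ k) x)) / n \<partial>M)"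
      by (simp add: birkhoff_sum_def sum_distrib_left)
    also have "\<dots> = (\<Sum>k<n. (\<integral>x. f l x * u ((T ^^ k) x) \<partial>M)) / n" using ki by simp
    finally have "(\<integral>x. f l x * u x \<partial>M) - (\<integral>x. f l x * (birkhoff_sum u n x / n) \<partial>M)
      = (\<Sum>k<n. (\<integral>x. f l x * u x \<partial>M) - (\<integral>x. f l x * u ((T ^^ k) x) \<partial>M)) / n"
      using n by (simp add: sum_subtractf field_simps)
    then have "\<bar>(\<integral>x. f l x * u x \<partial>M) - (\<integral>x. f l x * (birkhoff_sum u n x / n) \<partial>M)\<bar>
      = \<bar>\<Sum>k<n. (\<integral>x. f l x * u x \<partial>M) - (\<integral>x. f l x * u ((T ^^ k) x) \<partial>M)\<bar> / n" by simp
    also have "\<dots> \<le> (\<Sum>k<n. n * (D * \<delta> l)) / n"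
    proof (intro divide_right_mono order_trans[OF sum_abs] sum_mono)
      fix k assume "k \<in> {..<n}"
      then have "real k * (D * \<delta> l) \<le> n * (D * \<delta> l)" using D0 \<open>\<delta> l \<ge> 0\<close> by (intro mult_right_mono) auto
      then show "\<bar>(\<integral>x. f l x * u x \<partial>M) - (\<integral>x. f l x * u ((T ^^ k) x) \<partial>M)\<bar> \<le> n * (D * \<delta> l)"
        using steps[of l k] by linarith
    qed simp
    also have "\<dots> = n * (D * \<delta> l)" using n by simp
    finally show ?thesis .
  qed
  have L1: "\<bar>(\<integral>x. f l x * (birkhoff_sum u n x / n) \<partial>M) - (\<integral>x. f l x \<partial>M) * ?c\<bar>
      \<le> C * (\<integral>x. \<bar>birkhoff_sum u n x / n - ?c\<bar> \<partial>M)" for n l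
  proof -
    have bi: "integrable M (\<lambda>x. birkhoff_sum u n x / n)"
      using birkhoff_sum_bound[OF uD] by (intro integrable_divide integrable_bounded) auto
    have "integrable M (\<lambda>x. f l x * birkhoff_sum u n x)"
      using fC birkhoff_sum_bound[OF uD] by (intro prod_int) auto
    then have "(\<integral>x. f l x * (birkhoff_sum u n x / n) \<partial>M) - (\<integral>x. f l x \<partial>M) * ?c
        = (\<integral>x. (birkhoff_sum u n x / n - ?c) * f l x \<partial>M)"
      using fi by (simp add: algebra_simps)
    then show ?thesis using abs_integral_mult_le[of "\<lambda>x. birkhoff_sum u n x / n - ?c" "f l" C] bi fC by simp
  qed
  show ?thesis
  proof (rule LIMSEQ_I)
    fix r :: real assume r: "r > 0"
    have "(\<lambda>n. C * (\<integral>x. \<bar>birkhoff_sum u n x / n - ?c\<bar> \<partial>M)) \<longlonglongrightarrow> C * 0"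
      using uD by (intro tendsto_mult tendsto_const birkhoff_average_tendsto_L1) auto
    then have "\<forall>\<^sub>F n in sequentially. C * (\<integral>x. \<bar>birkhoff_sum u n x / n - ?c\<bar> \<partial>M) < r / 2"
      using r by (intro order_tendstoD) auto
    then have "\<forall>\<^sub>F n in sequentially. n > 0 \<and> C * (\<integral>x. \<bar>birkhoff_sum u n x / n - ?c\<bar> \<partial>M) < r / 2"
      using eventually_gt_at_top[of 0] by eventually_elim auto
    then obtain n where n: "n > 0" "C * (\<integral>x. \<bar>birkhoff_sum u n x / n - ?c\<bar> \<partial>M) < r / 2"
      by (auto simp: eventually_sequentially)
    have "(\<lambda>l. n * (D * \<delta> l)) \<longlonglongrightarrow> n * (D * 0)"
      using inv unfolding \<delta>_def by (intro tendsto_mult tendsto_const)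
    then have "\<forall>\<^sub>F l in sequentially. n * (D * \<delta> l) < r / 2" using r by (intro order_tendstoD) auto
    then have "\<forall>\<^sub>F l in sequentially. norm ((\<integral>x. f l x * u x \<partial>M) - (\<integral>x. f l x \<partial>M) * ?c - 0) < r"
    proof eventually_elim
      case (elim l)
      show ?case unfolding real_norm_def using elim avg[OF n(1), of l] L1[of l n] n(2) by linarith
    qed
    then show "\<exists>no. \<forall>l\<ge>no. norm ((\<integral>x. f l x * u x \<partial>M) - (\<integral>x. f l x \<partial>M) * ?c - 0) < r"
      by (simp add: eventually_sequentially)
  qed
qed

end

context ergodic_system
begin

text \<open>The density \<open>u\<close> of \<nu> is integrable but possibly unbounded. The bounded
  case is applied to the truncations \<open>w n\<close>, whose integrals tend to 1, with an error
  uniform in l.\<close>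

lemma asymptotically_invariant_tendsto_Pmeas:
  fixes f :: "nat \<Rightarrow> 'a \<Rightarrow> real"
  assumes f [measurable]: "\<And>l. f l \<in> borel_measurable M"
    and fC: "\<And>l x. x \<in> space M \<Longrightarrow> \<bar>f l x\<bar> \<le> C"
    and inv: "(\<lambda>l. \<integral>x. \<bar>f l (T x) - f l x\<bar> \<partial>M) \<longlonglongrightarrow> 0"
    and \<nu>: "\<nu> \<in> Pmeas M"
  shows "(\<lambda>l. (\<integral>x. f l x \<partial>\<nu>) - (\<integral>x. f l x \<partial>M)) \<longlonglongrightarrow> 0"
proof -
  have sets: "sets \<nu> = sets M" and prob: "prob_space \<nu>" and ac: "absolutely_continuous M \<nu>"
    using \<nu> unfolding Pmeas_def by auto
  interpret \<nu>: prob_space \<nu> by fact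
  obtain x0 where x0: "x0 \<in> space M" using not_empty by blast
  have C0: "C \<ge> 0" using fC[OF x0] by (auto intro: order_trans[OF abs_ge_zero])
  define u where "u x = enn2real (RN_deriv M \<nu> x)" for x
  have u [measurable]: "u \<in> borel_measurable M" unfolding u_def by measurable
  have u0: "u x \<ge> 0" for x unfolding u_def by simp
  have dens: "\<nu> = density M (\<lambda>x. ennreal (u x))"
  proof -
    have "AE x in M. RN_deriv M \<nu> x \<noteq> \<infinity>"
      using RN_deriv_finite[OF \<nu>.sigma_finite_measure_axioms ac sets] .
    then have "AE x in M. RN_deriv M \<nu> x = ennreal (u x)"
      by eventually_elim (simp add: u_def less_top)
    then have "density M (RN_deriv M \<nu>) = density M (\<lambda>x. ennreal (u x))"
      by (intro density_cong) auto
    then show ?thesis using density_RN_deriv[OF ac sets] by simp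
  qed
  have "emeasure \<nu> (space M) = (\<integral>\<^sup>+x. ennreal (u x) \<partial>M)"
    unfolding dens by (subst emeasure_density) (auto intro!: nn_integral_cong)
  then have nn: "(\<integral>\<^sup>+x. ennreal (u x) \<partial>M) = 1"
    using \<nu>.emeasure_space_1 sets_eq_imp_space_eq[OF sets] by simp
  have ui: "integrable M u" by (rule integrableI_nonneg) (auto simp: u0 nn)
  have u1: "(\<integral>x. u x \<partial>M) = 1" using nn u0 by (subst integral_eq_nn_integral) auto
  define w where "w n x = min (u x) (real n)" for n x
  have w [measurable]: "w n \<in> borel_measurable M" for n unfolding w_def by measurable
  have wb: "\<bar>w n x\<bar> \<le> n" for n x using u0[of x] unfolding w_def by auto
  have wi: "integrable M (w n)" for n using wb by (intro integrable_bounded[of _ n]) auto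
  have "(\<lambda>n. \<integral>x. w n x \<partial>M) \<longlonglongrightarrow> (\<integral>x. u x \<partial>M)"
  proof (rule integral_dominated_convergence[where w = u])
    show "AE x in M. (\<lambda>n. w n x) \<longlonglongrightarrow> u x"
    proof (rule AE_I2)
      fix x
      have "w n x = u x" if "n \<ge> nat \<lceil>u x\<rceil>" for n
        using that unfolding w_def by (simp add: min_def)
      then show "(\<lambda>n. w n x) \<longlonglongrightarrow> u x"
        unfolding eventually_sequentially[symmetric]
        by (intro tendsto_eventually eventually_sequentiallyI[of "nat \<lceil>u x\<rceil>"])
    qed
    show "AE x in M. norm (w n x) \<le> u x" for n using u0 unfolding w_def by auto
  qed (auto intro: ui)
  then have w1: "(\<lambda>n. \<integral>x. w n x \<partial>M) \<longlonglongrightarrow> 1" using u1 by simp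
  have int_\<nu>: "(\<integral>x. f l x \<partial>\<nu>) = (\<integral>x. u x * f l x \<partial>M)" for l
    unfolding dens using u0 by (subst integral_real_density) auto
  \<comment> \<open>The mass lost by truncation enters twice: once when \<open>u\<close> is replaced
    by \<open>w n\<close>, and once because the integral of \<open>w n\<close> is not exactly
    1.\<close>
  have bound: "\<bar>(\<integral>x. f l x \<partial>\<nu>) - (\<integral>x. f l x \<partial>M)\<bar> \<le>
      \<bar>(\<integral>x. f l x * w n x \<partial>M) - (\<integral>x. f l x \<partial>M) * (\<integral>x. w n x \<partial>M)\<bar> + 2 * C * (1 - (\<integral>x. w n x \<partial>M))"
    for l n
  proof -
    let ?\<eta> = "1 - (\<integral>x. w n x \<partial>M)"
    have uf: "integrable M (\<lambda>x. u x * f l x)"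
    proof (rule Bochner_Integration.integrable_bound[OF integrable_mult_left[OF ui, of C]])
      show "AE x in M. norm (u x * f l x) \<le> norm (u x * C)"
        using fC u0 C0 by (auto simp: abs_mult intro!: AE_I2 mult_left_mono)
    qed measurable
    have wf: "integrable M (\<lambda>x. w n x * f l x)"
      using fC wb by (intro integrable_bounded[of _ "n * C"]) (auto simp: abs_mult intro!: mult_mono')
    have "\<bar>\<integral>x. (u x - w n x) * f l x \<partial>M\<bar> \<le> C * (\<integral>x. \<bar>u x - w n x\<bar> \<partial>M)"
      using ui wi fC by (intro abs_integral_mult_le) auto
    also have "(\<integral>x. \<bar>u x - w n x\<bar> \<partial>M) = (\<integral>x. u x - w n x \<partial>M)"
      by (intro Bochner_Integration.integral_cong) (auto simp: w_def)
    also have "\<dots> = ?\<eta>" using ui wi u1 by simp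
    finally have 1: "\<bar>\<integral>x. (u x - w n x) * f l x \<partial>M\<bar> \<le> C * ?\<eta>" .
    have \<eta>: "?\<eta> \<ge> 0"
      using u1 integral_mono[OF wi ui, of n] unfolding w_def by simp
    have "(\<integral>x. \<bar>f l x\<bar> \<partial>M) \<le> (\<integral>x. C \<partial>M)"
      using fC integrable_bounded[OF f fC] by (intro integral_mono) auto
    then have "\<bar>\<integral>x. f l x \<partial>M\<bar> \<le> C"
      using prob_space by (intro order_trans[OF integral_abs_bound]) simp
    then have 2: "\<bar>(\<integral>x. f l x \<partial>M) * ?\<eta>\<bar> \<le> C * ?\<eta>"
      using \<eta> by (simp add: abs_mult mult_right_mono)
    have "(\<integral>x. f l x \<partial>\<nu>) = (\<integral>x. (u x - w n x) * f l x \<partial>M) + (\<integral>x. f l x * w n x \<partial>M)"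
      using uf wf int_\<nu>[of l] unfolding mult.commute[of "f l _"] by (simp add: left_diff_distrib)
    then have "(\<integral>x. f l x \<partial>\<nu>) - (\<integral>x. f l x \<partial>M) = (\<integral>x. (u x - w n x) * f l x \<partial>M)
        + ((\<integral>x. f l x * w n x \<partial>M) - (\<integral>x. f l x \<partial>M) * (\<integral>x. w n x \<partial>M)) - (\<integral>x. f l x \<partial>M) * ?\<eta>"
      by (simp add: algebra_simps)
    then show ?thesis using 1 2 by linarith
  qed
  show ?thesis
  proof (rule LIMSEQ_I)
    fix r :: real assume r: "r > 0"
    have "(\<lambda>n. 2 * C * (1 - (\<integral>x. w n x \<partial>M))) \<longlonglongrightarrow> 2 * C * (1 - 1)"
      by (intro tendsto_intros w1)
    then have "\<forall>\<^sub>F n in sequentially. 2 * C * (1 - (\<integral>x. w n x \<partial>M)) < r / 2"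
      using r by (intro order_tendstoD) auto
    then obtain n where n: "2 * C * (1 - (\<integral>x. w n x \<partial>M)) < r / 2"
      by (auto simp: eventually_sequentially)
    have "(\<lambda>l. (\<integral>x. f l x * w n x \<partial>M) - (\<integral>x. f l x \<partial>M) * (\<integral>x. w n x \<partial>M)) \<longlonglongrightarrow> 0"
      by (rule asymptotically_invariant_tendsto_bounded[OF f fC inv w wb])
    from tendsto_rabs_zero[OF this]
    have "\<forall>\<^sub>F l in sequentially. \<bar>(\<integral>x. f l x * w n x \<partial>M) - (\<integral>x. f l x \<partial>M) * (\<integral>x. w n x \<partial>M)\<bar> < r / 2"
      using r by (intro order_tendstoD) auto
    then have "\<forall>\<^sub>F l in sequentially. norm ((\<integral>x. f l x \<partial>\<nu>) - (\<integral>x. f l x \<partial>M) - 0) < r"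
    proof eventually_elim
      case (elim l)
      show ?case using bound[of l n] elim n unfolding real_norm_def by linarith
    qed
    then show "\<exists>no. \<forall>l\<ge>no. norm ((\<integral>x. f l x \<partial>\<nu>) - (\<integral>x. f l x \<partial>M) - 0) < r"
      by (simp add: eventually_sequentially)
  qed
qed

end

text \<open>This is the form in which sequential compactness enters: the limit measure may depend on
  the subsequence, but the limit of the differences of integrals is always 0.\<close>

lemma tendsto_zero_if_subseq:
  fixes X :: "nat \<Rightarrow> real"
  assumes "\<And>s :: nat \<Rightarrow> nat. strict_mono s \<Longrightarrow> \<exists>r :: nat \<Rightarrow> nat. strict_mono r \<and> (\<lambda>n. X (s (r n))) \<longlonglongrightarrow> 0"
  shows "X \<longlonglongrightarrow> 0"
proof (rule ccontr)
  assume "\<not> X \<longlonglongrightarrow> 0"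
  then obtain e where e: "e > 0" "\<forall>N. \<exists>n\<ge>N. \<bar>X n\<bar> \<ge> e"
    unfolding LIMSEQ_iff by (auto simp: not_less)
  then have "infinite {n. \<bar>X n\<bar> \<ge> e}" unfolding infinite_nat_iff_unbounded_le by auto
  then obtain s :: "nat \<Rightarrow> nat" where s: "strict_mono s" "\<And>n. s n \<in> {n. \<bar>X n\<bar> \<ge> e}"
    using infinite_enumerate by blast
  then obtain r where r: "strict_mono r" "(\<lambda>n. X (s (r n))) \<longlonglongrightarrow> 0" using assms by blast
  have "\<forall>\<^sub>F n in sequentially. \<bar>X (s (r n))\<bar> < e"
    using order_tendstoD(2)[OF tendsto_rabs_zero[OF r(2)] e(1)] .
  then show False using s(2) by (auto simp: eventually_sequentially not_less[symmetric])
qed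

context ergodic_system
begin

theorem asymptotically_invariant_tendsto_P_compact:
  fixes f :: "nat \<Rightarrow> 'a \<Rightarrow> real"
  assumes f [measurable]: "\<And>l. f l \<in> borel_measurable M"
    and fC: "\<And>l x. x \<in> space M \<Longrightarrow> \<bar>f l x\<bar> \<le> C"
    and inv: "(\<lambda>l. \<integral>x. \<bar>f l (T x) - f l x\<bar> \<partial>M) \<longlonglongrightarrow> 0"
    and K: "P_compact M K" and \<nu>: "\<And>l. \<nu> l \<in> K"
  shows "(\<lambda>l. (\<integral>x. f l x \<partial>\<nu> l) - (\<integral>x. f l x \<partial>M)) \<longlonglongrightarrow> 0"
proof (rule tendsto_zero_if_subseq)
  fix s :: "nat \<Rightarrow> nat" assume s: "strict_mono s"
  have "\<exists>r \<nu>'. strict_mono r \<and> \<nu>' \<in> K \<and> (\<lambda>n. dP M (\<nu> (s (r n))) \<nu>') \<longlonglongrightarrow> 0"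
    using K[unfolded P_compact_def, THEN conjunct2, rule_format, of "\<lambda>n. \<nu> (s n)"] \<nu> by simp
  then obtain r \<nu>' where r: "strict_mono r" and \<nu>': "\<nu>' \<in> K" and lim: "(\<lambda>n. dP M (\<nu> (s (r n))) \<nu>') \<longlonglongrightarrow> 0"
    by blast
  have KP: "N \<in> Pmeas M" if "N \<in> K" for N using K that unfolding P_compact_def by blast
  have sr: "strict_mono (\<lambda>n. s (r n))" using s r by (simp add: strict_mono_def)
  have "(\<lambda>l. (\<integral>x. f l x \<partial>\<nu>') - (\<integral>x. f l x \<partial>M)) \<longlonglongrightarrow> 0"
    by (rule asymptotically_invariant_tendsto_Pmeas[OF f fC inv KP[OF \<nu>']])
  from LIMSEQ_subseq_LIMSEQ[OF this sr]
  have 1: "(\<lambda>n. (\<integral>x. f (s (r n)) x \<partial>\<nu>') - (\<integral>x. f (s (r n)) x \<partial>M)) \<longlonglongrightarrow> 0" by (simp add: o_def)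
  \<comment> \<open>The total variation bound asks for a strictly positive constant, while
    \<open>C\<close> may be 0.\<close>
  let ?C = "\<bar>C\<bar> + 1"
  have 2: "(\<lambda>n. (\<integral>x. f (s (r n)) x \<partial>\<nu> (s (r n))) - (\<integral>x. f (s (r n)) x \<partial>\<nu>')) \<longlonglongrightarrow> 0"
  proof (rule Lim_null_comparison)
    have "(\<lambda>n. 2 * ?C * dP M (\<nu> (s (r n))) \<nu>') \<longlonglongrightarrow> 2 * ?C * 0" by (intro tendsto_mult lim tendsto_const)
    then show "(\<lambda>n. 2 * ?C * dP M (\<nu> (s (r n))) \<nu>') \<longlonglongrightarrow> 0" by simp
    show "\<forall>\<^sub>F n in sequentially. norm ((\<integral>x. f (s (r n)) x \<partial>\<nu> (s (r n))) - (\<integral>x. f (s (r n)) x \<partial>\<nu>'))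
        \<le> 2 * ?C * dP M (\<nu> (s (r n))) \<nu>'"
    proof (rule always_eventually, rule allI)
      fix n
      have "\<bar>f l x\<bar> \<le> ?C" if "x \<in> space M" for l x using fC[OF that, of l] by linarith
      then show "norm ((\<integral>x. f (s (r n)) x \<partial>\<nu> (s (r n))) - (\<integral>x. f (s (r n)) x \<partial>\<nu>'))
        \<le> 2 * ?C * dP M (\<nu> (s (r n))) \<nu>'"
        unfolding real_norm_def using KP[OF \<nu>] KP[OF \<nu>'] unfolding Pmeas_def
        by (intro integral_diff_le_dP) (auto intro: prob_space.finite_measure)
    qed
  qed
  show "\<exists>r. strict_mono r \<and> (\<lambda>n. (\<integral>x. f (s (r n)) x \<partial>\<nu> (s (r n))) - (\<integral>x. f (s (r n)) x \<partial>M)) \<longlonglongrightarrow> 0"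
    using tendsto_add[OF 1 2] r by (intro exI[of _ r]) simp
qed

end

section \<open>Conditional measures and the return map\<close>

lemma sets_cond_meas [simp, measurable_cong]: "sets (cond_meas N B) = sets N"
  by (simp add: cond_meas_def)

lemma space_cond_meas [simp]: "space (cond_meas N B) = space N"
  by (simp add: cond_meas_def)

context finite_measure
begin

text \<open>If \<open>B\<close> is null, the defining density is infinite on \<open>B\<close> and
  the real one is 0 by division by zero. They agree off \<open>B\<close>, hence almost everywhere,
  so conditioning on a null set gives the zero measure.\<close>

lemma cond_meas_eq_density:
  assumes [measurable]: "B \<in> sets M"
  shows "cond_meas M B = density M (\<lambda>x. ennreal (indicator B x / measure M B))"
  unfolding cond_meas_def
proof (rule density_cong)
  show "AE x in M. indicator B x / emeasure M B = ennreal (indicator B x / measure M B)"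
  proof (cases "measure M B = 0")
    case True
    then have "B \<in> null_sets M" using assms by (intro null_setsI) (auto simp: emeasure_eq_measure)
    then have "AE x in M. x \<notin> B" by (rule AE_not_in)
    then show ?thesis by eventually_elim simp
  next
    case False
    then have "measure M B > 0" by (simp add: zero_less_measure_iff)
    then have "1 / emeasure M B = ennreal (1 / measure M B)"
      using divide_ennreal[of 1 "measure M B"] by (simp add: emeasure_eq_measure)
    then show ?thesis by (auto simp: indicator_def)
  qed
qed measurable

lemma integral_cond_meas:
  fixes f :: "'a \<Rightarrow> real"
  assumes [measurable]: "B \<in> sets M" "f \<in> borel_measurable M"
  shows "(\<integral>x. f x \<partial>cond_meas M B) = (\<integral>x. indicator B x * f x \<partial>M) / measure M B"
proof -
  have "(\<integral>x. f x \<partial>cond_meas M B) = (\<integral>x. indicator B x / measure M B * f x \<partial>M)"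
    unfolding cond_meas_eq_density[OF assms(1)] by (rule integral_real_density) auto
  then show ?thesis by simp
qed

lemma emeasure_cond_meas:
  assumes [measurable]: "B \<in> sets M" "E \<in> sets M"
  shows "emeasure (cond_meas M B) E = ennreal (measure M (B \<inter> E) / measure M B)"
proof -
  have "emeasure (cond_meas M B) E = (\<integral>\<^sup>+x. ennreal (1 / measure M B) * indicator (B \<inter> E) x \<partial>M)"
    by (subst cond_meas_eq_density) (auto simp: emeasure_density indicator_def intro!: nn_integral_cong)
  also have "\<dots> = ennreal (1 / measure M B) * ennreal (measure M (B \<inter> E))"
    by (subst nn_integral_cmult_indicator) (auto simp: emeasure_eq_measure)
  finally show ?thesis by (simp add: ennreal_mult''[symmetric])
qed

lemma finite_measure_cond_meas:
  assumes "B \<in> sets M"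
  shows "finite_measure (cond_meas M B)"
  using emeasure_cond_meas[OF assms, of "space M"] by (intro finite_measureI) simp

lemma prob_space_cond_meas:
  assumes "B \<in> sets M" "measure M B > 0"
  shows "prob_space (cond_meas M B)"
  using emeasure_cond_meas[OF assms(1), of "space M"] assms sets.sets_into_space[OF assms(1)]
  by (intro prob_spaceI) (simp add: Int_absorb2)

lemma absolutely_continuous_cond_meas:
  assumes [measurable]: "B \<in> sets M"
  shows "absolutely_continuous M (cond_meas M B)"
  unfolding cond_meas_eq_density[OF assms] by (rule absolutely_continuousI_density) measurable

lemma AE_cond_meas_mem:
  assumes [measurable]: "B \<in> sets M"
  shows "AE x in cond_meas M B. x \<in> B"
  unfolding cond_meas_eq_density[OF assms] by (subst AE_density) (auto simp: indicator_def)

end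

section \<open>Return times, recurrence and invariance under the return map\<close>

lemma less_ret_time_iff: "enat k < ret_time T A x \<longleftrightarrow> (\<forall>n. 1 \<le> n \<and> n \<le> k \<longrightarrow> (T ^^ n) x \<notin> A)"
proof (cases "\<exists>n\<ge>1. (T ^^ n) x \<in> A")
  case True
  let ?P = "\<lambda>n. n \<ge> 1 \<and> (T ^^ n) x \<in> A"
  have L: "?P (Least ?P)" using True by (rule LeastI_ex[of ?P])
  have "k < Least ?P \<longleftrightarrow> (\<forall>n. 1 \<le> n \<and> n \<le> k \<longrightarrow> (T ^^ n) x \<notin> A)"
    using L not_less_Least[of _ ?P] by (meson le_less_trans not_le)
  then show ?thesis using True unfolding ret_time_def by simp
next
  case False
  then show ?thesis unfolding ret_time_def by auto
qed

context ergodic_system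
begin

text \<open>Infinitely many visits are required rather than one because this makes the set invariant
  under preimages exactly, as the ergodicity assumption demands.\<close>

definition recurrent_set :: "'a set \<Rightarrow> 'a set" where
  "recurrent_set A = {x \<in> space M. \<forall>m. \<exists>n\<ge>m. (T ^^ n) x \<in> A}"

lemma sets_recurrent_set [measurable]:
  assumes [measurable]: "A \<in> sets M"
  shows "recurrent_set A \<in> sets M"
  unfolding recurrent_set_def by measurable

lemma T_mem_recurrent_set_iff:
  assumes "x \<in> space M"
  shows "T x \<in> recurrent_set A \<longleftrightarrow> x \<in> recurrent_set A"
proof -
  have "(\<forall>m. \<exists>n\<ge>m. (T ^^ n) (T x) \<in> A) \<longleftrightarrow> (\<forall>m. \<exists>n\<ge>m. (T ^^ n) x \<in> A)"
    unfolding funpow_swap1[symmetric] funpow.simps(2)[unfolded o_def fun_eq_iff, rule_format, symmetric]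
    by (metis Suc_le_D Suc_le_mono le_SucI)
  then show ?thesis using assms T_in_space unfolding recurrent_set_def by simp
qed

text \<open>The set of points with a visit at time m or later contains the preimage of
  \<open>A\<close> under \<open>T ^^ m\<close>, so it has at least the measure of \<open>A\<close>.
  The decreasing intersection keeps this bound, and an invariant set of positive measure is
  full.\<close>

lemma AE_recurrent_set:
  assumes A [measurable]: "A \<in> sets M" and pos: "measure M A > 0"
  shows "AE x in M. x \<in> recurrent_set A"
proof -
  define U where "U m = {x \<in> space M. \<exists>n\<ge>m. (T ^^ n) x \<in> A}" for m
  have U [measurable]: "U m \<in> sets M" for m unfolding U_def by measurable
  have "measure M A \<le> measure M (U m)" for m
    unfolding measure_vimage_T_power[OF A, of m, symmetric]
    by (intro finite_measure_mono) (auto simp: U_def)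
  moreover have "(\<lambda>m. measure M (U m)) \<longlonglongrightarrow> measure M (\<Inter>m. U m)"
    by (rule finite_Lim_measure_decseq) (auto simp: U_def decseq_def intro: order_trans)
  moreover have "(\<Inter>m. U m) = recurrent_set A" unfolding U_def recurrent_set_def by auto
  ultimately have "measure M A \<le> measure M (recurrent_set A)" by (intro LIMSEQ_le_const) auto
  moreover have "T -` recurrent_set A \<inter> space M = recurrent_set A"
    using T_mem_recurrent_set_iff sets.sets_into_space[OF sets_recurrent_set[OF A]] by auto
  ultimately have "measure M (recurrent_set A) = 1" using T_ergodic[of "recurrent_set A"] pos by auto
  then show ?thesis by (rule AE_prob_1)
qed

lemma recurrent_set_ret_map:
  assumes "x \<in> recurrent_set A"
  defines "N \<equiv> (LEAST n. n \<ge> 1 \<and> (T ^^ n) x \<in> A)"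
  shows "N \<ge> 1" "(T ^^ N) x \<in> A" "\<And>n. 1 \<le> n \<Longrightarrow> n < N \<Longrightarrow> (T ^^ n) x \<notin> A"
proof -
  let ?P = "\<lambda>n. n \<ge> 1 \<and> (T ^^ n) x \<in> A"
  have "?P (Least ?P)" using assms(1) unfolding recurrent_set_def by (intro LeastI_ex[of ?P]) auto
  then show "N \<ge> 1" "(T ^^ N) x \<in> A" unfolding N_def by auto
  show "(T ^^ n) x \<notin> A" if "1 \<le> n" "n < N" for n
    using not_less_Least[of n ?P] that unfolding N_def by auto
qed

lemma ret_map_eqI:
  assumes "n \<ge> 1" "(T ^^ n) x \<in> A" "\<And>m. 1 \<le> m \<Longrightarrow> m < n \<Longrightarrow> (T ^^ m) x \<notin> A"
  shows "ret_map T A x = (T ^^ n) x"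
proof -
  have "(LEAST n. n \<ge> 1 \<and> (T ^^ n) x \<in> A) = n"
    using assms by (intro Least_equality) (auto simp: not_less[symmetric])
  then show ?thesis unfolding ret_map_def by simp
qed

text \<open>If N is the first return time of \<open>x\<close> and j < N, then the first return time
  of \<open>(T ^^ j) x\<close> is N - j, and both orbits enter \<open>A\<close> at the same
  point.\<close>

lemma ret_map_T_power:
  assumes x: "x \<in> recurrent_set A" and j: "enat j < ret_time T A x"
  shows "ret_map T A ((T ^^ j) x) = ret_map T A x"
proof -
  define N where "N = (LEAST n. n \<ge> 1 \<and> (T ^^ n) x \<in> A)"
  note N = recurrent_set_ret_map[OF x, folded N_def]
  have "j < N" using N j unfolding less_ret_time_iff by (meson not_le)
  have pow: "(T ^^ m) ((T ^^ j) x) = (T ^^ (m + j)) x" for m by (simp add: funpow_add)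
  have "ret_map T A ((T ^^ j) x) = (T ^^ (N - j)) ((T ^^ j) x)"
    using \<open>j < N\<close> N by (intro ret_map_eqI) (auto simp: pow)
  then show ?thesis using \<open>j < N\<close> by (simp add: pow ret_map_def N_def)
qed

lemma ret_map_measurable [measurable]:
  assumes [measurable]: "A \<in> sets M"
  shows "ret_map T A \<in> measurable M M"
  unfolding ret_map_def
  by (rule measurable_compose_countable[where f = "\<lambda>n x. (T ^^ n) x"]) measurable

lemma sets_less_ret_time [measurable]:
  assumes [measurable]: "A \<in> sets M" "\<tau> \<in> measurable M (count_space UNIV)"
  shows "{x \<in> space M. enat (\<tau> x) < ret_time T A x} \<in> sets M"
  unfolding less_ret_time_iff by measurable

lemma distr_ret_map:
  assumes A [measurable]: "A \<in> sets M" and pos: "measure M A > 0"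
  shows "distr (cond_meas M A) (cond_meas M A) (ret_map T A) = cond_meas M A"
proof (rule measure_eqI)
  fix E assume "E \<in> sets (distr (cond_meas M A) (cond_meas M A) (ret_map T A))"
  then have E [measurable]: "E \<in> sets M" by simp
  \<comment> \<open>The first visit to \<open>A\<close> happens at time \<open>n\<close> and lies in \<open>E\<close>: \<open>C (Suc n)\<close> is the preimage of
    \<open>C n - A\<close>, so the measures of \<open>A \<inter> C n\<close> telescope.\<close>
  define C where "C n = {x \<in> space M. (\<forall>m. 1 \<le> m \<and> m < n \<longrightarrow> (T ^^ m) x \<notin> A) \<and> (T ^^ n) x \<in> A \<inter> E}" for n
  have C [measurable]: "C n \<in> sets M" for n unfolding C_def by measurable
  have C1: "C 1 = T -` (A \<inter> E) \<inter> space M" unfolding C_def by auto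
  \<comment> \<open>The restriction on n matters: \<open>C 0\<close> is contained in
    \<open>A\<close>, so \<open>C 0 - A\<close> is empty, whereas \<open>C 1\<close> is the preimage
    of \<open>A \<inter> E\<close>.\<close>
  have C_Suc: "C (Suc n) = T -` (C n - A) \<inter> space M" if "n \<ge> 1" for n
  proof -
    have "(\<forall>m. 1 \<le> m \<and> m < Suc n \<longrightarrow> (T ^^ m) x \<notin> A) \<longleftrightarrow>
        T x \<notin> A \<and> (\<forall>m. 1 \<le> m \<and> m < n \<longrightarrow> (T ^^ m) (T x) \<notin> A)" for x
    proof safe
      fix m assume *: "T x \<notin> A" "\<forall>m. 1 \<le> m \<and> m < n \<longrightarrow> (T ^^ m) (T x) \<notin> A" "1 \<le> m" "m < Suc n" "(T ^^ m) x \<in> A"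
      then obtain k where "m = Suc k" by (cases m) auto
      with * show False by (cases k) (auto simp: funpow_swap1)
    next
      assume "\<forall>m. 1 \<le> m \<and> m < Suc n \<longrightarrow> (T ^^ m) x \<notin> A" "T x \<in> A"
      then show False using that by (auto dest: spec[of _ 1])
    next
      fix m assume "\<forall>m. 1 \<le> m \<and> m < Suc n \<longrightarrow> (T ^^ m) x \<notin> A" "1 \<le> m" "m < n" "(T ^^ m) (T x) \<in> A"
      then show False by (auto dest: spec[of _ "Suc m"] simp: funpow_swap1)
    qed
    then show ?thesis unfolding C_def using T_in_space by (auto simp: funpow_swap1)
  qed
  have C_less: "x \<notin> C n" if "x \<in> C m" "1 \<le> m" "m < n" for x m n
    using that unfolding C_def by blast
  then have C_disj: "m = n" if "x \<in> C (Suc m)" "x \<in> C (Suc n)" for x m n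
    using that by (metis One_nat_def Suc_le_mono le0 linorder_neqE_nat nat.inject)
  have C_rec: "measure M (C (Suc n)) = measure M (C n) - measure M (A \<inter> C n)" if "n \<ge> 1" for n
  proof -
    have "measure M (C (Suc n)) = measure M (C n - A)"
      unfolding C_Suc[OF that] by (rule measure_vimage_T) measurable
    also have "\<dots> = measure M (C n) - measure M (C n \<inter> A)" by (rule finite_measure_Diff') auto
    finally show ?thesis by (simp add: Int_commute)
  qed
  have part: "(\<Sum>i<n. measure M (A \<inter> C (Suc i))) = measure M (A \<inter> E) - measure M (C (Suc n))" for n
  proof (induction n)
    case 0
    show ?case using measure_vimage_T[of "A \<inter> E"] C1 by simp
  next
    case (Suc n)
    then show ?case using C_rec[of "Suc n"] by simp
  qed
  \<comment> \<open>Sets of points with different first visit times are disjoint in a space of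
    finite measure, so their measures tend to 0. This removes the remainder of the telescoping sum
    in \<open>part\<close>.\<close>
  have "(\<lambda>i. measure M (C (Suc i))) sums measure M (\<Union>i. C (Suc i))"
    using C_disj by (intro finite_measure_UNION) (fastforce simp: disjoint_family_on_def)+
  then have "(\<lambda>i. measure M (C (Suc i))) \<longlonglongrightarrow> 0" by (rule sums_summable[THEN summable_LIMSEQ_zero])
  then have "(\<lambda>n. measure M (A \<inter> E) - measure M (C (Suc n))) \<longlonglongrightarrow> measure M (A \<inter> E) - 0"
    by (intro tendsto_intros)
  then have "(\<lambda>i. measure M (A \<inter> C (Suc i))) sums measure M (A \<inter> E)" unfolding sums_def part by simp
  moreover have "(\<lambda>i. measure M (A \<inter> C (Suc i))) sums measure M (\<Union>i. A \<inter> C (Suc i))"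
    using C_disj by (intro finite_measure_UNION) (fastforce simp: disjoint_family_on_def)+
  ultimately have eq: "measure M (\<Union>i. A \<inter> C (Suc i)) = measure M (A \<inter> E)" using sums_unique2 by blast
  have "measure M (A \<inter> (ret_map T A -` E \<inter> space M)) = measure M (\<Union>i. A \<inter> C (Suc i))"
  proof (rule finite_measure_eq_AE)
    \<comment> \<open>For a recurrent point the first return time is finite, and it is the only
      index i + 1 at which \<open>x\<close> can belong to \<open>C (Suc i)\<close>.\<close>
    show "AE x in M. x \<in> A \<inter> (ret_map T A -` E \<inter> space M) \<longleftrightarrow> x \<in> (\<Union>i. A \<inter> C (Suc i))"
      using AE_recurrent_set[OF A pos]
    proof eventually_elim
      case (elim x)
      define N where "N = (LEAST n. n \<ge> 1 \<and> (T ^^ n) x \<in> A)"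
      note N = recurrent_set_ret_map[OF elim, folded N_def]
      have xs: "x \<in> space M" using elim by (simp add: recurrent_set_def)
      have "(T ^^ N) x \<in> E \<longleftrightarrow> (\<exists>i. x \<in> C (Suc i))"
      proof
        assume "(T ^^ N) x \<in> E"
        then have "x \<in> C (Suc (N - 1))" using N xs unfolding C_def by auto
        then show "\<exists>i. x \<in> C (Suc i)" ..
      next
        assume "\<exists>i. x \<in> C (Suc i)"
        then obtain i where i: "x \<in> C (Suc i)" ..
        then have "ret_map T A x = (T ^^ Suc i) x" by (intro ret_map_eqI) (auto simp: C_def)
        then show "(T ^^ N) x \<in> E" using i by (simp add: C_def ret_map_def N_def)
      qed
      then show ?case using xs by (auto simp: ret_map_def N_def)
    qed
  qed measurable
  then show "emeasure (distr (cond_meas M A) (cond_meas M A) (ret_map T A)) E = emeasure (cond_meas M A) E"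
    using eq by (simp add: emeasure_distr emeasure_cond_meas)
qed simp

lemma integral_ret_map:
  fixes f :: "'a \<Rightarrow> real"
  assumes A [measurable]: "A \<in> sets M" and pos: "measure M A > 0" and [measurable]: "f \<in> borel_measurable M"
  shows "(\<integral>x. f (ret_map T A x) \<partial>cond_meas M A) = (\<integral>x. f x \<partial>cond_meas M A)"
proof -
  have "(\<integral>x. f x \<partial>distr (cond_meas M A) (cond_meas M A) (ret_map T A)) = (\<integral>x. f (ret_map T A x) \<partial>cond_meas M A)"
    by (rule integral_distr) measurable
  then show ?thesis unfolding distr_ret_map[OF A pos] by simp
qed

lemma loc_proc_eq_loc_proc0: "loc_proc T A \<psi> x = loc_proc0 T A \<psi> (ret_map T A x)"
  unfolding loc_proc_def loc_proc0_def by (simp add: funpow_swap1)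

lemma loc_proc_T_power:
  assumes "x \<in> recurrent_set A" "enat j < ret_time T A x"
  shows "loc_proc T A \<psi> ((T ^^ j) x) = loc_proc T A \<psi> x"
  unfolding loc_proc_eq_loc_proc0 ret_map_T_power[OF assms] ..

end

section \<open>Weak convergence and continuity sets\<close>

text \<open>This is the upper half of the mapping theorem for almost everywhere continuous
  functions. It is used for nonnegative error terms, for which an upper bound is what is
  wanted.\<close>

lemma weak_conv_law_eventually_integral_le:
  fixes f :: "'b::metric_space \<Rightarrow> real"
  assumes conv: "weak_conv_law P X Q"
    and P: "\<And>l. prob_space (P l)" and X: "\<And>l. X l \<in> borel_measurable (P l)"
    and Q: "prob_space Q" "sets Q = sets borel"
    and f [measurable]: "f \<in> borel_measurable borel" and fC: "\<And>y. \<bar>f y\<bar> \<le> C"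
    and cont: "AE y in Q. isCont f y"
    and e: "e > 0"
  shows "\<forall>\<^sub>F l in sequentially. (\<integral>x. f (X l x) \<partial>P l) \<le> (\<integral>y. f y \<partial>Q) + e"
proof -
  interpret Q: prob_space Q by fact
  \<comment> \<open>Lipschitz majorants of \<open>f\<close> that converge to \<open>f\<close> at its points of continuity.\<close>
  define g where "g k x = (SUP y. f y - real k * dist x y)" for k x
  have C: "C \<ge> 0" using fC[of undefined] by linarith
  have f_le: "f y - real k * dist x y \<le> C" for k x y
  proof -
    have "0 \<le> real k * dist x y" by simp
    then show ?thesis using fC[of y] by linarith
  qed
  have bdd: "bdd_above (range (\<lambda>y. f y - real k * dist x y))" for k x
    using f_le by (rule bdd_aboveI2)
  have g_ge: "f x \<le> g k x" for k x
    unfolding g_def using cSUP_upper[OF UNIV_I bdd, of x k x] by simp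
  have g_leI: "g k x \<le> c" if "\<And>y. f y - real k * dist x y \<le> c" for k x c
    unfolding g_def using that by (intro cSUP_least) auto
  have g_le: "g k x \<le> C" for k x
    using f_le by (rule g_leI)
  have gC: "\<bar>g k x\<bar> \<le> C" for k x using g_le[of k x] g_ge[of x k] fC[of x] by linarith
  have g_lip: "g k x \<le> g k x' + k * dist x x'" for k x x'
  proof (rule g_leI)
    fix y
    have "f y - real k * dist x' y \<le> g k x'" unfolding g_def by (rule cSUP_upper[OF UNIV_I bdd])
    moreover have "real k * dist x' y \<le> real k * (dist x x' + dist x y)"
      by (intro mult_left_mono) (metis dist_commute dist_triangle, simp)
    ultimately show "f y - real k * dist x y \<le> g k x' + k * dist x x'" by (simp add: algebra_simps)
  qed
  have g_cont: "continuous_on UNIV (g k)" for k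
  proof (rule continuous_on_subset[OF uniformly_continuous_imp_continuous], unfold uniformly_continuous_on_def, safe)
    fix e :: real assume e: "e > 0"
    show "\<exists>d>0. \<forall>x\<in>UNIV. \<forall>x'\<in>UNIV. dist x' x < d \<longrightarrow> dist (g k x') (g k x) < e"
    proof (intro exI conjI ballI impI)
      show "e / (k + 1) > 0" using e by simp
      fix x x' :: 'b assume d: "dist x' x < e / (k + 1)"
      have "k * dist x' x \<le> (k + 1) * dist x' x" by (intro mult_right_mono) auto
      also have "\<dots> < e" using d by (simp add: field_simps)
      finally show "dist (g k x') (g k x) < e"
        using g_lip[of k x x'] g_lip[of k x' x] by (simp add: dist_real_def dist_commute abs_less_iff)
    qed
  qed auto
  have g_lim: "(\<lambda>k. g k x) \<longlonglongrightarrow> f x" if c: "isCont f x" for x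
  proof (rule LIMSEQ_I)
    fix r :: real assume r: "r > 0"
    then obtain d where d: "d > 0" "\<And>y. dist y x < d \<Longrightarrow> dist (f y) (f x) < r / 2"
      using c unfolding continuous_at_eps_delta by (metis half_gt_zero)
    show "\<exists>no. \<forall>k\<ge>no. norm (g k x - f x) < r"
    proof (intro exI allI impI)
      \<comment> \<open>Beyond distance \<open>d\<close> the penalty \<open>k * dist x y\<close> is
        at least 2 * C, which is the largest possible increase of \<open>f\<close>; within distance
        \<open>d\<close> continuity at \<open>x\<close> controls \<open>f y\<close>.\<close>
      fix k assume k: "nat \<lceil>2 * C / d\<rceil> \<le> k"
      have "g k x \<le> f x + r / 2"
      proof (rule g_leI)
        fix y
        show "f y - real k * dist x y \<le> f x + r / 2"
        proof (cases "dist y x < d")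
          case True
          then have "f y < f x + r / 2" using d(2)[of y] unfolding dist_real_def by linarith
          moreover have "0 \<le> real k * dist x y" by simp
          ultimately show ?thesis by linarith
        next
          case False
          have "2 * C / d \<le> k" using k by linarith
          then have "2 * C \<le> k * d" using d(1) by (simp add: field_simps)
          also have "\<dots> \<le> k * dist x y" using False by (intro mult_left_mono) (auto simp: dist_commute)
          finally show ?thesis using fC[of y] fC[of x] r by linarith
        qed
      qed
      then show "norm (g k x - f x) < r" using g_ge[of x k] r by simp
    qed
  qed
  have [measurable]: "g k \<in> borel_measurable borel" for k using g_cont by (rule borel_measurable_continuous_onI)
  have Qborel: "h \<in> borel_measurable Q" if "h \<in> borel_measurable borel" for h :: "'b \<Rightarrow> real"
    using that Q(2) measurable_cong_sets by blast
  have "(\<lambda>k. \<integral>y. g k y \<partial>Q) \<longlonglongrightarrow> (\<integral>y. f y \<partial>Q)"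
  proof (rule integral_dominated_convergence[where w = "\<lambda>_. C"])
    show "AE y in Q. (\<lambda>k. g k y) \<longlonglongrightarrow> f y" using cont by eventually_elim (rule g_lim)
  qed (auto intro!: Qborel simp: gC)
  then have "\<forall>\<^sub>F k in sequentially. (\<integral>y. g k y \<partial>Q) < (\<integral>y. f y \<partial>Q) + e / 2"
    using e by (intro order_tendstoD) auto
  then obtain k where k: "(\<integral>y. g k y \<partial>Q) < (\<integral>y. f y \<partial>Q) + e / 2" by (auto simp: eventually_sequentially)
  have "bounded (range (g k))" using gC by (auto simp: bounded_iff)
  then have "(\<lambda>l. \<integral>x. g k (X l x) \<partial>P l) \<longlonglongrightarrow> (\<integral>y. g k y \<partial>Q)"
    using conv g_cont unfolding weak_conv_law_def by blast
  then have "\<forall>\<^sub>F l in sequentially. (\<integral>x. g k (X l x) \<partial>P l) < (\<integral>y. g k y \<partial>Q) + e / 2"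
    using e by (intro order_tendstoD) auto
  then show ?thesis
  proof eventually_elim
    case (elim l)
    interpret prob_space "P l" by (rule P)
    have [measurable]: "X l \<in> borel_measurable (P l)" by (rule X)
    have "integrable (P l) (\<lambda>x. f (X l x))" using fC by (intro integrable_const_bound[of _ C]) auto
    moreover have "integrable (P l) (\<lambda>x. g k (X l x))" using gC by (intro integrable_const_bound[of _ C]) auto
    ultimately have "(\<integral>x. f (X l x) \<partial>P l) \<le> (\<integral>x. g k (X l x) \<partial>P l)"
      using g_ge by (intro integral_mono) auto
    then show ?case using elim k by simp
  qed
qed

section \<open>Approximation in \<open>L1\<close> by indicators from a \<pi>-system\<close>

inductive indicator_span :: "'b set set \<Rightarrow> ('b \<Rightarrow> real) \<Rightarrow> bool" for \<F> where
  base: "F \<in> \<F> \<Longrightarrow> indicator_span \<F> (\<lambda>x. c * indicator F x)"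
| add: "indicator_span \<F> s \<Longrightarrow> indicator_span \<F> t \<Longrightarrow> indicator_span \<F> (\<lambda>x. s x + t x)"

lemma indicator_span_scale: "indicator_span \<F> s \<Longrightarrow> indicator_span \<F> (\<lambda>x. a * s x)"
proof (induction rule: indicator_span.induct)
  case (base F c)
  then show ?case using indicator_span.base[of F \<F> "a * c"] by (simp add: mult.assoc)
next
  case (add s t)
  then show ?case using indicator_span.add by (fastforce simp: distrib_left)
qed

lemma indicator_span_bounded: "indicator_span \<F> s \<Longrightarrow> \<exists>C. \<forall>x. \<bar>s x\<bar> \<le> C"
proof (induction rule: indicator_span.induct)
  case (base F c)
  show ?case by (intro exI[of _ "\<bar>c\<bar>"]) (auto simp: indicator_def)
next
  case (add s t)
  then obtain C D where "\<And>x. \<bar>s x\<bar> \<le> C" "\<And>x. \<bar>t x\<bar> \<le> D" by blast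
  then have "\<bar>s x + t x\<bar> \<le> C + D" for x by (meson abs_triangle_ineq add_mono order_trans)
  then show ?case by blast
qed

lemma indicator_span_measurable:
  assumes "indicator_span \<F> s" "\<F> \<subseteq> sets N"
  shows "s \<in> borel_measurable N"
  using assms by (induction rule: indicator_span.induct) auto

text \<open>The complement of the frontier consists of two open sets, the interior and the exterior
  of \<open>F\<close>, and the indicator is constant on each.\<close>

lemma isCont_indicator_notin_frontier:
  assumes "y \<notin> frontier F"
  shows "isCont (indicator F :: 'b::metric_space \<Rightarrow> real) y"
proof (cases "y \<in> interior F")
  case True
  have "\<forall>\<^sub>F x in nhds y. indicator F x = (1::real)"
    unfolding eventually_nhds using True interior_subset[of F]
    by (intro exI[of _ "interior F"]) (auto simp: indicator_def)
  then show ?thesis using isCont_cong[of "indicator F" "\<lambda>_. 1::real" y] by simp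
next
  case False
  then have "y \<in> - closure F" using assms by (auto simp: frontier_def)
  then have "\<forall>\<^sub>F x in nhds y. indicator F x = (0::real)"
    unfolding eventually_nhds using closure_subset[of F]
    by (intro exI[of _ "- closure F"]) (auto simp: indicator_def)
  then show ?thesis using isCont_cong[of "indicator F" "\<lambda>_. 0::real" y] by simp
qed

lemma AE_isCont_indicator:
  fixes Q :: "'b::metric_space measure"
  assumes "prob_space Q" "sets Q = sets borel" "measure Q (frontier F) = 0"
  shows "AE y in Q. isCont (indicator F :: 'b \<Rightarrow> real) y"
proof -
  interpret prob_space Q by fact
  have "frontier F \<in> null_sets Q"
    using assms by (intro null_setsI) (auto simp: emeasure_eq_measure)
  then have "AE y in Q. y \<notin> frontier F" by (rule AE_not_in)
  then show ?thesis by eventually_elim (rule isCont_indicator_notin_frontier)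
qed

lemma AE_isCont_indicator_span:
  fixes Q :: "'b::metric_space measure"
  assumes "indicator_span \<F> s" "prob_space Q" "sets Q = sets borel"
    "\<And>F. F \<in> \<F> \<Longrightarrow> measure Q (frontier F) = 0"
  shows "AE y in Q. isCont s y"
  using assms(1)
proof (induction rule: indicator_span.induct)
  case (base F c)
  show ?case using AE_isCont_indicator[OF assms(2,3) assms(4)[OF base]]
    by eventually_elim (auto intro!: isCont_mult)
next
  case (add s t)
  from add(3,4) show ?case by eventually_elim (intro isCont_add)
qed

text \<open>The sets whose indicators lie in the \<open>L1\<close>-closure of the span form a Dynkin
  class: complements use that the whole space belongs to \<F>, disjoint unions use continuity of the
  measure. Stability under intersections extends this to the generated \<sigma>-algebra, and from
  indicators the usual induction reaches all integrable functions.\<close>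

lemma indicator_span_dense:
  fixes Q :: "'b measure" and h :: "'b \<Rightarrow> real"
  assumes Q: "prob_space Q" and Q_sets: "sets Q = sigma_sets (space Q) \<F>"
    and \<F>: "Int_stable \<F>" "space Q \<in> \<F>" "\<F> \<subseteq> Pow (space Q)"
    and h: "integrable Q h" and e: "e > 0"
  shows "\<exists>s. indicator_span \<F> s \<and> (\<integral>y. \<bar>h y - s y\<bar> \<partial>Q) < e"
proof -
  interpret prob_space Q by fact
  have sub: "\<F> \<subseteq> sets Q" unfolding Q_sets by auto
  have span_int: "integrable Q s" if "indicator_span \<F> s" for s
  proof -
    obtain C where "\<And>x. \<bar>s x\<bar> \<le> C" using indicator_span_bounded[OF \<open>indicator_span \<F> s\<close>] by blast
    then show ?thesis using indicator_span_measurable[OF \<open>indicator_span \<F> s\<close> sub] by (intro integrable_const_bound[of _ C]) auto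
  qed
  \<comment> \<open>Membership in the \<open>L1\<close>-closure of the span, as a predicate suitable
    for both inductions.\<close>
  define ok where "ok f \<longleftrightarrow> (\<forall>e>0. \<exists>s. indicator_span \<F> s \<and> (\<integral>y. \<bar>f y - s y\<bar> \<partial>Q) < e)" for f
  have ok_span: "ok s" if "indicator_span \<F> s" for s unfolding ok_def using that by (auto intro!: exI[of _ s])
  have ok_close: "ok f" if f: "integrable Q f"
    and lim: "\<And>e. e > 0 \<Longrightarrow> \<exists>g. integrable Q g \<and> ok g \<and> (\<integral>y. \<bar>f y - g y\<bar> \<partial>Q) < e" for f
    unfolding ok_def
  proof safe
    fix e :: real assume e: "e > 0"
    then obtain g where g: "integrable Q g" "ok g" "(\<integral>y. \<bar>f y - g y\<bar> \<partial>Q) < e / 2" using lim[of "e / 2"] by auto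
    then obtain s where s: "indicator_span \<F> s" "(\<integral>y. \<bar>g y - s y\<bar> \<partial>Q) < e / 2"
      using e unfolding ok_def by (meson half_gt_zero)
    have "(\<integral>y. \<bar>f y - s y\<bar> \<partial>Q) \<le> (\<integral>y. \<bar>f y - g y\<bar> + \<bar>g y - s y\<bar> \<partial>Q)"
      using f g(1) span_int[OF s(1)] by (intro integral_mono) auto
    also have "\<dots> = (\<integral>y. \<bar>f y - g y\<bar> \<partial>Q) + (\<integral>y. \<bar>g y - s y\<bar> \<partial>Q)"
      using f g(1) span_int[OF s(1)] by simp
    finally show "\<exists>s. indicator_span \<F> s \<and> (\<integral>y. \<bar>f y - s y\<bar> \<partial>Q) < e" using g(3) s by (intro exI[of _ s]) auto
  qed
  have ok_add: "ok (\<lambda>y. f y + g y)" if f: "integrable Q f" "ok f" and g: "integrable Q g" "ok g" for f g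
    unfolding ok_def
  proof safe
    fix e :: real assume e: "e > 0"
    then obtain s t where s: "indicator_span \<F> s" "(\<integral>y. \<bar>f y - s y\<bar> \<partial>Q) < e / 2"
      and t: "indicator_span \<F> t" "(\<integral>y. \<bar>g y - t y\<bar> \<partial>Q) < e / 2"
      using f g unfolding ok_def by (meson half_gt_zero)
    have "(\<integral>y. \<bar>f y + g y - (s y + t y)\<bar> \<partial>Q) \<le> (\<integral>y. \<bar>f y - s y\<bar> + \<bar>g y - t y\<bar> \<partial>Q)"
      using f g(1) span_int[OF s(1)] span_int[OF t(1)] by (intro integral_mono) auto
    also have "\<dots> = (\<integral>y. \<bar>f y - s y\<bar> \<partial>Q) + (\<integral>y. \<bar>g y - t y\<bar> \<partial>Q)"
      using f g(1) span_int[OF s(1)] span_int[OF t(1)] by simp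
    finally show "\<exists>s. indicator_span \<F> s \<and> (\<integral>y. \<bar>f y + g y - s y\<bar> \<partial>Q) < e"
      using s t by (intro exI[of _ "\<lambda>y. s y + t y"]) (auto intro: indicator_span.add)
  qed
  have ok_scale: "ok (\<lambda>y. c * f y)" if f: "integrable Q f" "ok f" for f c
    unfolding ok_def
  proof safe
    fix e :: real assume e: "e > 0"
    then have "e / (\<bar>c\<bar> + 1) > 0" by simp
    then obtain s where s: "indicator_span \<F> s" "(\<integral>y. \<bar>f y - s y\<bar> \<partial>Q) < e / (\<bar>c\<bar> + 1)"
      using f unfolding ok_def by blast
    have "(\<integral>y. \<bar>c * f y - c * s y\<bar> \<partial>Q) = \<bar>c\<bar> * (\<integral>y. \<bar>f y - s y\<bar> \<partial>Q)"
      by (simp add: abs_mult right_diff_distrib[symmetric])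
    also have "\<dots> \<le> (\<bar>c\<bar> + 1) * (\<integral>y. \<bar>f y - s y\<bar> \<partial>Q)" by (intro mult_right_mono) auto
    also have "\<dots> < e" using s(2) by (simp add: field_simps)
    finally show "\<exists>s. indicator_span \<F> s \<and> (\<integral>y. \<bar>c * f y - s y\<bar> \<partial>Q) < e"
      using s by (intro exI[of _ "\<lambda>y. c * s y"]) (auto intro: indicator_span_scale)
  qed
  have ind_int: "integrable Q (indicator B :: 'b \<Rightarrow> real)" if "B \<in> sets Q" for B
    using that by (simp add: less_top[symmetric])
  have ok_ind: "ok (indicator B)" if "B \<in> sigma_sets (space Q) \<F>" for B
    using \<F>(1) \<F>(3) that
  proof (induction rule: sigma_sets_induct_disjoint)
    case (basic F)
    then show ?case using ok_span[OF indicator_span.base[of F \<F> 1]] by simp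
  next
    case empty
    show ?case using ok_span[OF indicator_span.base[OF \<F>(2), of 0]] by (simp add: indicator_def)
  next
    case (compl B)
    then have B: "B \<in> sets Q" unfolding Q_sets by blast
    have "ok (\<lambda>y. 1 * indicator (space Q) y + - 1 * indicator B y)"
      using ok_add[OF _ ok_span[OF indicator_span.base[OF \<F>(2), of 1]] _ ok_scale[OF ind_int[OF B] compl(2), of "- 1"]]
        ind_int[OF B] ind_int[OF sets.top] by simp
    moreover have "1 * indicator (space Q) y + - 1 * indicator B y = (indicator (space Q - B) y :: real)" for y
      using sets.sets_into_space[OF B] by (auto simp: indicator_def)
    ultimately show ?case by simp
  next
    case (union E)
    have E: "E i \<in> sets Q" for i using union(2) unfolding Q_sets by auto
    define U where "U n = (\<Union>i<n. E i)" for n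
    have U: "U n \<in> sets Q" for n unfolding U_def using E by auto
    have UE: "(\<Union>i. E i) \<in> sets Q" using E by auto
    have okU: "ok (indicator (U n))" for n
    proof (induction n)
      case 0
      show ?case using ok_span[OF indicator_span.base[OF \<F>(2), of 0]] by (simp add: indicator_def U_def)
    next
      case (Suc n)
      have "ok (\<lambda>y. indicator (U n) y + indicator (E n) y)"
        using Suc union E U by (intro ok_add ind_int) auto
      moreover have "E i \<inter> E n = {}" if "i < n" for i
        using union(1) that by (auto simp: disjoint_family_on_def)
      then have "U n \<inter> E n = {}" unfolding U_def by blast
      then have "indicator (U n) y + indicator (E n) y = (indicator (U (Suc n)) y :: real)" for y
        unfolding U_def by (auto simp: indicator_def lessThan_Suc)
      ultimately show ?case by simp
    qed
    show ?case
    proof (rule ok_close)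
      fix e :: real assume e: "e > 0"
      have "(\<lambda>n. measure Q (U n)) \<longlonglongrightarrow> measure Q (\<Union>n. U n)"
        by (rule finite_Lim_measure_incseq) (use U in \<open>auto simp: U_def incseq_def intro: less_le_trans\<close>)
      moreover have "(\<Union>n. U n) = (\<Union>i. E i)" unfolding U_def by auto
      ultimately have "\<forall>\<^sub>F n in sequentially. measure Q (\<Union>i. E i) - e < measure Q (U n)"
        using e by (intro order_tendstoD) auto
      then obtain n where n: "measure Q (\<Union>i. E i) - e < measure Q (U n)" by (auto simp: eventually_sequentially)
      have "(\<integral>y. \<bar>indicator (\<Union>i. E i) y - indicator (U n) y\<bar> \<partial>Q)
          = (\<integral>y. indicator (\<Union>i. E i) y - indicator (U n) y \<partial>Q :: real)"
        unfolding U_def by (intro Bochner_Integration.integral_cong) (auto simp: indicator_def)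
      also have "\<dots> = measure Q (\<Union>i. E i) - measure Q (U n)"
        using ind_int[OF U] ind_int[OF UE] sets.Int_space_eq2[OF U] sets.Int_space_eq2[OF UE] by simp
      finally show "\<exists>g. integrable Q g \<and> ok g \<and> (\<integral>y. \<bar>indicator (\<Union>i. E i) y - g y\<bar> \<partial>Q) < e"
        using n okU ind_int[OF U] by (intro exI[of _ "indicator (U n)"]) auto
    qed (rule ind_int[OF UE])
  qed
  have "ok h" using h
  proof (induction rule: integrable_induct)
    case (base A c)
    then have "A \<in> sets Q" "A \<in> sigma_sets (space Q) \<F>" by (auto simp: Q_sets)
    from ok_scale[OF ind_int[OF this(1)] ok_ind[OF this(2)], of c]
    show ?case by (simp add: mult.commute)
  next
    case (add f g)
    then show ?case by (intro ok_add)
  next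
    case (lim f s)
    show ?case
    proof (rule ok_close)
      show "integrable Q f" by fact
      fix e :: real assume e: "e > 0"
      have "(\<lambda>i. \<integral>y. \<bar>f y - s i y\<bar> \<partial>Q) \<longlonglongrightarrow> (\<integral>y. 0 \<partial>Q)"
      \<comment> \<open>The induction rule supplies approximants bounded by twice the norm of
        \<open>f\<close>, which gives the factor 3 for the difference.\<close>
      proof (rule integral_dominated_convergence[where w = "\<lambda>y. 3 * \<bar>f y\<bar>"])
        show "AE y in Q. (\<lambda>i. \<bar>f y - s i y\<bar>) \<longlonglongrightarrow> 0"
        proof (rule AE_I2)
          fix y assume "y \<in> space Q"
          then have "(\<lambda>i. \<bar>f y - s i y\<bar>) \<longlonglongrightarrow> \<bar>f y - f y\<bar>" by (intro tendsto_intros lim)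
          then show "(\<lambda>i. \<bar>f y - s i y\<bar>) \<longlonglongrightarrow> 0" by simp
        qed
        show "AE y in Q. norm \<bar>f y - s i y\<bar> \<le> 3 * \<bar>f y\<bar>" for i
        proof (rule AE_I2)
          fix y assume "y \<in> space Q"
          then have "norm (s i y) \<le> 2 * norm (f y)" by (rule lim)
          then show "norm \<bar>f y - s i y\<bar> \<le> 3 * \<bar>f y\<bar>" by simp
        qed
      qed (use lim in auto)
      then have "\<forall>\<^sub>F i in sequentially. (\<integral>y. \<bar>f y - s i y\<bar> \<partial>Q) < e" using e by (intro order_tendstoD) auto
      then obtain i where "(\<integral>y. \<bar>f y - s i y\<bar> \<partial>Q) < e" by (auto simp: eventually_sequentially)
      then show "\<exists>g. integrable Q g \<and> ok g \<and> (\<integral>y. \<bar>f y - g y\<bar> \<partial>Q) < e"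
        using lim by (intro exI[of _ "s i"]) auto
    qed
  qed
  then show ?thesis using e unfolding ok_def by blast
qed

section \<open>Test functions on sequence space\<close>

lemma bounded_range_of_compact_UNIV:
  fixes h :: "'b::topological_space \<Rightarrow> real"
  assumes "compact (UNIV :: 'b set)" "continuous_on UNIV h"
  shows "bounded (range h)"
  using compact_continuous_image[OF assms(2,1)] by (rule compact_imp_bounded)

text \<open>The Bochner integral of a non-measurable function is \<open>0\<close>, so convergence of the integrals
  of every continuous test function forces each \<open>h \<circ> X l\<close> to be measurable for large \<open>l\<close>; Baire
  makes the threshold independent of \<open>h\<close>.\<close>

lemma weak_conv_law_eventually_measurable:
  fixes X :: "nat \<Rightarrow> 'a \<Rightarrow> 'b::metric_space"
  assumes cpt: "compact (UNIV :: 'b set)" and conv: "weak_conv_law P X Q"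
    and Q: "prob_space Q" "sets Q = sets borel"
  shows "\<exists>L. \<forall>l\<ge>L. X l \<in> borel_measurable (P l)"
proof -
  interpret Q: prob_space Q by fact
  define H where "H L = {h :: 'b \<Rightarrow>\<^sub>C real. \<forall>l\<ge>L. (\<lambda>x. apply_bcontfun h (X l x)) \<in> borel_measurable (P l)}" for L :: nat
  have H_closed: "closed (H L)" for L
    unfolding closed_sequential_limits
  proof safe
    fix h :: "nat \<Rightarrow> 'b \<Rightarrow>\<^sub>C real" and h0
    assume h: "\<forall>n. h n \<in> H L" and lim: "h \<longlonglongrightarrow> h0"
    have pt: "(\<lambda>n. apply_bcontfun (h n) y) \<longlonglongrightarrow> apply_bcontfun h0 y" for y
      using tendsto_bcontfun_uniform_limit[OF lim] by (rule tendsto_uniform_limitI) simp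
    show "h0 \<in> H L" unfolding H_def
    proof safe
      fix l assume "l \<ge> L"
      then show "(\<lambda>x. apply_bcontfun h0 (X l x)) \<in> borel_measurable (P l)"
        using h by (intro borel_measurable_LIMSEQ_real[OF pt]) (auto simp: H_def)
    qed
  qed
  have H_cover: "\<exists>L. h \<in> H L" for h
  proof -
    \<comment> \<open>The shift makes \<open>g\<close> at least 1, so the limit of its integrals is
      positive. A nonzero Bochner integral comes only from an integrable, hence measurable,
      function, and subtracting the constant recovers \<open>h\<close>.\<close>
    define g where "g y = apply_bcontfun h y + (norm h + 1)" for y
    have g_cont: "continuous_on UNIV g" unfolding g_def by (intro continuous_intros) auto
    have g_bdd: "bounded (range g)" by (rule bounded_range_of_compact_UNIV[OF cpt g_cont])
    have g1: "g y \<ge> 1" for y using norm_bounded[of h y] unfolding g_def by simp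
    obtain B where B: "\<And>y. \<bar>g y\<bar> \<le> B" using g_bdd by (auto simp: bounded_iff)
    have "g \<in> borel_measurable Q"
      using borel_measurable_continuous_onI[OF g_cont] Q(2) measurable_cong_sets by blast
    then have "integrable Q g" using B by (intro Q.integrable_const_bound[of _ B]) auto
    then have "(\<integral>y. 1 \<partial>Q) \<le> (\<integral>y. g y \<partial>Q)" using g1 by (intro integral_mono) auto
    then have "(\<integral>y. g y \<partial>Q) > 0" by (simp add: Q.prob_space)
    moreover have "(\<lambda>l. \<integral>x. g (X l x) \<partial>P l) \<longlonglongrightarrow> (\<integral>y. g y \<partial>Q)"
      using conv g_cont g_bdd unfolding weak_conv_law_def by blast
    ultimately have "\<forall>\<^sub>F l in sequentially. (\<integral>x. g (X l x) \<partial>P l) > 0" by (intro order_tendstoD)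
    then obtain L where L: "\<And>l. l \<ge> L \<Longrightarrow> (\<integral>x. g (X l x) \<partial>P l) > 0" by (auto simp: eventually_sequentially)
    have "(\<lambda>x. apply_bcontfun h (X l x)) \<in> borel_measurable (P l)" if "l \<ge> L" for l
    proof -
      have "integrable (P l) (\<lambda>x. g (X l x))" using L[OF that] not_integrable_integral_eq by fastforce
      then have "(\<lambda>x. g (X l x) - (norm h + 1)) \<in> borel_measurable (P l)" by simp
      then show ?thesis unfolding g_def by simp
    qed
    then show ?thesis unfolding H_def by auto
  qed
  have "\<exists>L. interior (H L) \<noteq> {}"
  proof (rule ccontr)
    assume "\<not> ?thesis"
    then have empty: "interior (H L) = {}" for L by blast
    have comp: "Met_TC.mcomplete TYPE('b \<Rightarrow>\<^sub>C real)"
      unfolding Met_TC.mcomplete_def by (auto simp: Cauchy_convergent_iff convergent_def)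
    have "Met_TC.mtopology interior_of \<Union>(range H) = {}"
      using H_closed empty by (intro Met_TC.metric_Baire_category_alt comp) auto
    moreover have "\<Union>(range H) = UNIV" using H_cover by auto
    ultimately show False by auto
  qed
  then obtain L h0 where "h0 \<in> interior (H L)" by blast
  then obtain e where e: "e > 0" "ball h0 e \<subseteq> H L" unfolding mem_interior by blast
  \<comment> \<open>Measurability is preserved by linear combinations. Every \<open>h\<close> is a
    rescaled difference of the centre \<open>h0\<close> and a nearby point of the ball; the summand
    1 in the denominator of \<open>t\<close> covers \<open>h = 0\<close>.\<close>
  have all: "h \<in> H L" for h
  proof -
    define t where "t = e / (2 * (norm h + 1))"
    have t: "t > 0" using e unfolding t_def by (simp add: add_nonneg_pos)
    have "t * norm h \<le> t * (norm h + 1)" using t by simp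
    also have "t * (norm h + 1) = e / 2" unfolding t_def by (simp add: field_simps add_nonneg_eq_0_iff)
    finally have "norm (t *\<^sub>R h) < e" using t e(1) by simp
    then have 1: "h0 + t *\<^sub>R h \<in> H L" using e(2) by (auto simp: dist_norm subset_iff)
    have 2: "h0 \<in> H L" using e by auto
    show ?thesis unfolding H_def
    proof safe
      fix l assume l: "l \<ge> L"
      have m1: "(\<lambda>x. apply_bcontfun (h0 + t *\<^sub>R h) (X l x)) \<in> borel_measurable (P l)"
        and m2: "(\<lambda>x. apply_bcontfun h0 (X l x)) \<in> borel_measurable (P l)"
        using 1 2 l unfolding H_def by blast+
      have "(\<lambda>x. (1 / t) * (apply_bcontfun (h0 + t *\<^sub>R h) (X l x) - apply_bcontfun h0 (X l x))) \<in> borel_measurable (P l)"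
        by (rule borel_measurable_times[OF borel_measurable_const borel_measurable_diff[OF m1 m2]])
      then show "(\<lambda>x. apply_bcontfun h (X l x)) \<in> borel_measurable (P l)"
        using t by simp
    qed
  qed
  have "X l \<in> borel_measurable (P l)" if l: "l \<ge> L" for l
  proof (rule borel_measurableI)
    fix S :: "'b set" assume S: "open S"
    show "X l -` S \<inter> space (P l) \<in> sets (P l)"
    \<comment> \<open>The distance to the empty set is 0 by convention, so the description of
      \<open>S\<close> as the set where the distance to its complement is positive fails for
      \<open>UNIV\<close>.\<close>
    proof (cases "S = UNIV")
      case False
      define h where "h y = infdist y (- S)" for y
      have h_cont: "continuous_on UNIV h" unfolding h_def by (intro continuous_intros)
      have "h \<in> bcontfun" unfolding bcontfun_def using h_cont bounded_range_of_compact_UNIV[OF cpt h_cont] by simp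
      then have "apply_bcontfun (Bcontfun h) = h" by (rule Bcontfun_inverse)
      then have [measurable]: "(\<lambda>x. h (X l x)) \<in> borel_measurable (P l)"
        using all[of "Bcontfun h"] l unfolding H_def by auto
      have "y \<in> S \<longleftrightarrow> h y > 0" for y
        using in_closed_iff_infdist_zero[of "- S" y] S False infdist_nonneg[of y "- S"]
        unfolding h_def by (auto simp: less_le)
      then have "X l -` S \<inter> space (P l) = {x \<in> space (P l). h (X l x) > 0}" by auto
      also have "\<dots> \<in> sets (P l)" by measurable
      finally show ?thesis .
    qed simp
  qed
  then show ?thesis by blast
qed

text \<open>The algebra to which the Stone-Weierstrass theorem is applied. Products over initial
  segments of coordinates are the right generators, because their integrals factor under the product
  measure and they permit induction on the length.\<close>

inductive coord_span :: "((nat \<Rightarrow> 'b::topological_space) \<Rightarrow> real) \<Rightarrow> bool" where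
  prod: "(\<And>i. continuous_on UNIV (h i)) \<Longrightarrow> coord_span (\<lambda>x. \<Prod>i<k. h i (x i))" for h :: "nat \<Rightarrow> 'b \<Rightarrow> real"
| add: "coord_span p \<Longrightarrow> coord_span q \<Longrightarrow> coord_span (\<lambda>x. p x + q x)"

lemma coord_span_continuous: "coord_span p \<Longrightarrow> continuous_on UNIV p"
proof (induction rule: coord_span.induct)
  case (prod h k)
  have "continuous_on UNIV (\<lambda>x. h i (x i))" for i
    using continuous_on_compose2[OF prod continuous_on_product_coordinates] by auto
  then show ?case by (intro continuous_on_prod)
next
  case (add p q)
  then show ?case by (intro continuous_on_add)
qed

lemma coord_span_mult:
  assumes "coord_span p" "coord_span q"
  shows "coord_span (\<lambda>x. p x * q x)"
  using assms
proof (induction arbitrary: q rule: coord_span.induct)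
  case (prod h k)
  note h = prod.hyps
  show ?case using prod.prems
  proof (induction rule: coord_span.induct)
    case (prod h' k')
    \<comment> \<open>Factors beyond either length are padded with 1, so that both products run over
      the same initial segment.\<close>
    define f where "f i y = (if i < k then h i y else 1) * (if i < k' then h' i y else 1)" for i y
    have "continuous_on UNIV (f i)" for i
      unfolding f_def using h prod by (cases "i < k"; cases "i < k'") (auto intro!: continuous_intros)
    then have "coord_span (\<lambda>x. \<Prod>i<max k k'. f i (x i))" by (rule coord_span.prod)
    moreover have "(\<Prod>i<max k k'. f i (x i)) = (\<Prod>i<k. h i (x i)) * (\<Prod>i<k'. h' i (x i))" for x
    proof -
      have "(\<Prod>i<max k k'. if i < k then h i (x i) else 1) = (\<Prod>i<k. h i (x i))"
        by (intro prod.mono_neutral_cong_right) auto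
      moreover have "(\<Prod>i<max k k'. if i < k' then h' i (x i) else 1) = (\<Prod>i<k'. h' i (x i))"
        by (intro prod.mono_neutral_cong_right) auto
      ultimately show ?thesis unfolding f_def prod.distrib by simp
    qed
    ultimately show ?case by simp
  next
    case (add p' q')
    then show ?case using coord_span.add by (fastforce simp: distrib_left)
  qed
next
  case (add p p')
  then show ?case using coord_span.add[OF add.IH(1)[OF add.prems] add.IH(2)[OF add.prems]]
    by (simp add: distrib_right)
qed

text \<open>The sequence space is compact by Tychonoff, and two sequences that differ at n are
  separated by the distance of the n-th coordinate to a fixed point.\<close>

lemma coord_span_dense:
  fixes g :: "(nat \<Rightarrow> 'b::metric_space) \<Rightarrow> real"
  assumes cpt: "compact (UNIV :: 'b set)" and g: "continuous_on UNIV g" and e: "e > 0"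
  shows "\<exists>p. coord_span p \<and> (\<forall>x. \<bar>g x - p x\<bar> < e)"
proof -
  have cont: "continuous_on UNIV h" if "coord_span h" for h :: "(nat \<Rightarrow> 'b) \<Rightarrow> real"
    using that by (rule coord_span_continuous)
  have "compact_space (product_topology (\<lambda>_::nat. euclidean :: 'b topology) UNIV)"
    using cpt by (subst compact_space_product_topology) (auto simp: compact_space_def)
  then have "compact (UNIV :: (nat \<Rightarrow> 'b) set)"
    by (simp add: euclidean_product_topology compact_space_def)
  then have "\<exists>p. coord_span p \<and> (\<forall>x\<in>UNIV. \<bar>g x - p x\<bar> < e)"
  proof (rule Stone_Weierstrass_HOL[where P = coord_span])
    show "coord_span (\<lambda>x::nat \<Rightarrow> 'b. c)" for c
      using coord_span.prod[of "\<lambda>_ _. c" 1] by simp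
    show "\<exists>f. coord_span f \<and> f x \<noteq> f y" if xy: "x \<in> UNIV \<and> y \<in> UNIV \<and> x \<noteq> y" for x y :: "nat \<Rightarrow> 'b"
    proof -
      obtain n where n: "x n \<noteq> y n" using xy by (auto simp: fun_eq_iff)
      define h where "h i z = (if i = n then dist z (x n) else 1)" for i z
      have "continuous_on UNIV (h i)" for i
        unfolding h_def by (cases "i = n") (auto intro!: continuous_intros)
      then have "coord_span (\<lambda>x. \<Prod>i<Suc n. h i (x i))" by (rule coord_span.prod)
      moreover have "(\<Prod>i<Suc n. h i (z i)) = dist (z n) (x n)" for z
        unfolding h_def by simp
      ultimately have "coord_span (\<lambda>z. dist (z n) (x n))" by simp
      then show ?thesis using n by (intro exI[of _ "\<lambda>z. dist (z n) (x n)"]) auto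
    qed
  qed (use g e cont in \<open>auto intro: coord_span.add coord_span_mult\<close>)
  then show ?thesis by simp
qed

lemma coord_span_measurable:
  fixes p :: "(nat \<Rightarrow> 'b::topological_space) \<Rightarrow> real"
  assumes p: "coord_span p" and X: "\<And>n. (\<lambda>x. X x n) \<in> borel_measurable N"
  shows "(\<lambda>x. p (X x)) \<in> borel_measurable N"
  using p
proof (induction rule: coord_span.induct)
  case (prod h k)
  have "(\<lambda>x. h i (X x i)) \<in> borel_measurable N" for i
    using measurable_compose[OF X borel_measurable_continuous_onI[OF prod]] .
  then show ?case by (intro borel_measurable_prod)
next
  case (add p q)
  then show ?case by (intro borel_measurable_add)
qed

text \<open>Only the first k coordinates occur, and their joint law under the infinite product is
  the finite product, where the integral factors.\<close>

lemma integral_PiM_prod: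
  fixes h :: "nat \<Rightarrow> 'b \<Rightarrow> real"
  assumes Q: "prob_space Q" and h: "\<And>i. integrable Q (h i)"
  shows "(\<integral>x. (\<Prod>i<k. h i (x i)) \<partial>PiM UNIV (\<lambda>_. Q)) = (\<Prod>i<k. \<integral>y. h i y \<partial>Q)"
proof -
  interpret product_prob_space "\<lambda>_::nat. Q" UNIV
    using Q by (intro product_prob_spaceI)
  have [measurable]: "h i \<in> borel_measurable Q" for i using h by auto
  have "(\<integral>x. (\<Prod>i<k. h i (x i)) \<partial>PiM {..<k} (\<lambda>_. Q)) =
      (\<integral>x. (\<Prod>i<k. h i (x i)) \<partial>distr (PiM UNIV (\<lambda>_. Q)) (PiM {..<k} (\<lambda>_. Q)) (\<lambda>x. restrict x {..<k}))"
    by (subst distr_PiM_restrict_finite) auto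
  also have "\<dots> = (\<integral>x. (\<Prod>i<k. h i (restrict x {..<k} i)) \<partial>PiM UNIV (\<lambda>_. Q))"
    by (intro integral_distr) measurable
  also have "\<dots> = (\<integral>x. (\<Prod>i<k. h i (x i)) \<partial>PiM UNIV (\<lambda>_. Q))" by simp
  finally show ?thesis using product_integral_prod[of "{..<k}" h] h by simp
qed

lemma coord_span_bounded:
  fixes p :: "(nat \<Rightarrow> 'b::topological_space) \<Rightarrow> real"
  assumes cpt: "compact (UNIV :: 'b set)" and "coord_span p"
  shows "\<exists>B. \<forall>y. \<bar>p y\<bar> \<le> B"
  using assms(2)
proof (induction rule: coord_span.induct)
  case (prod h k)
  have "\<exists>B. \<forall>y. \<bar>h i y\<bar> \<le> B" for i
    using bounded_range_of_compact_UNIV[OF cpt prod[of i]] by (auto simp: bounded_iff)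
  then obtain B where B: "\<And>i y. \<bar>h i y\<bar> \<le> B i" by metis
  have "\<bar>\<Prod>i<k. h i (y i)\<bar> \<le> (\<Prod>i<k. B i)" for y
    unfolding abs_prod by (intro prod_mono) (auto simp: B)
  then show ?case by blast
next
  case (add p q)
  then obtain B B' where "\<And>y. \<bar>p y\<bar> \<le> B" "\<And>y. \<bar>q y\<bar> \<le> B'" by blast
  then have "\<bar>p y + q y\<bar> \<le> B + B'" for y by (meson abs_triangle_ineq add_mono order_trans)
  then show ?case by blast
qed

lemma coord_span_integrable:
  fixes p :: "(nat \<Rightarrow> 'b::topological_space) \<Rightarrow> real"
  assumes "compact (UNIV :: 'b set)" "coord_span p" "prob_space N" "\<And>n. (\<lambda>x. Y x n) \<in> borel_measurable N"
  shows "integrable N (\<lambda>x. p (Y x))"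
proof -
  interpret prob_space N by fact
  obtain B where "\<And>y. \<bar>p y\<bar> \<le> B" using coord_span_bounded[OF assms(1,2)] by blast
  then show ?thesis using coord_span_measurable[OF assms(2,4)] by (intro integrable_const_bound[of _ B]) auto
qed

text \<open>\<open>Y\<close> is controlled coordinate by coordinate. A continuous \<open>g\<close>
  is a uniform limit of functions in \<open>coord_span\<close>, each of which depends on finitely
  many coordinates.\<close>

lemma continuous_coord_measurable:
  fixes g :: "(nat \<Rightarrow> 'b::metric_space) \<Rightarrow> real"
  assumes cpt: "compact (UNIV :: 'b set)" and g: "continuous_on UNIV g"
    and Y: "\<And>n. (\<lambda>x. Y x n) \<in> borel_measurable N"
  shows "(\<lambda>x. g (Y x)) \<in> borel_measurable N"
proof -
  have "\<forall>m::nat. \<exists>p. coord_span p \<and> (\<forall>y. \<bar>g y - p y\<bar> < 1 / Suc m)"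
    using coord_span_dense[OF cpt g] by simp
  then obtain p where p: "\<And>m::nat. coord_span (p m)" "\<And>m y. \<bar>g y - p m y\<bar> < 1 / Suc m"
    by metis
  have "(\<lambda>m. p m y) \<longlonglongrightarrow> g y" for y
  proof (rule metric_LIMSEQ_I)
    fix r :: real assume "r > 0"
    then obtain m where m: "1 / Suc m < r" using nat_approx_posE by blast
    have "dist (p k y) (g y) < r" if "k \<ge> m" for k
    proof -
      have "1 / real (Suc k) \<le> 1 / Suc m" using that by (simp add: frac_le)
      then show ?thesis using p(2)[of y k] m unfolding dist_real_def by linarith
    qed
    then show "\<exists>no. \<forall>n\<ge>no. dist (p n y) (g y) < r" by blast
  qed
  then show ?thesis by (rule borel_measurable_LIMSEQ_real) (rule coord_span_measurable[OF p(1) Y])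
qed

lemma integral_uniformly_close:
  fixes g p :: "'a \<Rightarrow> real"
  assumes N: "prob_space N" and "integrable N g" "integrable N p" "\<And>x. \<bar>g x - p x\<bar> < e"
  shows "\<bar>(\<integral>x. g x \<partial>N) - (\<integral>x. p x \<partial>N)\<bar> \<le> e"
proof -
  interpret prob_space N by fact
  have "\<bar>\<integral>x. g x - p x \<partial>N\<bar> \<le> (\<integral>x. \<bar>g x - p x\<bar> \<partial>N)" by (rule integral_abs_bound)
  also have "\<dots> \<le> (\<integral>x. e \<partial>N)" using assms by (intro integral_mono) (auto intro: less_imp_le)
  finally show ?thesis using assms by (simp add: prob_space)
qed

text \<open>Approximating \<open>g\<close> uniformly by \<open>p\<close> changes every integral by
  at most r / 3, whatever the index l, so convergence for \<open>p\<close> yields convergence for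
  \<open>g\<close>.\<close>

lemma weak_conv_law_if_coord_prods:
  fixes X :: "nat \<Rightarrow> 'a \<Rightarrow> nat \<Rightarrow> 'b::metric_space"
  assumes cpt: "compact (UNIV :: 'b set)"
    and P: "\<And>l. prob_space (P l)" and X: "\<And>l n. (\<lambda>x. X l x n) \<in> borel_measurable (P l)"
    and R: "prob_space R" and coord: "\<And>n. (\<lambda>y. y n) \<in> borel_measurable R"
    and lim: "\<And>h k. (\<And>i. continuous_on UNIV (h i :: 'b \<Rightarrow> real)) \<Longrightarrow>
      (\<lambda>l. \<integral>x. (\<Prod>i<k. h i (X l x i)) \<partial>P l) \<longlonglongrightarrow> (\<integral>y. (\<Prod>i<k. h i (y i)) \<partial>R)"
  shows "weak_conv_law P X R"
  unfolding weak_conv_law_def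
proof safe
  fix g :: "(nat \<Rightarrow> 'b) \<Rightarrow> real"
  assume g: "continuous_on UNIV g" and bdd: "bounded (range g)"
  interpret R: prob_space R by fact
  interpret P: prob_space "P l" for l by (rule P)
  obtain C where C: "\<And>y. \<bar>g y\<bar> \<le> C" using bdd by (auto simp: bounded_iff)
  have gP: "integrable (P l) (\<lambda>x. g (X l x))" for l
    using continuous_coord_measurable[OF cpt g X] C by (intro P.integrable_const_bound[of _ C]) auto
  have gR: "integrable R g"
    using continuous_coord_measurable[OF cpt g coord] C by (intro R.integrable_const_bound[of _ C]) auto
  have pP: "integrable (P l) (\<lambda>x. p (X l x))" if "coord_span p" for l p
    by (rule coord_span_integrable[OF cpt that P X])
  have pR: "integrable R p" if "coord_span p" for p
    by (rule coord_span_integrable[OF cpt that R coord])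
  have p_lim: "(\<lambda>l. \<integral>x. p (X l x) \<partial>P l) \<longlonglongrightarrow> (\<integral>y. p y \<partial>R)" if "coord_span p" for p
    using that
  proof (induction rule: coord_span.induct)
    case (prod h k)
    then show ?case by (rule lim)
  next
    case (add p q)
    have "(\<integral>x. p (X l x) + q (X l x) \<partial>P l) = (\<integral>x. p (X l x) \<partial>P l) + (\<integral>x. q (X l x) \<partial>P l)" for l
      using pP add by (intro Bochner_Integration.integral_add) auto
    moreover have "(\<integral>y. p y + q y \<partial>R) = (\<integral>y. p y \<partial>R) + (\<integral>y. q y \<partial>R)"
      using pR add by (intro Bochner_Integration.integral_add) auto
    ultimately show ?case using add by (simp add: tendsto_add)
  qed
  show "(\<lambda>l. \<integral>x. g (X l x) \<partial>P l) \<longlonglongrightarrow> (\<integral>y. g y \<partial>R)"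
  proof (rule metric_LIMSEQ_I)
    fix r :: real assume r: "r > 0"
    then obtain p where p: "coord_span p" "\<And>y. \<bar>g y - p y\<bar> < r / 3"
      using coord_span_dense[OF cpt g, of "r / 3"] by auto
    obtain no where no: "\<And>l. l \<ge> no \<Longrightarrow> dist (\<integral>x. p (X l x) \<partial>P l) (\<integral>y. p y \<partial>R) < r / 3"
      using metric_LIMSEQ_D[OF p_lim[OF p(1)], of "r / 3"] r by auto
    have "dist (\<integral>x. g (X l x) \<partial>P l) (\<integral>y. g y \<partial>R) < r" if "l \<ge> no" for l
      using no[OF that] integral_uniformly_close[OF P gP pP[OF p(1)] p(2), of l]
        integral_uniformly_close[OF R gR pR[OF p(1)] p(2)] unfolding dist_real_def by linarith
    then show "\<exists>no. \<forall>l\<ge>no. dist (\<integral>x. g (X l x) \<partial>P l) (\<integral>y. g y \<partial>R) < r" by blast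
  qed
qed

section \<open>Decorrelation of successive visits\<close>

lemma abs_integral_le_const:
  fixes f :: "'a \<Rightarrow> real"
  assumes "prob_space N" "f \<in> borel_measurable N" "\<And>x. x \<in> space N \<Longrightarrow> \<bar>f x\<bar> \<le> C"
  shows "\<bar>\<integral>x. f x \<partial>N\<bar> \<le> C"
proof -
  interpret prob_space N by fact
  have "integrable N f" using assms by (intro integrable_const_bound[of _ C]) auto
  then have "(\<integral>x. \<bar>f x\<bar> \<partial>N) \<le> (\<integral>x. C \<partial>N)" using assms by (intro integral_mono) auto
  then show ?thesis by (intro order_trans[OF integral_abs_bound]) (simp add: prob_space)
qed

text \<open>Written without division, the identity also covers null \<open>B\<close>, where both
  sides vanish.\<close>

lemma (in finite_measure) integral_indicator_eq_cond_meas: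
  fixes f :: "'a \<Rightarrow> real"
  assumes B [measurable]: "B \<in> sets M" and f [measurable]: "f \<in> borel_measurable M"
  shows "(\<integral>x. indicator B x * f x \<partial>M) = measure M B * (\<integral>x. f x \<partial>cond_meas M B)"
proof (cases "measure M B = 0")
  case True
  then have "B \<in> null_sets M" using B by (intro null_setsI) (auto simp: emeasure_eq_measure)
  then have "AE x in M. indicator B x * f x = 0"
    using AE_not_in[of B M] by (auto simp: indicator_def)
  then have "(\<integral>x. indicator B x * f x \<partial>M) = 0" by (rule integral_eq_zero_AE)
  then show ?thesis using True by simp
next
  case False
  then show ?thesis by (simp add: integral_cond_meas)
qed

lemma dP_refl [simp]: "dP M N N = 0"
proof -
  have "sets M \<noteq> {}" by auto
  then show ?thesis unfolding dP_def by (simp add: cSUP_const)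
qed

text \<open>The setting after two reductions: \<open>\<psi> l\<close> is measurable on all of
  \<open>M\<close>, and the delays are given in the general \<epsilon>-form only.\<close>

locale rare_observables = ergodic_system M T
  for M :: "'a measure" and T :: "'a \<Rightarrow> 'a" +
  fixes A :: "nat \<Rightarrow> 'a set" and \<psi> :: "nat \<Rightarrow> 'a \<Rightarrow> 'b::metric_space"
    and Q :: "'b measure" and \<F> :: "'b set set"
  assumes A [measurable]: "\<And>l. A l \<in> sets M"
    and A_pos: "\<And>l. measure M (A l) > 0"
    and A_rare: "(\<lambda>l. measure M (A l)) \<longlonglongrightarrow> 0"
    and cpt: "compact (UNIV :: 'b set)"
    and \<psi> [measurable]: "\<And>l. \<psi> l \<in> borel_measurable M"
    and Q: "prob_space Q" and Q_sets: "sets Q = sets borel"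
    and \<psi>_conv: "weak_conv_law (\<lambda>l. cond_meas M (A l)) \<psi> Q"
    and \<F>_Int: "Int_stable \<F>"
    and \<F>_gen: "sigma_sets UNIV \<F> = sets (borel :: 'b measure)"
    and \<F>_UNIV: "UNIV \<in> \<F>"
    and \<F>_bdry: "\<And>F. F \<in> \<F> \<Longrightarrow> measure Q (frontier F) = 0"
    and escape: "\<And>\<epsilon>::real. \<epsilon> > 0 \<Longrightarrow> \<exists>\<nu>. (\<forall>l. \<nu> l \<in> Pmeas M \<and> dP M (\<nu> l) (cond_meas M (A l)) < \<epsilon>) \<and>
          (\<forall>F\<in>\<F>. measure Q F > 0 \<longrightarrow>
             (\<exists>K \<nu>F \<tau>. P_compact M K \<and> (\<forall>l. \<nu>F l \<in> Pmeas M) \<and>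
                (\<lambda>l. dP M (\<nu>F l) (cond_meas (\<nu> l) (A l \<inter> \<psi> l -` F \<inter> space M))) \<longlonglongrightarrow> 0 \<and>
                (\<forall>l. \<tau> l \<in> measurable M (count_space UNIV)) \<and>
                (\<lambda>l. measure (\<nu>F l) {x \<in> space M. enat (\<tau> l x) < ret_time T (A l) x})
                   \<longlonglongrightarrow> 1 \<and>
                (\<forall>l. push_tau T (\<tau> l) (\<nu>F l) \<in> K)))"
begin

sublocale Q: prob_space Q by (rule Q)

sublocale \<mu>A: prob_space "cond_meas M (A l)" for l
  by (rule prob_space_cond_meas[OF A A_pos])

abbreviation proc :: "nat \<Rightarrow> 'a \<Rightarrow> nat \<Rightarrow> 'b" where
  "proc l \<equiv> loc_proc T (A l) (\<psi> l)"

abbreviation proc0 :: "nat \<Rightarrow> 'a \<Rightarrow> nat \<Rightarrow> 'b" where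
  "proc0 l \<equiv> loc_proc0 T (A l) (\<psi> l)"

lemma proc0_measurable: "(\<lambda>x. proc0 l x n) \<in> borel_measurable M"
proof -
  have [measurable]: "(ret_map T (A l) ^^ n) \<in> measurable M M" by (induction n) auto
  show ?thesis unfolding loc_proc0_def by measurable
qed

lemma proc_measurable: "(\<lambda>x. proc l x n) \<in> borel_measurable M"
  unfolding loc_proc_eq_loc_proc0 using measurable_compose[OF ret_map_measurable[OF A] proc0_measurable] .

lemma sets_\<F>: "F \<in> \<F> \<Longrightarrow> F \<in> sets borel"
  using \<F>_gen by auto

lemma sets_visit: "F \<in> \<F> \<Longrightarrow> A l \<inter> \<psi> l -` F \<inter> space M \<in> sets M"
proof -
  assume "F \<in> \<F>"
  then have "\<psi> l -` F \<inter> space M \<in> sets M" using sets_\<F> measurable_sets[OF \<psi>] by blast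
  then show ?thesis using sets.Int[OF A[of l]] by (simp add: Int_assoc)
qed

lemma proc_asymptotically_invariant:
  assumes G [measurable]: "\<And>l. (\<lambda>x. g (proc l x)) \<in> borel_measurable M"
    and gC: "\<And>y. \<bar>g y\<bar> \<le> (C::real)"
  shows "(\<lambda>l. \<integral>x. \<bar>g (proc l (T x)) - g (proc l x)\<bar> \<partial>M) \<longlonglongrightarrow> 0"
proof (rule Lim_null_comparison)
  have "(\<lambda>l. 2 * C * measure M (A l)) \<longlonglongrightarrow> 2 * C * 0" by (intro tendsto_intros A_rare)
  then show "(\<lambda>l. 2 * C * measure M (A l)) \<longlonglongrightarrow> 0" by simp
  show "\<forall>\<^sub>F l in sequentially. norm (\<integral>x. \<bar>g (proc l (T x)) - g (proc l x)\<bar> \<partial>M) \<le> 2 * C * measure M (A l)"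
  proof (rule always_eventually, rule allI)
    fix l
    have [measurable]: "(\<lambda>x. g (proc l (T x))) \<in> borel_measurable M"
      using measurable_compose[OF T_measurable G] .
    have C: "C \<ge> 0" using gC[of undefined] by linarith
    have b: "\<bar>g y - g z\<bar> \<le> 2 * C" for y z using gC[of y] gC[of z] by linarith
    have "(\<integral>x. \<bar>g (proc l (T x)) - g (proc l x)\<bar> \<partial>M)
        \<le> (\<integral>x. 2 * C * indicator (T -` A l \<inter> space M) x \<partial>M)"
    proof (rule integral_mono_AE)
      show "integrable M (\<lambda>x. \<bar>g (proc l (T x)) - g (proc l x)\<bar>)"
        using b by (intro integrable_bounded[of _ "2 * C"]) auto
      show "integrable M (\<lambda>x. 2 * C * indicator (T -` A l \<inter> space M) x)"
        using C by (intro integrable_bounded[of _ "2 * C"]) (auto simp: indicator_def)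
      show "AE x in M. \<bar>g (proc l (T x)) - g (proc l x)\<bar> \<le> 2 * C * indicator (T -` A l \<inter> space M) x"
        using AE_recurrent_set[OF A A_pos, of l] AE_space
      proof eventually_elim
        case (elim x)
        show ?case
        proof (cases "T x \<in> A l")
          case True
          then show ?thesis using b elim by simp
        next
          case False
          then have "enat 1 < ret_time T (A l) x"
            unfolding less_ret_time_iff by (auto simp: le_Suc_eq)
          from loc_proc_T_power[OF elim(1) this, of "\<psi> l"] show ?thesis using C by simp
        qed
      qed
    qed
    also have "\<dots> = 2 * C * measure M (A l)" using measure_vimage_T[OF A] by simp
    finally show "norm (\<integral>x. \<bar>g (proc l (T x)) - g (proc l x)\<bar> \<partial>M) \<le> 2 * C * measure M (A l)" by simp
  qed
qed

text \<open>The integral of the future is carried along a chain of measures: from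
  \<open>\<nu> l\<close> conditioned on \<open>B l\<close> to \<open>\<nu>F l\<close> by closeness
  in \<open>dP\<close>, to its image under the delay because the process is unchanged before the
  first return, and to \<open>M\<close> by compactness. Multiplying the result by the mass of
  \<open>B l\<close>, which is at most 1, does not enlarge these errors; passing between
  \<open>\<nu> l\<close> and \<open>cond_meas M (A l)\<close> costs a multiple of
  \<epsilon>.\<close>

lemma visit_decorrelates:
  assumes G [measurable]: "\<And>l. (\<lambda>x. g (proc l x)) \<in> borel_measurable M"
    and gC: "\<And>y. \<bar>g y\<bar> \<le> C" and C: "(C::real) > 0"
    and F: "F \<in> \<F>" "measure Q F > 0"
  defines "B \<equiv> \<lambda>l. A l \<inter> \<psi> l -` F \<inter> space M"
  shows "(\<lambda>l. (\<integral>x. indicator (B l) x * g (proc l x) \<partial>cond_meas M (A l))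
      - measure (cond_meas M (A l)) (B l) * (\<integral>x. g (proc l x) \<partial>M)) \<longlonglongrightarrow> 0"
proof (rule LIMSEQ_I)
  fix r :: real assume r: "r > 0"
  have B [measurable]: "B l \<in> sets M" for l unfolding B_def by (rule sets_visit[OF F(1)])
  \<comment> \<open>Changing the measure costs 2 * C * \<epsilon> for the joint integral and C *
    \<epsilon> / 2 for the mass of \<open>B l\<close>, together at most 5 * r / 8. With the
    vanishing errors kept below r / 4 the total stays below r.\<close>
  define \<epsilon> where "\<epsilon> = r / (4 * C)"
  have \<epsilon>: "\<epsilon> > 0" using r C unfolding \<epsilon>_def by simp
  obtain \<nu> where \<nu>: "\<And>l. \<nu> l \<in> Pmeas M" "\<And>l. dP M (\<nu> l) (cond_meas M (A l)) < \<epsilon>"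
    and esc: "\<forall>F\<in>\<F>. measure Q F > 0 \<longrightarrow>
             (\<exists>K \<nu>F \<tau>. P_compact M K \<and> (\<forall>l. \<nu>F l \<in> Pmeas M) \<and>
                (\<lambda>l. dP M (\<nu>F l) (cond_meas (\<nu> l) (A l \<inter> \<psi> l -` F \<inter> space M))) \<longlonglongrightarrow> 0 \<and>
                (\<forall>l. \<tau> l \<in> measurable M (count_space UNIV)) \<and>
                (\<lambda>l. measure (\<nu>F l) {x \<in> space M. enat (\<tau> l x) < ret_time T (A l) x})
                   \<longlonglongrightarrow> 1 \<and>
                (\<forall>l. push_tau T (\<tau> l) (\<nu>F l) \<in> K))"
    using escape[OF \<epsilon>] by blast
  obtain K \<nu>F \<tau> where K: "P_compact M K" and \<nu>F: "\<And>l. \<nu>F l \<in> Pmeas M"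
    and dF: "(\<lambda>l. dP M (\<nu>F l) (cond_meas (\<nu> l) (B l))) \<longlonglongrightarrow> 0"
    and \<tau> [measurable]: "\<And>l. \<tau> l \<in> measurable M (count_space UNIV)"
    and \<tau>lim: "(\<lambda>l. measure (\<nu>F l) {x \<in> space M. enat (\<tau> l x) < ret_time T (A l) x}) \<longlonglongrightarrow> 1"
    and push: "\<And>l. push_tau T (\<tau> l) (\<nu>F l) \<in> K"
    using esc[rule_format, OF F] unfolding B_def by blast
  have sets\<nu> [measurable_cong]: "sets (\<nu> l) = sets M" and prob\<nu>: "prob_space (\<nu> l)" for l
    using \<nu>(1)[of l] unfolding Pmeas_def by auto
  have sets\<nu>F [measurable_cong]: "sets (\<nu>F l) = sets M" and prob\<nu>F: "prob_space (\<nu>F l)"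
    and ac\<nu>F: "absolutely_continuous M (\<nu>F l)" for l
    using \<nu>F[of l] unfolding Pmeas_def by auto
  have space\<nu>F: "space (\<nu>F l) = space M" for l using sets\<nu>F by (rule sets_eq_imp_space_eq)
  interpret \<nu>: prob_space "\<nu> l" for l by (rule prob\<nu>)
  interpret \<nu>F: prob_space "\<nu>F l" for l by (rule prob\<nu>F)
  define I where "I l = (\<integral>x. g (proc l x) \<partial>M)" for l
  define J where "J l = (\<integral>x. g (proc l x) \<partial>push_tau T (\<tau> l) (\<nu>F l))" for l
  define S where "S l = {x \<in> space M. enat (\<tau> l x) < ret_time T (A l) x}" for l
  have S [measurable]: "S l \<in> sets M" for l unfolding S_def by (rule sets_less_ret_time[OF A \<tau>])
  have pow [measurable]: "(\<lambda>x. (T ^^ \<tau> l x) x) \<in> measurable M M" for l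
    by (rule measurable_compose_countable[where f = "\<lambda>n x. (T ^^ n) x"]) measurable
  have Gpow [measurable]: "(\<lambda>x. g (proc l ((T ^^ \<tau> l x) x))) \<in> borel_measurable M" for l
    using measurable_compose[OF pow G] .
  have "(\<lambda>l. J l - I l) \<longlonglongrightarrow> 0"
    unfolding J_def I_def
    by (rule asymptotically_invariant_tendsto_P_compact[OF G gC proc_asymptotically_invariant[OF G gC] K push])
  moreover have J_bound: "\<bar>(\<integral>x. g (proc l x) \<partial>\<nu>F l) - J l\<bar> \<le> 2 * C * (1 - measure (\<nu>F l) (S l))" for l
  proof -
    have "J l = (\<integral>x. g (proc l ((T ^^ \<tau> l x) x)) \<partial>\<nu>F l)"
      unfolding J_def push_tau_def by (rule integral_distr) measurable
    moreover have i1: "integrable (\<nu>F l) (\<lambda>x. g (proc l x))"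
      using gC by (intro \<nu>F.integrable_const_bound[of _ C]) auto
    moreover have i2: "integrable (\<nu>F l) (\<lambda>x. g (proc l ((T ^^ \<tau> l x) x)))"
      using gC by (intro \<nu>F.integrable_const_bound[of _ C]) auto
    ultimately have "\<bar>(\<integral>x. g (proc l x) \<partial>\<nu>F l) - J l\<bar> =
        \<bar>\<integral>x. g (proc l x) - g (proc l ((T ^^ \<tau> l x) x)) \<partial>\<nu>F l\<bar>" by simp
    also have "\<dots> \<le> (\<integral>x. \<bar>g (proc l x) - g (proc l ((T ^^ \<tau> l x) x))\<bar> \<partial>\<nu>F l)" by (rule integral_abs_bound)
    \<comment> \<open>On \<open>S l\<close> the delay ends before the first return, so at recurrent
      points the two integrands agree; elsewhere they differ by at most 2 * C.\<close>
    also have "\<dots> \<le> (\<integral>x. 2 * C * indicator (space M - S l) x \<partial>\<nu>F l)"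
    proof (rule integral_mono_AE)
      show "integrable (\<nu>F l) (\<lambda>x. \<bar>g (proc l x) - g (proc l ((T ^^ \<tau> l x) x))\<bar>)" using i1 i2 by auto
      show "integrable (\<nu>F l) (\<lambda>x. 2 * C * indicator (space M - S l) x)"
        using C by (intro \<nu>F.integrable_const_bound[of _ "2 * C"]) (auto simp: indicator_def)
      have "AE x in \<nu>F l. x \<in> recurrent_set (A l)"
        using absolutely_continuous_AE[OF sets\<nu>F ac\<nu>F AE_recurrent_set[OF A A_pos]] .
      then show "AE x in \<nu>F l. \<bar>g (proc l x) - g (proc l ((T ^^ \<tau> l x) x))\<bar> \<le> 2 * C * indicator (space M - S l) x"
      proof eventually_elim
        case (elim x)
        show ?case
        proof (cases "x \<in> S l")
          case True
          then show ?thesis using loc_proc_T_power[OF elim, of "\<tau> l x" "\<psi> l"] unfolding S_def by simp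
        next
          case False
          have "x \<in> space M" using elim by (simp add: recurrent_set_def)
          moreover have "\<bar>g y - g z\<bar> \<le> 2 * C" for y z using gC[of y] gC[of z] by linarith
          ultimately show ?thesis using False by simp
        qed
      qed
    qed
    also have "\<dots> = 2 * C * (1 - measure (\<nu>F l) (S l))"
      using \<nu>F.prob_compl[of "S l" l] by (simp add: sets\<nu>F space\<nu>F Int_absorb1)
    finally show ?thesis .
  qed
  moreover have F_bound: "\<bar>(\<integral>x. g (proc l x) \<partial>\<nu>F l) - (\<integral>x. g (proc l x) \<partial>cond_meas (\<nu> l) (B l))\<bar>
      \<le> 2 * C * dP M (\<nu>F l) (cond_meas (\<nu> l) (B l))" for l
    using gC C by (intro integral_diff_le_dP)
      (auto intro!: \<nu>.finite_measure_cond_meas simp: sets\<nu> sets\<nu>F \<nu>F.finite_measure_axioms)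
  define err where "err l = \<bar>J l - I l\<bar> + 2 * C * (1 - measure (\<nu>F l) (S l))
    + 2 * C * dP M (\<nu>F l) (cond_meas (\<nu> l) (B l))" for l
  have "(\<lambda>l. \<bar>J l - I l\<bar> + 2 * C * (1 - measure (\<nu>F l) (S l))
    + 2 * C * dP M (\<nu>F l) (cond_meas (\<nu> l) (B l))) \<longlonglongrightarrow> \<bar>0\<bar> + 2 * C * (1 - 1) + 2 * C * 0"
    using \<open>(\<lambda>l. J l - I l) \<longlonglongrightarrow> 0\<close> \<tau>lim dF unfolding S_def by (intro tendsto_intros)
  then have "err \<longlonglongrightarrow> 0" unfolding err_def by simp
  then have "\<forall>\<^sub>F l in sequentially. err l < r / 4" using r by (intro order_tendstoD) auto
  then have "\<forall>\<^sub>F l in sequentially. norm ((\<integral>x. indicator (B l) x * g (proc l x) \<partial>cond_meas M (A l))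
      - measure (cond_meas M (A l)) (B l) * I l - 0) < r"
  proof eventually_elim
    case (elim l)
    let ?N = "cond_meas (\<nu> l) (B l)"
    have "\<bar>indicator (B l) x * g (proc l x)\<bar> \<le> C" for x
      using gC[of "proc l x"] C by (auto simp: indicator_def)
    then have 1: "\<bar>(\<integral>x. indicator (B l) x * g (proc l x) \<partial>\<nu> l) - (\<integral>x. indicator (B l) x * g (proc l x) \<partial>cond_meas M (A l))\<bar>
        \<le> 2 * C * dP M (\<nu> l) (cond_meas M (A l))"
      using C by (intro integral_diff_le_dP)
        (auto simp: sets\<nu> \<nu>.finite_measure_axioms \<mu>A.finite_measure_axioms)
    have 2: "(\<integral>x. indicator (B l) x * g (proc l x) \<partial>\<nu> l) = measure (\<nu> l) (B l) * (\<integral>x. g (proc l x) \<partial>?N)"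
      by (rule \<nu>.integral_indicator_eq_cond_meas) measurable
    have "\<bar>(\<integral>x. g (proc l x) \<partial>?N) - I l\<bar> \<le> err l"
      using J_bound[of l] F_bound[of l] unfolding err_def by linarith
    then have "measure (\<nu> l) (B l) * \<bar>(\<integral>x. g (proc l x) \<partial>?N) - I l\<bar> \<le> 1 * err l"
      using \<nu>.prob_le_1 by (intro mult_mono) auto
    then have 3: "\<bar>measure (\<nu> l) (B l) * (\<integral>x. g (proc l x) \<partial>?N) - measure (\<nu> l) (B l) * I l\<bar> \<le> err l"
      by (simp add: right_diff_distrib[symmetric] abs_mult)
    have "\<bar>measure (\<nu> l) (B l) - measure (cond_meas M (A l)) (B l)\<bar> \<le> dP M (\<nu> l) (cond_meas M (A l)) / 2"
      using \<nu>.finite_measure_axioms \<mu>A.finite_measure_axioms sets\<nu> by (intro abs_measure_diff_le_dP) auto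
    moreover have "\<bar>I l\<bar> \<le> C" unfolding I_def using gC by (intro abs_integral_le_const prob_space_axioms) auto
    ultimately have "\<bar>measure (\<nu> l) (B l) - measure (cond_meas M (A l)) (B l)\<bar> * \<bar>I l\<bar> \<le> dP M (\<nu> l) (cond_meas M (A l)) / 2 * C"
      by (intro mult_mono') auto
    then have 4: "\<bar>measure (\<nu> l) (B l) * I l - measure (cond_meas M (A l)) (B l) * I l\<bar> \<le> dP M (\<nu> l) (cond_meas M (A l)) / 2 * C"
      by (simp add: left_diff_distrib[symmetric] abs_mult)
    have "C * dP M (\<nu> l) (cond_meas M (A l)) \<le> C * \<epsilon>" using \<nu>(2)[of l] C by (intro mult_left_mono) auto
    then have "C * dP M (\<nu> l) (cond_meas M (A l)) \<le> r / 4" using C unfolding \<epsilon>_def by simp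
    moreover define d where "d = C * dP M (\<nu> l) (cond_meas M (A l))"
    moreover have "2 * C * dP M (\<nu> l) (cond_meas M (A l)) = 2 * d"
      "dP M (\<nu> l) (cond_meas M (A l)) / 2 * C = d / 2" unfolding d_def by simp_all
    ultimately show ?case using 1 2 3 4 elim r unfolding real_norm_def by linarith
  qed
  then show "\<exists>no. \<forall>l\<ge>no. norm ((\<integral>x. indicator (B l) x * g (proc l x) \<partial>cond_meas M (A l))
      - measure (cond_meas M (A l)) (B l) * (\<integral>x. g (proc l x) \<partial>M) - 0) < r"
    unfolding I_def by (simp add: eventually_sequentially)
qed

text \<open>The future is averaged under \<open>M\<close> rather than under
  \<open>cond_meas M (A l)\<close>, because \<open>M\<close> is the measure with which the delayed
  images merge. For \<open>s = 1\<close> the quantity compares the two averages of the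
  future.\<close>

definition cov :: "((nat \<Rightarrow> 'b) \<Rightarrow> real) \<Rightarrow> ('b \<Rightarrow> real) \<Rightarrow> nat \<Rightarrow> real" where
  "cov g s l = (\<integral>x. s (\<psi> l x) * g (proc l x) \<partial>cond_meas M (A l))
      - (\<integral>x. s (\<psi> l x) \<partial>cond_meas M (A l)) * (\<integral>x. g (proc l x) \<partial>M)"

context
  fixes g :: "(nat \<Rightarrow> 'b) \<Rightarrow> real" and C :: real
  assumes G [measurable]: "\<And>l. (\<lambda>x. g (proc l x)) \<in> borel_measurable M"
    and gC: "\<And>y. \<bar>g y\<bar> \<le> C" and C: "C > 0"
begin

lemma \<mu>A_integrable:
  fixes f :: "'a \<Rightarrow> real"
  assumes "f \<in> borel_measurable M" "\<And>x. \<bar>f x\<bar> \<le> D"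
  shows "integrable (cond_meas M (A l)) f"
  using assms by (intro \<mu>A.integrable_const_bound[of _ D]) auto

text \<open>A bound by the mean of |s| allows the passage from the dense span of indicators to
  continuous functions, and disposes of events whose probability tends to 0.\<close>

lemma abs_cov_le:
  assumes s [measurable]: "s \<in> borel_measurable borel" and sD: "\<And>y. \<bar>s y\<bar> \<le> D"
  shows "\<bar>cov g s l\<bar> \<le> 2 * C * (\<integral>x. \<bar>s (\<psi> l x)\<bar> \<partial>cond_meas M (A l))"
proof -
  let ?N = "cond_meas M (A l)" and ?m = "\<integral>x. \<bar>s (\<psi> l x)\<bar> \<partial>cond_meas M (A l)"
  have D: "D \<ge> 0" using sD[of undefined] by linarith
  have si: "integrable ?N (\<lambda>x. s (\<psi> l x))" using sD by (intro \<mu>A_integrable[of _ D]) auto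
  have bound: "\<bar>s (\<psi> l x) * g (proc l x)\<bar> \<le> C * \<bar>s (\<psi> l x)\<bar>" for x
    using mult_right_mono[OF gC[of "proc l x"], of "\<bar>s (\<psi> l x)\<bar>"] by (simp add: abs_mult mult.commute)
  have sgi: "integrable ?N (\<lambda>x. s (\<psi> l x) * g (proc l x))"
  proof (rule \<mu>A_integrable[of _ "C * D"])
    show "\<bar>s (\<psi> l x) * g (proc l x)\<bar> \<le> C * D" for x
      using bound[of x] mult_left_mono[OF sD[of "\<psi> l x"], of C] C by linarith
  qed measurable
  have "\<bar>\<integral>x. s (\<psi> l x) * g (proc l x) \<partial>?N\<bar> \<le> (\<integral>x. \<bar>s (\<psi> l x) * g (proc l x)\<bar> \<partial>?N)"
    by (rule integral_abs_bound)
  also have "\<dots> \<le> (\<integral>x. C * \<bar>s (\<psi> l x)\<bar> \<partial>?N)" using si sgi bound by (intro integral_mono) auto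
  finally have 1: "\<bar>\<integral>x. s (\<psi> l x) * g (proc l x) \<partial>?N\<bar> \<le> C * ?m" by simp
  have "\<bar>\<integral>x. g (proc l x) \<partial>M\<bar> \<le> C" using gC by (intro abs_integral_le_const prob_space_axioms) auto
  moreover have "\<bar>\<integral>x. s (\<psi> l x) \<partial>?N\<bar> \<le> ?m" by (rule integral_abs_bound)
  ultimately have "\<bar>\<integral>x. s (\<psi> l x) \<partial>?N\<bar> * \<bar>\<integral>x. g (proc l x) \<partial>M\<bar> \<le> ?m * C"
    by (intro mult_mono') auto
  then have "\<bar>(\<integral>x. s (\<psi> l x) \<partial>?N) * (\<integral>x. g (proc l x) \<partial>M)\<bar> \<le> ?m * C" by (simp add: abs_mult)
  then show ?thesis using 1 unfolding cov_def by (simp add: algebra_simps)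
qed

lemma cov_add:
  assumes s [measurable]: "s \<in> borel_measurable borel" and sD: "\<And>y. \<bar>s y\<bar> \<le> D"
    and t [measurable]: "t \<in> borel_measurable borel" and tE: "\<And>y. \<bar>t y\<bar> \<le> E"
  shows "cov g (\<lambda>y. s y + t y) l = cov g s l + cov g t l"
proof -
  have sgi: "integrable (cond_meas M (A l)) (\<lambda>x. u (\<psi> l x) * g (proc l x))"
    if [measurable]: "u \<in> borel_measurable borel" and "\<And>y. \<bar>u y\<bar> \<le> D" for u :: "'b \<Rightarrow> real" and D
    using that(2) gC by (intro \<mu>A_integrable[of _ "D * C"]) (auto simp: abs_mult intro!: mult_mono')
  have ui: "integrable (cond_meas M (A l)) (\<lambda>x. u (\<psi> l x))"
    if [measurable]: "u \<in> borel_measurable borel" and "\<And>y. \<bar>u y\<bar> \<le> D" for u :: "'b \<Rightarrow> real" and D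
    using that(2) by (intro \<mu>A_integrable[of _ D]) auto
  show ?thesis unfolding cov_def
    using sgi[OF s sD] sgi[OF t tE] ui[OF s sD] ui[OF t tE] by (simp add: distrib_right)
qed

text \<open>Delays are given only for events of positive limit probability. If
  \<open>measure Q F = 0\<close>, then the negligible frontier and weak convergence make the
  probability of \<open>\<psi> l x \<in> F\<close> tend to 0, and the covariance with it.\<close>

lemma cov_indicator_tendsto:
  assumes F: "F \<in> \<F>"
  shows "cov g (indicator F) \<longlonglongrightarrow> 0"
proof (cases "measure Q F > 0")
  case True
  have [measurable]: "F \<in> sets borel" by (rule sets_\<F>[OF F])
  define B where "B l = A l \<inter> \<psi> l -` F \<inter> space M" for l
  have B [measurable]: "B l \<in> sets M" for l unfolding B_def by (rule sets_visit[OF F])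
  \<comment> \<open>The two indicators may differ outside \<open>A l\<close>, which the conditional
    measure does not charge.\<close>
  have ind: "AE x in cond_meas M (A l). indicator F (\<psi> l x) = (indicator (B l) x :: real)" for l
    using AE_cond_meas_mem[OF A[of l]] AE_space
    by eventually_elim (auto simp: B_def indicator_def)
  have "(\<integral>x. indicator F (\<psi> l x) * g (proc l x) \<partial>cond_meas M (A l)) =
      (\<integral>x. indicator (B l) x * g (proc l x) \<partial>cond_meas M (A l))" for l
    using ind[of l] by (intro integral_cong_AE) auto
  moreover have "(\<integral>x. indicator F (\<psi> l x) \<partial>cond_meas M (A l)) = measure (cond_meas M (A l)) (B l)" for l
  proof -
    have "(\<integral>x. indicator F (\<psi> l x) \<partial>cond_meas M (A l)) = (\<integral>x. indicator (B l) x \<partial>cond_meas M (A l) :: real)"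
      using ind[of l] by (intro integral_cong_AE) auto
    then show ?thesis using sets.sets_into_space[OF B] by (simp add: Int_absorb2)
  qed
  ultimately show ?thesis
    using visit_decorrelates[OF G gC C F True] unfolding cov_def B_def by simp
next
  case False
  have [measurable]: "F \<in> sets borel" by (rule sets_\<F>[OF F])
  have Q0: "measure Q F = 0" using False by (simp add: zero_less_measure_iff)
  have "(\<lambda>l. \<integral>x. \<bar>indicator F (\<psi> l x)\<bar> \<partial>cond_meas M (A l) :: real) \<longlonglongrightarrow> 0"
  proof (rule LIMSEQ_I)
    fix r :: real assume r: "r > 0"
    have "(\<integral>y. indicator F y \<partial>Q :: real) = 0" using Q0 Q_sets sets_eq_imp_space_eq[OF Q_sets] by simp
    moreover have "\<forall>\<^sub>F l in sequentially. (\<integral>x. indicator F (\<psi> l x) \<partial>cond_meas M (A l)) \<le> (\<integral>y. indicator F y \<partial>Q) + r / 2"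
    proof (rule weak_conv_law_eventually_integral_le[OF \<psi>_conv \<mu>A.prob_space_axioms _ Q Q_sets, where C = 1])
      show "AE y in Q. isCont (indicator F :: 'b \<Rightarrow> real) y"
        by (rule AE_isCont_indicator[OF Q Q_sets \<F>_bdry[OF F]])
    qed (use r in \<open>auto simp: indicator_def\<close>)
    ultimately have "\<forall>\<^sub>F l in sequentially. norm ((\<integral>x. \<bar>indicator F (\<psi> l x)\<bar> \<partial>cond_meas M (A l)) - (0::real)) < r"
    proof (elim eventually_mono)
      fix l
      assume "(\<integral>x. indicator F (\<psi> l x) \<partial>cond_meas M (A l)) \<le> (\<integral>y. indicator F y \<partial>Q) + r / 2"
        "(\<integral>y. indicator F y \<partial>Q :: real) = 0"
      moreover have "(\<integral>x. indicator F (\<psi> l x) \<partial>cond_meas M (A l)) \<ge> (0::real)" by simp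
      ultimately show "norm ((\<integral>x. \<bar>indicator F (\<psi> l x)\<bar> \<partial>cond_meas M (A l)) - (0::real)) < r" using r by simp
    qed
    then show "\<exists>no. \<forall>l\<ge>no. norm ((\<integral>x. \<bar>indicator F (\<psi> l x)\<bar> \<partial>cond_meas M (A l)) - (0::real)) < r"
      by (simp add: eventually_sequentially)
  qed
  from tendsto_mult_right_zero[OF this, of "2 * C"] show ?thesis
    using abs_cov_le[of "indicator F" 1]
    by (intro Lim_null_comparison[of "cov g (indicator F)"]) (auto simp: indicator_def)
qed

lemma cov_indicator_span_tendsto:
  assumes "indicator_span \<F> s"
  shows "cov g s \<longlonglongrightarrow> 0"
  using assms
proof (induction rule: indicator_span.induct)
  case (base F c)
  have "cov g (\<lambda>y. c * indicator F y) l = c * cov g (indicator F) l" for l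
    unfolding cov_def by (simp add: mult.assoc right_diff_distrib)
  then show ?case using tendsto_mult_right_zero[OF cov_indicator_tendsto[OF base], of c] by simp
next
  case (add s t)
  have sub: "\<F> \<subseteq> sets borel" using sets_\<F> by blast
  obtain D where D: "\<And>y. \<bar>s y\<bar> \<le> D" using indicator_span_bounded[OF add.hyps(1)] by blast
  obtain E where E: "\<And>y. \<bar>t y\<bar> \<le> E" using indicator_span_bounded[OF add.hyps(2)] by blast
  have "cov g (\<lambda>y. s y + t y) l = cov g s l + cov g t l" for l
    by (rule cov_add[OF indicator_span_measurable[OF add.hyps(1) sub] D indicator_span_measurable[OF add.hyps(2) sub] E])
  then show ?case using tendsto_add_zero[OF add.IH] by simp
qed

lemma cov_continuous_tendsto:
  assumes h: "continuous_on UNIV h"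
  shows "cov g h \<longlonglongrightarrow> 0"
proof (rule LIMSEQ_I)
  fix r :: real assume r: "r > 0"
  have sub: "\<F> \<subseteq> sets borel" using sets_\<F> by blast
  have Q_space: "space Q = UNIV" using sets_eq_imp_space_eq[OF Q_sets] by simp
  have hm [measurable]: "h \<in> borel_measurable borel" using h by (rule borel_measurable_continuous_onI)
  obtain D where D: "\<And>y. \<bar>h y\<bar> \<le> D"
    using bounded_range_of_compact_UNIV[OF cpt h] by (auto simp: bounded_iff)
  \<comment> \<open>The law of \<open>\<psi> l\<close> eventually sees the approximation error as at
    most 2 * e: one \<open>e\<close> from density in \<open>L1(Q)\<close>, one from weak
    convergence. The factor 2 * C of \<open>abs_cov_le\<close> turns this into r / 2.\<close>
  define e where "e = r / (8 * C)"
  have e: "e > 0" using r C by (simp add: e_def)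
  have "h \<in> borel_measurable Q" using hm Q_sets measurable_cong_sets by blast
  then have "integrable Q h" using D by (intro Q.integrable_const_bound[of _ D]) auto
  then obtain s where s: "indicator_span \<F> s" "(\<integral>y. \<bar>h y - s y\<bar> \<partial>Q) < e"
    using indicator_span_dense[OF Q, of \<F> h e] \<F>_Int \<F>_UNIV \<F>_gen Q_sets Q_space e by auto
  obtain E where E: "\<And>y. \<bar>s y\<bar> \<le> E" using indicator_span_bounded[OF s(1)] by blast
  have sm [measurable]: "s \<in> borel_measurable borel" by (rule indicator_span_measurable[OF s(1) sub])
  have hsD: "\<bar>h y - s y\<bar> \<le> D + E" for y using D[of y] E[of y] by linarith
  have "AE y in Q. isCont s y" by (rule AE_isCont_indicator_span[OF s(1) Q Q_sets \<F>_bdry])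
  then have isC: "AE y in Q. isCont (\<lambda>y. \<bar>h y - s y\<bar>) y"
    by eventually_elim (use h in \<open>auto intro!: continuous_intros simp: continuous_on_eq_continuous_at\<close>)
  have "\<forall>\<^sub>F l in sequentially. (\<integral>x. \<bar>h (\<psi> l x) - s (\<psi> l x)\<bar> \<partial>cond_meas M (A l)) \<le> (\<integral>y. \<bar>h y - s y\<bar> \<partial>Q) + e"
    using e hsD isC
    by (intro weak_conv_law_eventually_integral_le[OF \<psi>_conv \<mu>A.prob_space_axioms _ Q Q_sets, where C = "D + E"]) auto
  moreover have "\<forall>\<^sub>F l in sequentially. \<bar>cov g s l\<bar> < r / 2"
    using order_tendstoD(2)[OF tendsto_rabs_zero[OF cov_indicator_span_tendsto[OF s(1)]], of "r / 2"] r by simp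
  ultimately have "\<forall>\<^sub>F l in sequentially. norm (cov g h l - 0) < r"
  proof eventually_elim
    case (elim l)
    have "\<bar>cov g (\<lambda>y. h y - s y) l\<bar> \<le> 2 * C * (\<integral>x. \<bar>h (\<psi> l x) - s (\<psi> l x)\<bar> \<partial>cond_meas M (A l))"
      using hsD by (intro abs_cov_le) auto
    also have "\<dots> \<le> 2 * C * (2 * e)" using elim(1) s(2) C by (intro mult_left_mono) auto
    also have "\<dots> = r / 2" using C by (simp add: e_def)
    finally have 1: "\<bar>cov g (\<lambda>y. h y - s y) l\<bar> \<le> r / 2" .
    have "cov g (\<lambda>y. (h y - s y) + s y) l = cov g (\<lambda>y. h y - s y) l + cov g s l"
      using hsD E by (intro cov_add[of _ "D + E" _ E]) auto
    then have "cov g h l = cov g (\<lambda>y. h y - s y) l + cov g s l" by simp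
    then show ?case using 1 elim(2) unfolding real_norm_def by linarith
  qed
  then show "\<exists>no. \<forall>l\<ge>no. norm (cov g h l - 0) < r" by (simp add: eventually_sequentially)
qed

text \<open>Decorrelation from a constant. This is the bridge between the conditional measures and
  \<open>M\<close>, needed both to close the induction on coordinates and to obtain the convergence
  under \<open>M\<close>.\<close>

lemma integral_proc_\<mu>A_tendsto:
  "(\<lambda>l. (\<integral>x. g (proc l x) \<partial>cond_meas M (A l)) - (\<integral>x. g (proc l x) \<partial>M)) \<longlonglongrightarrow> 0"
proof -
  have "measure (cond_meas M (A l)) (space M) = 1" for l using \<mu>A.prob_space[of l] by simp
  then have "cov g (\<lambda>_. 1) = (\<lambda>l. (\<integral>x. g (proc l x) \<partial>cond_meas M (A l)) - (\<integral>x. g (proc l x) \<partial>M))"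
    unfolding cov_def by simp
  then show ?thesis using cov_continuous_tendsto[of "\<lambda>_. 1"] by simp
qed

end

lemma continuous_prod_bound:
  fixes h :: "nat \<Rightarrow> 'b \<Rightarrow> real"
  assumes "\<And>i. continuous_on UNIV (h i)"
  obtains C where "C > 0" "\<And>y. \<bar>\<Prod>i<k. h i (y i)\<bar> \<le> C"
proof -
  obtain B where B: "\<And>y. \<bar>\<Prod>i<k. h i (y i)\<bar> \<le> B"
    using coord_span_bounded[OF cpt coord_span.prod[of h k]] assms by blast
  have "\<bar>\<Prod>i<k. h i (y i)\<bar> \<le> \<bar>B\<bar> + 1" for y using B[of y] by linarith
  then show thesis by (intro that[of "\<bar>B\<bar> + 1"]) auto
qed

text \<open>\<open>proc l\<close> is \<open>proc0 l\<close> after one application of the return map,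
  which preserves the conditional measure.\<close>

lemma integral_prod_proc:
  fixes h :: "nat \<Rightarrow> 'b \<Rightarrow> real"
  assumes h: "\<And>i. continuous_on UNIV (h i)"
  shows "(\<integral>x. (\<Prod>i<k. h i (proc l x i)) \<partial>cond_meas M (A l)) =
    (\<integral>x. (\<Prod>i<k. h i (proc0 l x i)) \<partial>cond_meas M (A l))"
  unfolding loc_proc_eq_loc_proc0
  by (rule integral_ret_map[OF A A_pos, where f = "\<lambda>x. \<Prod>i<k. h i (proc0 l x i)"])
    (rule coord_span_measurable[OF coord_span.prod[OF h] proc0_measurable])

text \<open>Coordinate 0 is split off, and the vanishing covariance separates it from the later
  ones. The induction hypothesis concerns \<open>proc0\<close> under the conditional measure;
  invariance under the return map restates it for \<open>proc\<close>, and the bridge to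
  \<open>M\<close> then gives the limit of the second factor.\<close>

lemma integral_prod_proc0_tendsto:
  fixes h :: "nat \<Rightarrow> 'b \<Rightarrow> real"
  assumes "\<And>i. continuous_on UNIV (h i)"
  shows "(\<lambda>l. \<integral>x. (\<Prod>i<k. h i (proc0 l x i)) \<partial>cond_meas M (A l)) \<longlonglongrightarrow> (\<Prod>i<k. \<integral>y. h i y \<partial>Q)"
  using assms
proof (induction k arbitrary: h)
  case 0
  show ?case by (simp add: \<mu>A.prob_space[simplified])
next
  case (Suc k)
  define g where "g y = (\<Prod>i<k. h (Suc i) (y i))" for y :: "nat \<Rightarrow> 'b"
  obtain C where C: "C > 0" "\<And>y. \<bar>g y\<bar> \<le> C"
    using continuous_prod_bound[of "\<lambda>i. h (Suc i)" k] Suc.prems unfolding g_def by metis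
  have G: "(\<lambda>x. g (proc l x)) \<in> borel_measurable M" for l
    unfolding g_def by (rule coord_span_measurable[OF coord_span.prod[OF Suc.prems] proc_measurable])
  have "(\<lambda>l. \<integral>x. g (proc l x) \<partial>cond_meas M (A l)) \<longlonglongrightarrow> (\<Prod>i<k. \<integral>y. h (Suc i) y \<partial>Q)"
    unfolding g_def integral_prod_proc[of "\<lambda>i. h (Suc i)", OF Suc.prems]
    by (rule Suc.IH[of "\<lambda>i. h (Suc i)", OF Suc.prems])
  from tendsto_diff[OF this integral_proc_\<mu>A_tendsto[OF G C(2,1)]]
  have 1: "(\<lambda>l. \<integral>x. g (proc l x) \<partial>M) \<longlonglongrightarrow> (\<Prod>i<k. \<integral>y. h (Suc i) y \<partial>Q)" by simp
  have 2: "(\<lambda>l. \<integral>x. h 0 (\<psi> l x) \<partial>cond_meas M (A l)) \<longlonglongrightarrow> (\<integral>y. h 0 y \<partial>Q)"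
    using \<psi>_conv Suc.prems[of 0] bounded_range_of_compact_UNIV[OF cpt Suc.prems[of 0]]
    unfolding weak_conv_law_def by blast
  have "(\<Prod>i<Suc k. h i (proc0 l x i)) = h 0 (\<psi> l x) * g (proc l x)" for l x
    unfolding g_def by (subst prod.lessThan_Suc_shift) (simp add: loc_proc0_def loc_proc_def)
  then have eq: "(\<integral>x. (\<Prod>i<Suc k. h i (proc0 l x i)) \<partial>cond_meas M (A l)) =
      cov g (h 0) l + (\<integral>x. h 0 (\<psi> l x) \<partial>cond_meas M (A l)) * (\<integral>x. g (proc l x) \<partial>M)" for l
    unfolding cov_def by simp
  have "(\<lambda>l. \<integral>x. (\<Prod>i<Suc k. h i (proc0 l x i)) \<partial>cond_meas M (A l)) \<longlonglongrightarrow>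
      0 + (\<integral>y. h 0 y \<partial>Q) * (\<Prod>i<k. \<integral>y. h (Suc i) y \<partial>Q)"
    unfolding eq by (intro tendsto_add tendsto_mult 1 2 cov_continuous_tendsto[OF G C(2,1) Suc.prems])
  then show ?case by (subst prod.lessThan_Suc_shift) simp
qed

lemma integral_prod_proc_tendsto:
  fixes h :: "nat \<Rightarrow> 'b \<Rightarrow> real"
  assumes h: "\<And>i. continuous_on UNIV (h i)"
  shows "(\<lambda>l. \<integral>x. (\<Prod>i<k. h i (proc l x i)) \<partial>M) \<longlonglongrightarrow> (\<Prod>i<k. \<integral>y. h i y \<partial>Q)"
proof -
  obtain C where C: "C > 0" "\<And>y. \<bar>\<Prod>i<k. h i (y i)\<bar> \<le> C"
    using continuous_prod_bound[of h k] h by metis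
  have G: "(\<lambda>x. \<Prod>i<k. h i (proc l x i)) \<in> borel_measurable M" for l
    by (rule coord_span_measurable[OF coord_span.prod[OF h] proc_measurable])
  have "(\<lambda>l. \<integral>x. (\<Prod>i<k. h i (proc l x i)) \<partial>cond_meas M (A l)) \<longlonglongrightarrow> (\<Prod>i<k. \<integral>y. h i y \<partial>Q)"
    unfolding integral_prod_proc[of h, OF h] by (rule integral_prod_proc0_tendsto[OF h])
  from tendsto_diff[OF this integral_proc_\<mu>A_tendsto[where g = "\<lambda>y. \<Prod>i<k. h i (y i)", OF G C(2,1)]]
  show ?thesis by simp
qed

lemma integral_prod_PiM:
  fixes h :: "nat \<Rightarrow> 'b \<Rightarrow> real"
  assumes h: "\<And>i. continuous_on UNIV (h i)"
  shows "(\<integral>y. (\<Prod>i<k. h i (y i)) \<partial>PiM UNIV (\<lambda>_. Q)) = (\<Prod>i<k. \<integral>y. h i y \<partial>Q)"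
proof (rule integral_PiM_prod[OF Q])
  fix i
  obtain D where D: "\<And>y. \<bar>h i y\<bar> \<le> D"
    using bounded_range_of_compact_UNIV[OF cpt h[of i]] by (auto simp: bounded_iff)
  have "h i \<in> borel_measurable Q"
    using borel_measurable_continuous_onI[OF h[of i]] Q_sets measurable_cong_sets by blast
  then show "integrable Q (h i)" using D by (intro Q.integrable_const_bound[of _ D]) auto
qed

lemma PiM_coordinate_measurable: "(\<lambda>y. y n) \<in> borel_measurable (PiM UNIV (\<lambda>_::nat. Q))"
  using measurable_component_singleton[of n UNIV "\<lambda>_. Q"] Q_sets measurable_cong_sets by blast

theorem proc0_weak_conv:
  "weak_conv_law (\<lambda>l. cond_meas M (A l)) proc0 (PiM UNIV (\<lambda>_. Q))"
proof (rule weak_conv_law_if_coord_prods[OF cpt \<mu>A.prob_space_axioms _ prob_space_PiM[OF Q] PiM_coordinate_measurable])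
  show "(\<lambda>x. proc0 l x n) \<in> borel_measurable (cond_meas M (A l))" for l n
    using proc0_measurable by simp
qed (simp add: integral_prod_PiM integral_prod_proc0_tendsto)

theorem proc_weak_conv: "weak_conv_law (\<lambda>l. M) proc (PiM UNIV (\<lambda>_. Q))"
  by (rule weak_conv_law_if_coord_prods[OF cpt prob_space_axioms proc_measurable prob_space_PiM[OF Q] PiM_coordinate_measurable])
    (simp add: integral_prod_PiM integral_prod_proc_tendsto)

end

section \<open>Discarding finitely many indices and assembling the theorem\<close>

lemma weak_conv_law_offset:
  fixes X :: "nat \<Rightarrow> 'a \<Rightarrow> 'c::topological_space"
  assumes "weak_conv_law (\<lambda>l. P (l + n)) (\<lambda>l. X (l + n)) R"
  shows "weak_conv_law P X R"
  unfolding weak_conv_law_def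
proof safe
  fix g :: "'c \<Rightarrow> real" assume "continuous_on UNIV g" "bounded (range g)"
  then have "(\<lambda>l. \<integral>x. g (X (l + n) x) \<partial>P (l + n)) \<longlonglongrightarrow> (\<integral>y. g y \<partial>R)"
    using assms unfolding weak_conv_law_def by blast
  then show "(\<lambda>l. \<integral>x. g (X l x) \<partial>P l) \<longlonglongrightarrow> (\<integral>y. g y \<partial>R)" by (rule LIMSEQ_offset)
qed

lemma weak_conv_law_ignore_initial_segment:
  fixes X :: "nat \<Rightarrow> 'a \<Rightarrow> 'c::topological_space"
  assumes "weak_conv_law P X R"
  shows "weak_conv_law (\<lambda>l. P (l + n)) (\<lambda>l. X (l + n)) R"
  unfolding weak_conv_law_def
proof safe
  fix g :: "'c \<Rightarrow> real" assume "continuous_on UNIV g" "bounded (range g)"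
  then have "(\<lambda>l. \<integral>x. g (X l x) \<partial>P l) \<longlonglongrightarrow> (\<integral>y. g y \<partial>R)"
    using assms unfolding weak_conv_law_def by blast
  then show "(\<lambda>l. \<integral>x. g (X (l + n) x) \<partial>P (l + n)) \<longlonglongrightarrow> (\<integral>y. g y \<partial>R)"
    by (rule LIMSEQ_ignore_initial_segment)
qed

theorem mainTheorem6:
  fixes M :: "'a measure" and T :: "'a \<Rightarrow> 'a"
    and A :: "nat \<Rightarrow> 'a set"
    and \<psi> :: "nat \<Rightarrow> 'a \<Rightarrow> 'b::metric_space"
    and Q :: "'b measure"
    and Bpi :: "'b set set"
  assumes erg: "ergodic_pps M T"
    and A_sets: "\<And>l. A l \<in> sets M"
    and A_pos: "\<And>l. measure M (A l) > 0"
    and A_rare: "(\<lambda>l. measure M (A l)) \<longlonglongrightarrow> 0"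
    and F_compact: "compact (UNIV :: 'b set)"
    and \<psi>_meas: "\<And>l. \<psi> l \<in> measurable (restrict_space M (A l)) borel"
    and Q_prob: "prob_space Q" and Q_sets: "sets Q = sets borel"
    and \<psi>_conv: "weak_conv_law (\<lambda>l. cond_meas M (A l)) \<psi> Q"
    and Bpi_stable: "Int_stable Bpi"
    and Bpi_gen: "sigma_sets UNIV Bpi = sets (borel :: 'b measure)"
    and Bpi_UNIV: "UNIV \<in> Bpi"
    and Bpi_bdry: "\<And>F. F \<in> Bpi \<Longrightarrow> measure Q (frontier F) = 0"
    and hyp:
      "(\<forall>F\<in>Bpi. measure Q F > 0 \<longrightarrow>
          (\<exists>\<tau> K. (\<forall>l. \<tau> l \<in> measurable M (count_space UNIV)) \<and> P_compact M K \<and>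
             (\<lambda>l. measure (cond_meas (cond_meas M (A l)) (A l \<inter> \<psi> l -` F \<inter> space M))
                     {x \<in> space M. enat (\<tau> l x) < ret_time T (A l) x}) \<longlonglongrightarrow> 1 \<and>
             (\<forall>l. push_tau T (\<tau> l)
                    (cond_meas (cond_meas M (A l)) (A l \<inter> \<psi> l -` F \<inter> space M)) \<in> K)))
       \<or>
       (\<forall>\<epsilon>>0. \<exists>\<nu>. (\<forall>l. \<nu> l \<in> Pmeas M \<and> dP M (\<nu> l) (cond_meas M (A l)) < \<epsilon>) \<and>
          (\<forall>F\<in>Bpi. measure Q F > 0 \<longrightarrow>
             (\<exists>K \<nu>F \<tau>. P_compact M K \<and> (\<forall>l. \<nu>F l \<in> Pmeas M) \<and>
                (\<lambda>l. dP M (\<nu>F l) (cond_meas (\<nu> l) (A l \<inter> \<psi> l -` F \<inter> space M))) \<longlonglongrightarrow> 0 \<and>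
                (\<forall>l. \<tau> l \<in> measurable M (count_space UNIV)) \<and>
                (\<lambda>l. measure (\<nu>F l) {x \<in> space M. enat (\<tau> l x) < ret_time T (A l) x})
                   \<longlonglongrightarrow> 1 \<and>
                (\<forall>l. push_tau T (\<tau> l) (\<nu>F l) \<in> K))))"
  shows "weak_conv_law (\<lambda>l. cond_meas M (A l)) (\<lambda>l. loc_proc0 T (A l) (\<psi> l))
            (PiM UNIV (\<lambda>_. Q))
       \<and> weak_conv_law (\<lambda>l. M) (\<lambda>l. loc_proc T (A l) (\<psi> l)) (PiM UNIV (\<lambda>_. Q))"
proof -
  interpret ergodic_system M T using erg by (simp add: ergodic_system_iff)
  let ?\<mu> = "\<lambda>l. cond_meas M (A l)" and ?B = "\<lambda>l F. A l \<inter> \<psi> l -` F \<inter> space M"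
  have \<mu>_prob: "prob_space (?\<mu> l)" for l by (rule prob_space_cond_meas[OF A_sets A_pos])
  have \<mu>_P: "?\<mu> l \<in> Pmeas M" for l
    unfolding Pmeas_def using \<mu>_prob absolutely_continuous_cond_meas[OF A_sets] by simp
  \<comment> \<open>Conditional measures carry the \<sigma>-algebra of \<open>M\<close>, so this is
    measurability on the whole space and not only on \<open>A l\<close>.\<close>
  obtain L where L: "\<And>l. l \<ge> L \<Longrightarrow> \<psi> l \<in> borel_measurable M"
    using weak_conv_law_eventually_measurable[OF F_compact \<psi>_conv Q_prob Q_sets]
    by (auto cong: measurable_cong_sets)
  have Bpi_borel: "F \<in> sets borel" if "F \<in> Bpi" for F using Bpi_gen that by auto
  \<comment> \<open>Visit events lie inside \<open>A l\<close>, so measurability on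
    \<open>A l\<close> suffices, and this holds for the indices below \<open>L\<close> as
    well.\<close>
  have B_sets: "?B l F \<in> sets M" if "F \<in> Bpi" for l F
  proof -
    have "\<psi> l -` F \<inter> space (restrict_space M (A l)) \<in> sets (restrict_space M (A l))"
      by (rule measurable_sets[OF \<psi>_meas Bpi_borel[OF that]])
    moreover have "\<psi> l -` F \<inter> space (restrict_space M (A l)) = ?B l F"
      by (auto simp: space_restrict_space)
    moreover have "sets (restrict_space M (A l)) \<subseteq> sets M"
      using A_sets[of l] by (auto simp: sets_restrict_space)
    ultimately show ?thesis by auto
  qed
  have escape: "\<forall>\<epsilon>>0. \<exists>\<nu>. (\<forall>l. \<nu> l \<in> Pmeas M \<and> dP M (\<nu> l) (?\<mu> l) < \<epsilon>) \<and>
          (\<forall>F\<in>Bpi. measure Q F > 0 \<longrightarrow>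
             (\<exists>K \<nu>F \<tau>. P_compact M K \<and> (\<forall>l. \<nu>F l \<in> Pmeas M) \<and>
                (\<lambda>l. dP M (\<nu>F l) (cond_meas (\<nu> l) (?B l F))) \<longlonglongrightarrow> 0 \<and>
                (\<forall>l. \<tau> l \<in> measurable M (count_space UNIV)) \<and>
                (\<lambda>l. measure (\<nu>F l) {x \<in> space M. enat (\<tau> l x) < ret_time T (A l) x})
                   \<longlonglongrightarrow> 1 \<and>
                (\<forall>l. push_tau T (\<tau> l) (\<nu>F l) \<in> K)))"
    using hyp
  proof
    assume hyp1: "\<forall>F\<in>Bpi. measure Q F > 0 \<longrightarrow>
          (\<exists>\<tau> K. (\<forall>l. \<tau> l \<in> measurable M (count_space UNIV)) \<and> P_compact M K \<and>
             (\<lambda>l. measure (cond_meas (?\<mu> l) (?B l F))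
                     {x \<in> space M. enat (\<tau> l x) < ret_time T (A l) x}) \<longlonglongrightarrow> 1 \<and>
             (\<forall>l. push_tau T (\<tau> l) (cond_meas (?\<mu> l) (?B l F)) \<in> K))"
    show ?thesis
    \<comment> \<open>The first form of the hypothesis is the second with the conditional measures
      themselves as reference measures and all distances equal to 0.\<close>
    proof (intro allI impI exI[of _ ?\<mu>] conjI ballI)
      fix F assume F: "F \<in> Bpi" "measure Q F > 0"
      obtain \<tau> K where \<tau>: "\<forall>l. \<tau> l \<in> measurable M (count_space UNIV)" and K: "P_compact M K"
        and lim: "(\<lambda>l. measure (cond_meas (?\<mu> l) (?B l F))
                     {x \<in> space M. enat (\<tau> l x) < ret_time T (A l) x}) \<longlonglongrightarrow> 1"
        and push: "\<forall>l. push_tau T (\<tau> l) (cond_meas (?\<mu> l) (?B l F)) \<in> K"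
        using hyp1[rule_format, OF F] by blast
      have "cond_meas (?\<mu> l) (?B l F) \<in> Pmeas M" for l
      proof -
        interpret \<mu>: prob_space "?\<mu> l" by (rule \<mu>_prob)
        have \<tau>_meas [measurable]: "\<tau> l \<in> measurable M (count_space UNIV)" using \<tau> by blast
        have pow: "(\<lambda>x. (T ^^ \<tau> l x) x) \<in> measurable M M"
          by (rule measurable_compose_countable[where f = "\<lambda>n x. (T ^^ n) x"]) measurable
        \<comment> \<open>For some l the visit event might be null, which would make the conditional
          measure zero. Membership of its image in \<open>K\<close> excludes this, since
          \<open>K\<close> consists of probabilities and images preserve total mass.\<close>
        have "prob_space (push_tau T (\<tau> l) (cond_meas (?\<mu> l) (?B l F)))"
          using push K unfolding P_compact_def Pmeas_def by blast
        then have "prob_space (cond_meas (?\<mu> l) (?B l F))"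
          unfolding push_tau_def
          by (rule prob_space_distrD[rotated]) (use pow in \<open>simp cong: measurable_cong_sets\<close>)
        moreover have "absolutely_continuous M (cond_meas (?\<mu> l) (?B l F))"
          using absolutely_continuous_cond_meas[OF A_sets[of l]]
            \<mu>.absolutely_continuous_cond_meas[of "?B l F"] B_sets[OF F(1)]
          unfolding absolutely_continuous_def by auto
        ultimately show ?thesis unfolding Pmeas_def by simp
      qed
      then show "\<exists>K \<nu>F \<tau>. P_compact M K \<and> (\<forall>l. \<nu>F l \<in> Pmeas M) \<and>
                (\<lambda>l. dP M (\<nu>F l) (cond_meas (?\<mu> l) (?B l F))) \<longlonglongrightarrow> 0 \<and>
                (\<forall>l. \<tau> l \<in> measurable M (count_space UNIV)) \<and>
                (\<lambda>l. measure (\<nu>F l) {x \<in> space M. enat (\<tau> l x) < ret_time T (A l) x})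
                   \<longlonglongrightarrow> 1 \<and>
                (\<forall>l. push_tau T (\<tau> l) (\<nu>F l) \<in> K)"
        using \<tau> K lim push
        by (intro exI[of _ K] exI[of _ "\<lambda>l. cond_meas (?\<mu> l) (?B l F)"] exI[of _ \<tau>]) simp
    qed (simp_all add: \<mu>_P)
  qed
  \<comment> \<open>All hypotheses survive a shift of the index by \<open>L\<close>, and the two
    limits are insensitive to it.\<close>
  interpret shifted: rare_observables M T "\<lambda>l. A (l + L)" "\<lambda>l. \<psi> (l + L)" Q Bpi
  proof (rule rare_observables.intro[OF ergodic_system_axioms], rule rare_observables_axioms.intro)
    show "(\<lambda>l. measure M (A (l + L))) \<longlonglongrightarrow> 0" by (rule LIMSEQ_ignore_initial_segment[OF A_rare])
    show "weak_conv_law (\<lambda>l. cond_meas M (A (l + L))) (\<lambda>l. \<psi> (l + L)) Q"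
      by (rule weak_conv_law_ignore_initial_segment[OF \<psi>_conv])
    show "\<psi> (l + L) \<in> borel_measurable M" for l by (rule L) simp
    show "measure Q (frontier F) = 0" if "F \<in> Bpi" for F using that by (rule Bpi_bdry)
    fix \<epsilon> :: real assume \<epsilon>: "\<epsilon> > 0"
    obtain \<nu> where \<nu>: "\<forall>l. \<nu> l \<in> Pmeas M \<and> dP M (\<nu> l) (?\<mu> l) < \<epsilon>"
      and \<nu>F: "\<forall>F\<in>Bpi. measure Q F > 0 \<longrightarrow>
             (\<exists>K \<nu>F \<tau>. P_compact M K \<and> (\<forall>l. \<nu>F l \<in> Pmeas M) \<and>
                (\<lambda>l. dP M (\<nu>F l) (cond_meas (\<nu> l) (?B l F))) \<longlonglongrightarrow> 0 \<and>
                (\<forall>l. \<tau> l \<in> measurable M (count_space UNIV)) \<and>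
                (\<lambda>l. measure (\<nu>F l) {x \<in> space M. enat (\<tau> l x) < ret_time T (A l) x})
                   \<longlonglongrightarrow> 1 \<and>
                (\<forall>l. push_tau T (\<tau> l) (\<nu>F l) \<in> K))"
      using escape[rule_format, OF \<epsilon>] by (elim exE conjE) (rule that)
    show "\<exists>\<nu>. (\<forall>l. \<nu> l \<in> Pmeas M \<and> dP M (\<nu> l) (?\<mu> (l + L)) < \<epsilon>) \<and>
          (\<forall>F\<in>Bpi. measure Q F > 0 \<longrightarrow>
             (\<exists>K \<nu>F \<tau>. P_compact M K \<and> (\<forall>l. \<nu>F l \<in> Pmeas M) \<and>
                (\<lambda>l. dP M (\<nu>F l) (cond_meas (\<nu> l) (?B (l + L) F))) \<longlonglongrightarrow> 0 \<and>
                (\<forall>l. \<tau> l \<in> measurable M (count_space UNIV)) \<and>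
                (\<lambda>l. measure (\<nu>F l) {x \<in> space M. enat (\<tau> l x) < ret_time T (A (l + L)) x})
                   \<longlonglongrightarrow> 1 \<and>
                (\<forall>l. push_tau T (\<tau> l) (\<nu>F l) \<in> K)))"
    proof (intro exI[of _ "\<lambda>l. \<nu> (l + L)"] conjI ballI impI)
      show "\<forall>l. \<nu> (l + L) \<in> Pmeas M \<and> dP M (\<nu> (l + L)) (?\<mu> (l + L)) < \<epsilon>" using \<nu> by blast
      fix F assume F: "F \<in> Bpi" "measure Q F > 0"
      obtain K \<nu>F \<tau> where *: "P_compact M K" "\<forall>l. \<nu>F l \<in> Pmeas M"
          "(\<lambda>l. dP M (\<nu>F l) (cond_meas (\<nu> l) (?B l F))) \<longlonglongrightarrow> 0"
          "\<forall>l. \<tau> l \<in> measurable M (count_space UNIV)"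
          "(\<lambda>l. measure (\<nu>F l) {x \<in> space M. enat (\<tau> l x) < ret_time T (A l) x}) \<longlonglongrightarrow> 1"
          "\<forall>l. push_tau T (\<tau> l) (\<nu>F l) \<in> K"
        using \<nu>F[rule_format, OF F] by blast
      show "\<exists>K \<nu>F \<tau>. P_compact M K \<and> (\<forall>l. \<nu>F l \<in> Pmeas M) \<and>
                (\<lambda>l. dP M (\<nu>F l) (cond_meas (\<nu> (l + L)) (?B (l + L) F))) \<longlonglongrightarrow> 0 \<and>
                (\<forall>l. \<tau> l \<in> measurable M (count_space UNIV)) \<and>
                (\<lambda>l. measure (\<nu>F l) {x \<in> space M. enat (\<tau> l x) < ret_time T (A (l + L)) x})
                   \<longlonglongrightarrow> 1 \<and>
                (\<forall>l. push_tau T (\<tau> l) (\<nu>F l) \<in> K)"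
        using * LIMSEQ_ignore_initial_segment[OF *(3), of L] LIMSEQ_ignore_initial_segment[OF *(5), of L]
        by (intro exI[of _ K] exI[of _ "\<lambda>l. \<nu>F (l + L)"] exI[of _ "\<lambda>l. \<tau> (l + L)"]) blast
    qed
  qed (rule A_sets A_pos F_compact Q_prob Q_sets Bpi_stable Bpi_gen Bpi_UNIV)+
  show ?thesis
    using weak_conv_law_offset[of ?\<mu> L "\<lambda>l. loc_proc0 T (A l) (\<psi> l)", OF shifted.proc0_weak_conv]
      weak_conv_law_offset[of "\<lambda>_. M" L "\<lambda>l. loc_proc T (A l) (\<psi> l)", OF shifted.proc_weak_conv] by blast
qed

end
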